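(* Let $m,d\ge1$ and $2\le k_0<k$ be integers. In the disk-graph setting described in the context, with $t_n^m\sim n^{-k/(k-1)}$, let $\Gamma_0$ be a feasible connected graph of order $k_0$, and let $\Gamma_1,\dots,\Gamma_d$ be pairwise non-isomorphic feasible connected graphs of order $k$. Let $$V_n=(G'_n(\Gamma_1),\dots,G'_n(\Gamma_d),\tilde G'_n(\Gamma_0)),\qquad V'_n=(G'_n(\Gamma_1),\dots,G'_n(\Gamma_d)),\quad n\ge1.$$ For every $n$ and $j=1,\dots,d$ set $\lambda_{j,n}=\mathbb E[G'_n(\Gamma_j)]$. Let $N\sim\mathscr N(0,1)$ and $\mathbf X_{d,n}\sim\mathrm{Po}_d(\lambda_{1,n},\dots,\lambda_{d,n})$ be independent, and write $H_n=(\mathbf X_{d,n},N)$. (a) There exist constants $A$ and $B$, independent of $n$, such that $$d_\star(V_n,H_n)\le A\sqrt{nt_n^m}+Bn^{-\frac{k-k_0}{4(k-1)}}=O\big(n^{-\frac1{2(k-1)}}+n^{-\frac{k-k_0}{4(k-1)}}\big).$$ (b) Let $\mathbf X_d\sim\mathrm{Po}_d(a_1,\dots,a_d)$ be independent of $N$, where $a_j=\lim_{n\to\infty}\mathbb E[G'_n(\Gamma_j)]>0$, and set $H=(\mathbf X_d,N)$. Then, as $n\to\infty$, $V_n$ converges in distribution to $H$. (c) There exists a constant $C$, independent of $n$, such that $$d_{TV}(V'_n,\mathbf X_{d,n})\le C\sqrt{nt_n^m}=O\big(n^{-\frac1{2(k-1)}}\big).$$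
   Context: Setting. $f$ is a bounded continuous probability density on $\mathbb R^m$; $Y=\{Y_i:i\ge1\}$ are i.i.d. $\mathbb R^m$-valued random variables with density $f$; $N(n)$ is a Poisson random variable with mean $n$, independent of $Y$. $\{t_n\}$ is a strictly decreasing sequence of positive numbers with $t_n\to0$. For positive sequences, $b_n\sim a_n$ means $a_n/b_n\to1$. $G'(Y;t_n)$ is the random disk graph with vertex set $\{Y_1,\dots,Y_{N(n)}\}$ in which $Y_i,Y_j$ are joined by an edge iff $\|Y_i-Y_j\|_{\mathbb R^m}\in(0,t_n)$ (empty if $N(n)=0$). For a connected graph $\Gamma$ of order $p$, $G'_n(\Gamma)$ is the number of induced subgraphs of $G'(Y;t_n)$ isomorphic to $\Gamma$, i.e. the number of subsets $\{i_1,\dots,i_p\}\subset\{1,\dots,N(n)\}$ such that the restriction of $G'(Y;t_n)$ to $\{Y_{i_1},\dots,Y_{i_p}\}$ is isomorphic to $\Gamma$. $\Gamma$ is feasible (for every $n$) if, for every $n$, the probability that the disk graph with radius $t_n$ on $\{Y_1,\dots,Y_p\}$ is isomorphic to $\Gamma$ is strictly positive. $\tilde G'_n(\Gamma_0)=(G'_n(\Gamma_0)-\mathbb E[G'_n(\Gamma_0)])/\mathrm{Var}(G'_n(\Gamma_0))^{1/2}$. It is known that, in this regime, the limits $a_j=\lim_n\mathbb E[G'_n(\Gamma_j)]$ exist and are strictly positive for $j=1,\dots,d$. $\mathrm{Po}_d(\lambda_1,\dots,\lambda_d)$ is the law of $d$ independent Poisson variables with parameters $\lambda_i$. $d_{TV}(\mathbf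 A,\mathbf B)=\sup_{E\subseteq\mathbb Z_+^d}|\mathbb P(\mathbf A\in E)-\mathbb P(\mathbf B\in E)|$. $d_\star=d_{\mathscr H_1}$: $d_{\mathscr H_1}(X,Y)=\sup_\psi|\mathbb E\psi(X)-\mathbb E\psi(Y)|$ over all $\psi:\mathbb Z_+^d\times\mathbb R\to\mathbb R$ with $|\psi|\le1$ such that $x\mapsto\psi(j_1,\dots,j_d;x)$ is Lipschitz with constant $\le1$ for all $j_1,\dots,j_d$. *)

theory Defs
  imports "HOL-Probability.Probability" "Graph_Theory.Digraph_Isomorphism"
begin

text \<open>
  Finite simple graphs are the symmetric, loop-free pair digraphs (locale \<^locale>\<open>pair_graph\<close>) of
  the entry Graph_Theory; graph isomorphism is \<^const>\<open>digraph_iso\<close> and connectedness is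
  \<^const>\<open>Digraph_Component.connected\<close> (not the topological \<^const>\<open>Topological_Spaces.connected\<close>).
\<close>

definition disk_graph :: "real \<Rightarrow> 'a::real_normed_vector set \<Rightarrow> 'a pair_pre_digraph" where
  "disk_graph r V = \<lparr>pverts = V, parcs = {(x, y) \<in> V \<times> V. norm (x - y) \<in> {0<..<r}}\<rparr>"

text \<open>
  The induced subgraphs of the disk graph on \<open>y 1, \<dots>, y n\<close> are counted through the index sets of
  their vertices. If two of the chosen points coincide, the restriction has fewer vertices than
  \<open>\<Gamma>\<close>, so such an index set is not counted; for points with a density this is a null event.
\<close>

definition induced_count ::
  "real \<Rightarrow> (nat \<Rightarrow> 'a::real_normed_vector) \<Rightarrow> nat \<Rightarrow> 'v pair_pre_digraph \<Rightarrow> nat" where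
  "induced_count r y n \<Gamma> = card {I. I \<subseteq> {1..n} \<and> card I = card (pverts \<Gamma>) \<and>
     digraph_iso (induce_subgraph (with_proj (disk_graph r (y ` {1..n}))) (y ` I)) (with_proj \<Gamma>)}"

text \<open>
  Below, \<open>Y i \<omega>\<close> (for \<open>i \<ge> 1\<close>) are the random points, \<open>N n \<omega>\<close> is the random number of points of the
  \<open>n\<close>-th graph and \<open>t n\<close> is its radius. The index \<open>n = 0\<close> plays no role.
\<close>

definition disk_count ::
  "(nat \<Rightarrow> 'w \<Rightarrow> 'a::real_normed_vector) \<Rightarrow> (nat \<Rightarrow> 'w \<Rightarrow> nat) \<Rightarrow> (nat \<Rightarrow> real) \<Rightarrow>
    'v pair_pre_digraph \<Rightarrow> nat \<Rightarrow> 'w \<Rightarrow> nat" where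
  "disk_count Y N t \<Gamma> n \<omega> = induced_count (t n) (\<lambda>i. Y i \<omega>) (N n \<omega>) \<Gamma>"

definition mean_count ::
  "'w measure \<Rightarrow> (nat \<Rightarrow> 'w \<Rightarrow> 'a::real_normed_vector) \<Rightarrow> (nat \<Rightarrow> 'w \<Rightarrow> nat) \<Rightarrow> (nat \<Rightarrow> real) \<Rightarrow>
    'v pair_pre_digraph \<Rightarrow> nat \<Rightarrow> real" where
  "mean_count M Y N t \<Gamma> n = integral\<^sup>L M (\<lambda>\<omega>. real (disk_count Y N t \<Gamma> n \<omega>))"

definition var_count ::
  "'w measure \<Rightarrow> (nat \<Rightarrow> 'w \<Rightarrow> 'a::real_normed_vector) \<Rightarrow> (nat \<Rightarrow> 'w \<Rightarrow> nat) \<Rightarrow> (nat \<Rightarrow> real) \<Rightarrow>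
    'v pair_pre_digraph \<Rightarrow> nat \<Rightarrow> real" where
  "var_count M Y N t \<Gamma> n =
     integral\<^sup>L M (\<lambda>\<omega>. (real (disk_count Y N t \<Gamma> n \<omega>) - mean_count M Y N t \<Gamma> n)\<^sup>2)"

definition normalized_count ::
  "'w measure \<Rightarrow> (nat \<Rightarrow> 'w \<Rightarrow> 'a::real_normed_vector) \<Rightarrow> (nat \<Rightarrow> 'w \<Rightarrow> nat) \<Rightarrow> (nat \<Rightarrow> real) \<Rightarrow>
    'v pair_pre_digraph \<Rightarrow> nat \<Rightarrow> 'w \<Rightarrow> real" where
  "normalized_count M Y N t \<Gamma> n \<omega> =
     (real (disk_count Y N t \<Gamma> n \<omega>) - mean_count M Y N t \<Gamma> n) / sqrt (var_count M Y N t \<Gamma> n)"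

definition feasible ::
  "'w measure \<Rightarrow> (nat \<Rightarrow> 'w \<Rightarrow> 'a::real_normed_vector) \<Rightarrow> (nat \<Rightarrow> real) \<Rightarrow>
    'v pair_pre_digraph \<Rightarrow> bool" where
  "feasible M Y t \<Gamma> \<longleftrightarrow> (\<forall>n\<ge>1. 0 < measure M {\<omega> \<in> space M.
     digraph_iso (with_proj (disk_graph (t n) ((\<lambda>i. Y i \<omega>) ` {1..card (pverts \<Gamma>)}))) (with_proj \<Gamma>)})"

text \<open>The law \<open>Po\<^sub>d(\<lambda>\<^sub>1, \<dots>, \<lambda>\<^sub>d)\<close>; the default value \<open>0\<close> of \<^const>\<open>Pi_pmf\<close> is irrelevant on \<^term>\<open>UNIV\<close>.\<close>

definition poisson_vec_pmf :: "real ^ 'd \<Rightarrow> (nat ^ 'd) pmf" where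
  "poisson_vec_pmf l = map_pmf vec_lambda (Pi_pmf UNIV 0 (\<lambda>j. poisson_pmf (l $ j)))"

text \<open>
  Independence of two random variables whose values may lie in spaces of different types
  (\<^const>\<open>prob_space.indep_var\<close> requires equal types); it unfolds in the same way.
\<close>

definition indep_rv ::
  "'w measure \<Rightarrow> 'a measure \<Rightarrow> ('w \<Rightarrow> 'a) \<Rightarrow> 'b measure \<Rightarrow> ('w \<Rightarrow> 'b) \<Rightarrow> bool" where
  "indep_rv M MA A MB B \<longleftrightarrow> A \<in> measurable M MA \<and> B \<in> measurable M MB \<and>
     prob_space.indep_set M {A -` S \<inter> space M | S. S \<in> sets MA} {B -` S \<inter> space M | S. S \<in> sets MB}"

text \<open>
  Distances between random elements, possibly defined on different probability spaces. Members of
  the test class \<open>H1\<close> are automatically Borel measurable, because \<^typ>\<open>nat ^ 'd\<close> is countable. For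
  probability measures both suprema are over bounded nonempty sets.
\<close>

definition H1 :: "((nat ^ 'd) \<times> real \<Rightarrow> real) set" where
  "H1 = {\<psi>. (\<forall>z. \<bar>\<psi> z\<bar> \<le> 1) \<and> (\<forall>j. 1-lipschitz_on UNIV (\<lambda>x. \<psi> (j, x)))}"

definition d_H1 ::
  "'w measure \<Rightarrow> ('w \<Rightarrow> (nat ^ 'd) \<times> real) \<Rightarrow> 'p measure \<Rightarrow> ('p \<Rightarrow> (nat ^ 'd) \<times> real) \<Rightarrow> real" where
  "d_H1 M X P Y = (SUP \<psi>\<in>H1. \<bar>integral\<^sup>L M (\<lambda>\<omega>. \<psi> (X \<omega>)) - integral\<^sup>L P (\<lambda>\<omega>. \<psi> (Y \<omega>))\<bar>)"

definition d_TV ::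
  "'w measure \<Rightarrow> ('w \<Rightarrow> nat ^ 'd) \<Rightarrow> 'p measure \<Rightarrow> ('p \<Rightarrow> nat ^ 'd) \<Rightarrow> real" where
  "d_TV M X P Y = (SUP E. \<bar>measure M {\<omega> \<in> space M. X \<omega> \<in> E} - measure P {\<omega> \<in> space P. Y \<omega> \<in> E}\<bar>)"

definition converges_in_distribution ::
  "'w measure \<Rightarrow> (nat \<Rightarrow> 'w \<Rightarrow> 'b::topological_space) \<Rightarrow> 'p measure \<Rightarrow> ('p \<Rightarrow> 'b) \<Rightarrow> bool" where
  "converges_in_distribution M X P Y \<longleftrightarrow>
     (\<forall>h :: 'b \<Rightarrow> real. continuous_on UNIV h \<and> bounded (range h) \<longrightarrow>
        (\<lambda>n. integral\<^sup>L M (\<lambda>\<omega>. h (X n \<omega>))) \<longlonglongrightarrow> integral\<^sup>L P (\<lambda>\<omega>. h (Y \<omega>)))"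

end

theory Submission
  imports Defs
begin

text \<open>
  The proof combines the Stein method with the Mecke formula of a Poisson sample. Let \<open>W\<close> be the
  number of copies of a graph of order \<open>p\<close>. Choosing the \<open>p\<close> vertices of a copy out of a Poisson
  sample amounts to adding \<open>p\<close> fresh points to it (lemma \<open>mecke\<close>): \<open>E [W \<Phi>]\<close> is \<open>n ^ p / p!\<close>
  times the expectation of \<open>\<Phi>\<close> evaluated after planting \<open>p\<close> independent points, on the event that
  they form a copy. For \<open>\<Phi> = 1\<close> this is the mean. What remains of the Stein identity of \<open>W\<close> is
  therefore governed by how the counts change when a copy is planted.

  Planting a copy of \<open>\<Gamma>\<close> changes the counts by the copies contained in the planted points, and by
  mixed copies, which use old points too. Connectedness forces the old points of a mixed copy
  into a ball around the first planted point, whose radius is a multiple of \<open>t\<close>. If this ball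
  contains \<open>D\<close> old points, there are at most \<open>2 ^ p (2 ^ D - 1)\<close> mixed copies
  (\<open>card_mixed_copies_le\<close>). The old points are a Poisson sample independent of the planted ones, so
  the mean of \<open>4 ^ D\<close> is at most \<open>exp (3 n q)\<close>, where \<open>q = O (t ^ m)\<close> bounds the probability of
  such a ball (\<open>palm_near\<close>). Everything that is due to mixed copies is thus of order
  \<open>n t ^ m\<close>.

  For \<open>\<Gamma>\<^sub>j\<close> of order \<open>k\<close> a planted copy without mixed copies raises the \<open>j\<close>-th count by exactly one,
  leaves the other counts of graphs of order \<open>k\<close> unchanged because the graphs are pairwise
  non-isomorphic, and shifts the normalized count of \<open>\<Gamma>\<^sub>0\<close> by at most \<open>2 ^ k / \<sigma>\<close>. The solution of
  the Poisson Stein equation depends linearly on the test function, hence is Lipschitz in the last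
  argument if the test function is.
  So the \<open>j\<close>-th count may be replaced by an independent Poisson variable at a cost of order
  \<open>n t ^ m + 1 / \<sigma>\<close> (\<open>poisson_step\<close>), and by induction so may all of them (\<open>vector_step\<close>). There
  remains a bounded Lipschitz function of the normalized count of \<open>\<Gamma>\<^sub>0\<close>. Its normal Stein
  equation has a solution with Lipschitz derivative, and a first order expansion of the planted
  difference again costs \<open>n t ^ m + 1 / \<sigma>\<close> (\<open>normal_step\<close>).

  Rescaling the \<open>p - 1\<close> other points around the first one shows that the probability of a copy is
  asymptotically a positive multiple of \<open>t ^ (m (p - 1))\<close> (\<open>copy_probability_scaling\<close>). In the
  regime \<open>t ^ m \<sim> n powr (- k / (k - 1))\<close> the mean counts of order \<open>k\<close> therefore converge to
  positive limits, while the variance of the count of \<open>\<Gamma>\<^sub>0\<close>, which is at least its mean, grows at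
  least like \<open>n powr ((k - k\<^sub>0) / (k - 1))\<close>. Inserting this gives rates of order \<open>n t ^ m\<close> and
  \<open>n powr (- (k - k\<^sub>0) / (2 (k - 1)))\<close>, the squares of the asserted ones. Convergence in
  distribution follows, since the Poisson laws converge in total variation together with their
  parameters and Lipschitz functions determine weak convergence.
\<close>

section \<open>The Stein equation of the Poisson distribution\<close>

lemma poisson_expectation_sums:
  assumes "0 < l" and F: "\<And>j. \<bar>F j\<bar> \<le> B"
  shows "(\<lambda>j. l ^ j / fact j * exp (- l) * F j) sums measure_pmf.expectation (poisson_pmf l) F"
proof -
  have "integrable (measure_pmf (poisson_pmf l)) F"
    using F by (intro measure_pmf.integrable_const_bound[where B = B]) auto
  then have "integrable (density (count_space UNIV) (pmf (poisson_pmf l))) F"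
    by (simp only: measure_pmf_eq_density)
  then have "integrable (count_space UNIV) (\<lambda>j. pmf (poisson_pmf l) j * F j)"
    by (simp add: integrable_real_density)
  from sums_integral_count_space_nat[OF this]
  have "(\<lambda>j. pmf (poisson_pmf l) j * F j) sums (\<integral>x. pmf (poisson_pmf l) x * F x \<partial>count_space UNIV)" .
  also have "(\<integral>x. pmf (poisson_pmf l) x * F x \<partial>count_space UNIV)
      = measure_pmf.expectation (poisson_pmf l) F"
    by (subst measure_pmf_eq_density) (simp add: integral_real_density)
  finally show ?thesis using assms(1) by simp
qed

text \<open>
  The value at \<open>i\<close> is minus the integral of the centred \<open>F\<close> over \<open>{i..}\<close>, divided by the weight
  \<open>i pmf i\<close>. Written as a tail series, it is bounded without any case distinction between \<open>i\<close> small
  and \<open>i\<close> large. The Stein equation multiplies the value at \<open>0\<close> by \<open>0\<close>; the default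
  obeys the same bound.
\<close>

definition poisson_stein :: "real \<Rightarrow> (nat \<Rightarrow> real) \<Rightarrow> nat \<Rightarrow> real" where
  "poisson_stein l F i = (if i = 0 then 0 else
     - (\<Sum>q. l ^ q * fact (i - 1) / fact (i + q) *
          (F (i + q) - measure_pmf.expectation (poisson_pmf l) F)))"

lemma fact_mult_le_fact_add: "(fact a * fact b :: real) \<le> fact (a + b)"
proof -
  have "fact a * fact b \<le> (fact (a + b) :: nat)"
    by (intro dvd_imp_le fact_fact_dvd_fact) auto
  then show ?thesis by (metis of_nat_fact of_nat_le_iff of_nat_mult)
qed

lemma pmf_expectation_bound:
  fixes F :: "'a \<Rightarrow> real"
  assumes F: "\<And>j. \<bar>F j\<bar> \<le> B"
  shows "\<bar>measure_pmf.expectation p F\<bar> \<le> B"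
proof -
  have B: "0 \<le> B" using F[of undefined] by linarith
  have i: "integrable (measure_pmf p) F"
    using F by (intro measure_pmf.integrable_const_bound[where B = B]) auto
  have "\<bar>measure_pmf.expectation p F\<bar> \<le> measure_pmf.expectation p (\<lambda>x. \<bar>F x\<bar>)"
    by simp
  also have "\<dots> \<le> measure_pmf.expectation p (\<lambda>x. B)"
    using F i by (intro integral_mono) auto
  finally show ?thesis by simp
qed

text \<open>
  The estimate \<open>(i - 1)! q! \<le> (i + q)!\<close> dominates the series by the exponential series, uniformly
  in \<open>i\<close>.
\<close>

lemma poisson_stein_term_le:
  assumes "0 < l" and F: "\<And>j. \<bar>F j\<bar> \<le> B" and "i' \<le> i"
  shows "\<bar>l ^ q * fact i' / fact (i + q) * (F (i + q) - measure_pmf.expectation (poisson_pmf l) F)\<bar>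
    \<le> l ^ q / fact q * (2 * B)"
proof -
  have "fact i' * fact q \<le> (fact (i + q) :: real)"
    using fact_mult_le_fact_add[of i q] fact_mono[OF \<open>i' \<le> i\<close>, where 'a = real]
    by (meson fact_ge_zero mult_right_mono order_trans)
  then have "fact i' / fact (i + q) \<le> (1 / fact q :: real)"
    by (simp add: field_simps)
  from mult_left_mono[OF this, of "l ^ q"]
  have "l ^ q * fact i' / fact (i + q) \<le> l ^ q / fact q" using assms by simp
  moreover have "\<bar>F (i + q) - measure_pmf.expectation (poisson_pmf l) F\<bar> \<le> 2 * B"
    using F[of "i + q"] pmf_expectation_bound[of F B "poisson_pmf l", OF F] by linarith
  ultimately show ?thesis
    unfolding abs_mult using assms by (intro mult_mono) (auto simp: abs_mult)
qed

lemma summable_exp_terms: "summable (\<lambda>q. l ^ q / fact q * (C::real))"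
  using summable_exp_generic[of l] by (intro summable_mult2) (simp add: field_simps divideR_right scaleR_conv_of_real)

lemma suminf_exp_terms: "(\<Sum>q. l ^ q / fact q * (C::real)) = exp l * C"
proof -
  have "(\<lambda>q. l ^ q / fact q * C) sums (exp l * C)"
    using exp_converges[of l] by (intro sums_mult2) (simp add: field_simps)
  then show ?thesis by (rule sums_unique[symmetric])
qed

lemma summable_poisson_stein:
  assumes "0 < l" and F: "\<And>j. \<bar>F j\<bar> \<le> B" and "i' \<le> i"
  shows "summable (\<lambda>q. l ^ q * fact i' / fact (i + q) * (F (i + q) - measure_pmf.expectation (poisson_pmf l) F))"
  by (rule summable_comparison_test'[OF summable_exp_terms[of l "2 * B"], of 0])
     (use poisson_stein_term_le[OF assms] in auto)

lemma poisson_stein_bound: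
  assumes "0 < l" and F: "\<And>j. \<bar>F j\<bar> \<le> B"
  shows "\<bar>poisson_stein l F i\<bar> \<le> exp l * (2 * B)"
proof (cases "i = 0")
  case True
  then show ?thesis using F[of 0] by (simp add: poisson_stein_def)
next
  case False
  let ?f = "\<lambda>q. l ^ q * fact (i - 1) / fact (i + q) * (F (i + q) - measure_pmf.expectation (poisson_pmf l) F)"
  have le: "norm (?f q) \<le> l ^ q / fact q * (2 * B)" for q
    using poisson_stein_term_le[OF assms, of "i - 1" i q] by simp
  have "norm (suminf ?f) \<le> (\<Sum>q. l ^ q / fact q * (2 * B))"
    by (rule norm_suminf_le[OF le summable_exp_terms])
  then show ?thesis using False unfolding poisson_stein_def suminf_exp_terms by simp
qed

lemma poisson_stein_eq:
  assumes "0 < l" and F: "\<And>j. \<bar>F j\<bar> \<le> B"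
  shows "l * poisson_stein l F (Suc i) - real i * poisson_stein l F i
    = F i - measure_pmf.expectation (poisson_pmf l) F"
proof -
  let ?m = "measure_pmf.expectation (poisson_pmf l) F"
  define G where "G = (\<lambda>q. l ^ q * fact i / fact (i + q) * (F (i + q) - ?m))"
  have sG: "summable G" unfolding G_def using summable_poisson_stein[OF assms, of i i] by simp
  have s1: "summable (\<lambda>q. l ^ q * fact i / fact (Suc i + q) * (F (Suc i + q) - ?m))"
    using summable_poisson_stein[OF assms, of i "Suc i"] by simp
  have "l * poisson_stein l F (Suc i) = - (\<Sum>q. l * (l ^ q * fact i / fact (Suc i + q) * (F (Suc i + q) - ?m)))"
    using suminf_mult[OF s1, of l] by (simp add: poisson_stein_def)
  also have "\<dots> = - (\<Sum>q. G (Suc q))" by (simp add: G_def mult.assoc)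
  also have "(\<Sum>q. G (Suc q)) = suminf G - G 0" by (rule suminf_split_head[OF sG])
  finally have 1: "l * poisson_stein l F (Suc i) = F i - ?m - suminf G" by (simp add: G_def)
  \<comment> \<open>At \<open>i = 0\<close> the left side vanishes; the right side does because \<open>F\<close> is centred by its mean.\<close>
  have 2: "real i * poisson_stein l F i = - suminf G"
  proof (cases "i = 0")
    case True
    have "(\<lambda>q. exp l * (l ^ q / fact q * exp (- l) * F q) - l ^ q / fact q * ?m) sums
      (exp l * ?m - exp l * ?m)"
      using summable_exp_terms[of l ?m] suminf_exp_terms[of l ?m]
      by (intro sums_diff sums_mult poisson_expectation_sums[OF assms]) (simp add: sums_iff)
    moreover have "exp l * (l ^ q / fact q * exp (- l) * F q) - l ^ q / fact q * ?m = G q" for q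
      using True by (simp add: G_def exp_minus field_simps)
    ultimately have "suminf G = 0" by (simp add: sums_iff)
    then show ?thesis using True by simp
  next
    case False
    have f: "real i * fact (i - 1) = fact i" using False by (metis fact_reduce gr0I)
    have s: "summable (\<lambda>q. l ^ q * fact (i - 1) / fact (i + q) * (F (i + q) - ?m))"
      using summable_poisson_stein[OF assms, of "i - 1" i] by simp
    have "real i * poisson_stein l F i
      = - (\<Sum>q. real i * (l ^ q * fact (i - 1) / fact (i + q) * (F (i + q) - ?m)))"
      using suminf_mult[OF s, of "real i"] False by (simp add: poisson_stein_def)
    also have "\<dots> = - suminf G" unfolding G_def
      by (simp add: f[symmetric] mult.assoc mult.left_commute)
    finally show ?thesis .
  qed
  from 1 2 show ?thesis by simp
qed

lemma poisson_stein_diff: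
  assumes "0 < l" and F: "\<And>j. \<bar>F j\<bar> \<le> B" and F': "\<And>j. \<bar>F' j\<bar> \<le> B"
  shows "poisson_stein l F i - poisson_stein l F' i = poisson_stein l (\<lambda>j. F j - F' j) i"
proof (cases "i = 0")
  case False
  let ?p = "poisson_pmf l"
  have m: "measure_pmf.expectation ?p (\<lambda>j. F j - F' j)
    = measure_pmf.expectation ?p F - measure_pmf.expectation ?p F'"
    using F F' by (intro Bochner_Integration.integral_diff measure_pmf.integrable_const_bound[where B = B]) auto
  have alg: "c * (a - m) - c * (b - m') = c * (a - b - (m - m'))" for a b c m m' :: real
    by (simp add: algebra_simps)
  let ?m = "measure_pmf.expectation ?p F" and ?m' = "measure_pmf.expectation ?p F'"
  let ?c = "\<lambda>q. l ^ q * fact (i - 1) / fact (i + q)"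
  have "(\<Sum>q. ?c q * (F (i + q) - ?m)) - (\<Sum>q. ?c q * (F' (i + q) - ?m'))
    = (\<Sum>q. ?c q * (F (i + q) - ?m) - ?c q * (F' (i + q) - ?m'))"
    using suminf_diff[OF summable_poisson_stein[OF assms(1) F, of "i - 1" i]
        summable_poisson_stein[OF assms(1) F', of "i - 1" i]] by simp
  also have "\<dots> = (\<Sum>q. ?c q * (F (i + q) - F' (i + q) - (?m - ?m')))"
    by (intro arg_cong[of _ _ suminf] ext alg)
  finally show ?thesis using False unfolding poisson_stein_def m by simp
qed (simp add: poisson_stein_def)

text \<open>
  By linearity of the solution in \<open>F\<close>. With \<open>F\<close> and \<open>F'\<close> the sections of one test function at two
  values of a further argument, the solution inherits Lipschitz continuity in that argument.
\<close>

lemma poisson_stein_lipschitz: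
  assumes "0 < l" and F: "\<And>j. \<bar>F j\<bar> \<le> B" and F': "\<And>j. \<bar>F' j\<bar> \<le> B"
    and d: "\<And>j. \<bar>F j - F' j\<bar> \<le> \<delta>"
  shows "\<bar>poisson_stein l F i - poisson_stein l F' i\<bar> \<le> exp l * (2 * \<delta>)"
  unfolding poisson_stein_diff[OF assms(1-3)]
  using poisson_stein_bound[of l "\<lambda>j. F j - F' j" \<delta>] assms by simp

section \<open>Vectors of independent Poisson variables\<close>

definition vec_upd :: "nat ^ 'd \<Rightarrow> 'd \<Rightarrow> nat \<Rightarrow> nat ^ 'd" where
  "vec_upd v j i = (\<chi> q. if q = j then i else v $ q)"

text \<open>
  The coordinates in \<open>J\<close> are averaged out against independent Poisson variables and the others
  are kept, which interpolates between a function and its Poisson mean.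
\<close>

definition poisson_resample ::
  "real ^ 'd \<Rightarrow> 'd set \<Rightarrow> (nat ^ 'd \<Rightarrow> real) \<Rightarrow> nat ^ 'd \<Rightarrow> real" where
  "poisson_resample l J \<Psi> v = measure_pmf.expectation (Pi_pmf J 0 (\<lambda>j. poisson_pmf (l $ j)))
     (\<lambda>w. \<Psi> (\<chi> q. if q \<in> J then w q else v $ q))"

lemma poisson_resample_empty: "poisson_resample l {} \<Psi> = \<Psi>"
  by (auto simp: poisson_resample_def pmf_Pi_empty)

lemma poisson_resample_UNIV:
  "poisson_resample l UNIV \<Psi> v = measure_pmf.expectation (poisson_vec_pmf l) \<Psi>"
proof -
  have "(\<chi> q. w q) = vec_lambda w" for w :: "'a \<Rightarrow> nat" by simp
  then show ?thesis by (simp add: poisson_resample_def poisson_vec_pmf_def)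
qed

lemma poisson_resample_bound:
  assumes "\<And>v. \<bar>\<Psi> v\<bar> \<le> B" shows "\<bar>poisson_resample l J \<Psi> v\<bar> \<le> B"
  unfolding poisson_resample_def by (rule pmf_expectation_bound) (rule assms)

lemma poisson_resample_lipschitz:
  assumes "\<And>v. \<bar>\<Psi> v\<bar> \<le> B" "\<And>v. \<bar>\<Psi>' v\<bar> \<le> B" "\<And>v. \<bar>\<Psi> v - \<Psi>' v\<bar> \<le> \<delta>"
  shows "\<bar>poisson_resample l J \<Psi> v - poisson_resample l J \<Psi>' v\<bar> \<le> \<delta>"
proof -
  let ?P = "Pi_pmf J 0 (\<lambda>j. poisson_pmf (l $ j))"
  have "poisson_resample l J \<Psi> v - poisson_resample l J \<Psi>' v
    = measure_pmf.expectation ?P (\<lambda>w. \<Psi> (\<chi> q. if q \<in> J then w q else v $ q)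
        - \<Psi>' (\<chi> q. if q \<in> J then w q else v $ q))"
    unfolding poisson_resample_def
    using assms by (intro Bochner_Integration.integral_diff[symmetric] measure_pmf.integrable_const_bound[where B = B]) auto
  then show ?thesis using assms(3) by (simp add: pmf_expectation_bound)
qed

lemma expectation_pair_pmf:
  fixes F :: "'a \<times> 'b \<Rightarrow> real"
  assumes b: "\<And>z. \<bar>F z\<bar> \<le> B"
  shows "measure_pmf.expectation (pair_pmf p q) F
    = measure_pmf.expectation p (\<lambda>x. measure_pmf.expectation q (\<lambda>y. F (x, y)))"
proof -
  have B: "0 \<le> B" using b[of undefined] abs_ge_zero order_trans by blast
  have "measure_pmf.expectation (bind_pmf p (\<lambda>x. map_pmf (Pair x) q)) F
    = measure_pmf.expectation p (\<lambda>x. measure_pmf.expectation (map_pmf (Pair x) q) F)"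
    unfolding measure_pmf_bind
    by (rule integral_bind[where K = "count_space UNIV" and B = B and B' = 1])
       (use b in \<open>auto simp: measure_pmf.emeasure_space_1 prob_space.emeasure_space_1
         intro!: measure_pmf_in_subprob_algebra measurable_count_space_insert
           subprob_space_measure_pmf\<close>)
  then show ?thesis by (simp add: pair_pmf_def map_pmf_def[symmetric])
qed

lemma poisson_resample_insert:
  assumes "j \<notin> J" and b: "\<And>v. \<bar>\<Psi> v\<bar> \<le> B"
  shows "poisson_resample l (insert j J) \<Psi> v
    = measure_pmf.expectation (poisson_pmf (l $ j)) (\<lambda>i. poisson_resample l J \<Psi> (vec_upd v j i))"
proof -
  let ?q = "Pi_pmf J 0 (\<lambda>j. poisson_pmf (l $ j))"
  have "poisson_resample l (insert j J) \<Psi> v = measure_pmf.expectation (pair_pmf (poisson_pmf (l $ j)) ?q)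
     (\<lambda>(i, w). \<Psi> (\<chi> q. if q \<in> insert j J then (w(j := i)) q else v $ q))"
    unfolding poisson_resample_def using assms(1) by (simp add: Pi_pmf_insert case_prod_unfold)
  also have "\<dots> = measure_pmf.expectation (poisson_pmf (l $ j)) (\<lambda>i. measure_pmf.expectation ?q
     (\<lambda>w. \<Psi> (\<chi> q. if q \<in> insert j J then (w(j := i)) q else v $ q)))"
    by (subst expectation_pair_pmf[where B = B]) (use b in auto)
  also have "(\<lambda>i w. \<Psi> (\<chi> q. if q \<in> insert j J then (w(j := i)) q else v $ q))
      = (\<lambda>i w. \<Psi> (\<chi> q. if q \<in> J then w q else vec_upd v j i $ q))"
    using assms(1) by (intro ext arg_cong[of _ _ \<Psi>]) (auto simp: vec_eq_iff vec_upd_def)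
  finally show ?thesis unfolding poisson_resample_def by simp
qed

section \<open>The Stein equation of the normal distribution\<close>

abbreviation "\<rho> \<equiv> std_normal_density"

lemma rho_deriv: "(\<rho> has_real_derivative - x * \<rho> x) (at x)"
proof -
  have "((\<lambda>x. c * exp (- x\<^sup>2 / 2)) has_real_derivative - x * (c * exp (- x\<^sup>2 / 2))) (at x)" for c
    by (auto intro!: derivative_eq_intros)
  then show ?thesis unfolding std_normal_density_def .
qed

lemma integrable_rho: "integrable lborel \<rho>"
  using integrable_std_normal_moment[of 0] by simp

lemma integrable_rho_id: "integrable lborel (\<lambda>x. x * \<rho> x)"
  using integrable_std_normal_moment[of 1] by (simp add: mult.commute)

lemma continuous_rho: "continuous_on A \<rho>"
  unfolding std_normal_density_def by (intro continuous_intros) auto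

lemma rho_even: "\<rho> (- x) = \<rho> x"
  by (simp add: std_normal_density_def)

lemma integrable_times_rho:
  assumes "g \<in> borel_measurable borel" "\<And>y. \<bar>g y\<bar> \<le> B"
  shows "integrable lborel (\<lambda>y. g y * \<rho> y)"
proof (rule Bochner_Integration.integrable_bound[OF integrable_mult_right[OF integrable_rho, of B]])
  have "\<bar>g x\<bar> * \<rho> x \<le> \<bar>B\<bar> * \<rho> x" for x
    using assms(2)[of x] by (intro mult_right_mono) auto
  then show "AE x in lborel. norm (g x * \<rho> x) \<le> norm (B * \<rho> x)"
    by (simp add: abs_mult)
qed (use assms in measurable)

text \<open>
  For a centred \<open>g\<close> the solution of the Stein equation \<open>h' x - x h x = g x\<close> that stays bounded is
  \<open>- normal_tail g x / \<rho> x\<close>; all bounds on it compare such tail integrals with \<open>\<rho> x\<close>.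
\<close>

definition normal_tail :: "(real \<Rightarrow> real) \<Rightarrow> real \<Rightarrow> real" where
  "normal_tail g x = (\<integral>y. indicator {x..} y * (g y * \<rho> y) \<partial>lborel)"

lemma integrable_tail:
  assumes "integrable lborel (\<lambda>y. g y * \<rho> y)"
  shows "integrable lborel (\<lambda>y. indicator {x..} y * (g y * \<rho> y :: real))"
  using integrable_mult_indicator[OF _ assms, of "{x..}"] by simp

lemma normal_tail_mono:
  assumes "integrable lborel (\<lambda>y. g y * \<rho> y)" "integrable lborel (\<lambda>y. g' y * \<rho> y)"
    "\<And>y. x \<le> y \<Longrightarrow> g y \<le> g' y"
  shows "normal_tail g x \<le> normal_tail g' x"
  unfolding normal_tail_def
  by (intro integral_mono integrable_tail assms) (auto simp: indicator_def intro!: mult_right_mono assms)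

text \<open>
  The function \<open>- \<rho>\<close> is a primitive of \<open>y \<rho> y\<close>.
\<close>

lemma normal_tail_id:
  assumes "0 \<le> x" shows "normal_tail (\<lambda>y. y) x = \<rho> x"
proof -
  have lim: "((\<lambda>x. - \<rho> x) \<longlongrightarrow> 0) at_top"
    unfolding std_normal_density_def by real_asymp
  have "(\<integral>\<^sup>+y. ennreal (y * \<rho> y) * indicator {x..} y \<partial>lborel) = ennreal (0 - (- \<rho> x))"
    by (rule nn_integral_FTC_atLeast[where F = "\<lambda>x. - \<rho> x"])
       (use assms lim in \<open>auto intro!: derivative_eq_intros rho_deriv\<close>)
  then have "(\<integral>\<^sup>+y. ennreal (indicator {x..} y * (y * \<rho> y)) \<partial>lborel) = ennreal (\<rho> x)"
    by (subst nn_integral_cong[of _ _ "\<lambda>y. ennreal (y * \<rho> y) * indicator {x..} y"])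
       (auto simp: indicator_def)
  then show ?thesis unfolding normal_tail_def
    using assms by (subst integral_eq_nn_integral) (auto simp: indicator_def)
qed

lemma normal_tail_deriv:
  assumes c: "continuous_on UNIV g" and i: "integrable lborel (\<lambda>y. g y * \<rho> y)"
  shows "(normal_tail g has_real_derivative - (g x * \<rho> x)) (at x)"
proof -
  define a where "a = x - 1"
  have cont: "continuous_on A (\<lambda>y. g y * \<rho> y)" for A
    using continuous_on_subset[OF c] by (intro continuous_intros continuous_rho) auto
  have eq: "normal_tail g u = normal_tail g a - integral {a..u} (\<lambda>y. g y * \<rho> y)" if "a \<le> u" for u
  proof -
    have [measurable]: "g \<in> borel_measurable borel" by (rule borel_measurable_continuous_onI[OF c])
    have si: "set_integrable lborel {a..u} (\<lambda>y. g y * \<rho> y)"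
      using i by (intro borel_integrable_atLeastAtMost' cont)
    have "normal_tail g a = (\<integral>y. indicator {a..u} y * (g y * \<rho> y) + indicator {u..} y * (g y * \<rho> y) \<partial>lborel)"
      unfolding normal_tail_def using that
      by (intro integral_cong_AE) (auto intro!: AE_I[where N = "{u}"] split: split_indicator)
    also have "\<dots> = integral {a..u} (\<lambda>y. g y * \<rho> y) + normal_tail g u"
      using si set_borel_integral_eq_integral(2)[OF si]
      by (subst Bochner_Integration.integral_add)
         (auto simp: normal_tail_def set_integrable_def set_lebesgue_integral_def integrable_tail[OF i])
    finally show ?thesis by simp
  qed
  have "((\<lambda>u. integral {a..u} (\<lambda>y. g y * \<rho> y)) has_real_derivative g x * \<rho> x) (at x within {a..x+1})"
    by (rule integral_has_real_derivative[OF cont]) (auto simp: a_def)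
  then have "((\<lambda>u. integral {a..u} (\<lambda>y. g y * \<rho> y)) has_real_derivative g x * \<rho> x) (at x)"
    by (subst (asm) at_within_interior) (auto simp: a_def)
  then have d: "((\<lambda>u. normal_tail g a - integral {a..u} (\<lambda>y. g y * \<rho> y)) has_real_derivative - (g x * \<rho> x)) (at x)"
    by (auto intro!: derivative_eq_intros)
  have "\<forall>\<^sub>F u in nhds x. normal_tail g u = normal_tail g a - integral {a..u} (\<lambda>y. g y * \<rho> y)"
    using eventually_nhds_in_open[of "{a<..}" x] by (rule eventually_mono) (auto simp: a_def intro!: eq[unfolded a_def])
  from DERIV_cong_ev[OF refl this refl] d show ?thesis by (rule iffD2)
qed

text \<open>
  The upper bounds on the Mills ratio come from \<open>x \<le> y\<close> on the tail and from
  \<open>\<rho> (x + y) \<le> sqrt (2 pi) \<rho> x \<rho> y\<close> for nonnegative \<open>x\<close> and \<open>y\<close>.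
\<close>

lemma normal_tail_one_le: 
  assumes "0 \<le> x"
  shows "x * normal_tail (\<lambda>_. 1) x \<le> \<rho> x" "normal_tail (\<lambda>_. 1) x \<le> 3 * \<rho> x"
    "0 \<le> normal_tail (\<lambda>_. 1) x"
proof -
  have "(\<lambda>y. indicator {x..} y * (x * \<rho> y)) = (\<lambda>y. x * (indicator {x..} y * (1 * \<rho> y)))" by auto
  then have "x * normal_tail (\<lambda>_. 1) x = normal_tail (\<lambda>_. x) x"
    unfolding normal_tail_def by simp
  also have "\<dots> \<le> normal_tail (\<lambda>y. y) x"
    by (rule normal_tail_mono) (auto intro: integrable_rho_id integrable_mult_right integrable_rho)
  also have "\<dots> = \<rho> x" by (rule normal_tail_id[OF assms])
  finally show "x * normal_tail (\<lambda>_. 1) x \<le> \<rho> x" .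
  show "0 \<le> normal_tail (\<lambda>_. 1) x"
    unfolding normal_tail_def by (intro integral_nonneg_AE) (auto simp: indicator_def)
  have "normal_tail (\<lambda>_. 1) x = (\<integral>y. indicator {x..} (x + y) * (1 * \<rho> (x + y)) \<partial>lborel)"
    unfolding normal_tail_def using lborel_integral_real_affine[of 1 "\<lambda>y. indicator {x..} y * (1 * \<rho> y)" x] by simp
  also have "\<dots> \<le> (\<integral>y. sqrt (2 * pi) * \<rho> x * \<rho> y \<partial>lborel)"
  proof (rule integral_mono)
    have "integrable lborel (\<lambda>y. indicator {x..} (x + 1 * y) * (1 * \<rho> (x + 1 * y)))"
      using integrable_tail[of "\<lambda>_. 1" x] integrable_rho by (intro lborel_integrable_real_affine) auto
    then show "integrable lborel (\<lambda>y. indicator {x..} (x + y) * (1 * \<rho> (x + y)))" by simp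
    show "integrable lborel (\<lambda>y. sqrt (2 * pi) * \<rho> x * \<rho> y)"
      using integrable_rho by (intro integrable_mult_right)
    fix y :: real
    show "indicator {x..} (x + y) * (1 * \<rho> (x + y)) \<le> sqrt (2 * pi) * \<rho> x * \<rho> y"
    proof (cases "0 \<le> y")
      case True
      have "exp (- ((x + y)\<^sup>2 / 2)) \<le> exp (- (x\<^sup>2 / 2)) * exp (- (y\<^sup>2 / 2))"
        using True assms by (simp add: mult_exp_exp power2_sum add_divide_distrib)
      then have "\<rho> (x + y) \<le> sqrt (2 * pi) * \<rho> x * \<rho> y"
        unfolding std_normal_density_def by (simp add: exp_add field_simps)
      then show ?thesis using True by simp
    qed (auto simp: indicator_def)
  qed
  also have "\<dots> = sqrt (2 * pi) * \<rho> x"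
    using std_normal_moment_even[of 0] by (simp add: has_bochner_integral_iff)
  also have "\<dots> \<le> 3 * \<rho> x"
  proof (rule mult_right_mono)
    have "sqrt (2 * pi) \<le> sqrt (3\<^sup>2)" using pi_less_4 by (intro real_sqrt_le_mono) (auto)
    then show "sqrt (2 * pi) \<le> 3" by simp
  qed simp
  finally show "normal_tail (\<lambda>_. 1) x \<le> 3 * \<rho> x" .
qed

text \<open>
  The difference of both sides, divided by \<open>1 + x\<^sup>2\<close>, has derivative \<open>- 2 \<rho> x / (1 + x\<^sup>2)\<^sup>2\<close> and
  vanishes at infinity, hence it is nonnegative.
\<close>

lemma mills_lower:
  assumes "0 \<le> x" shows "x * \<rho> x \<le> (1 + x\<^sup>2) * normal_tail (\<lambda>_. 1) x"
proof -
  define B where "B x = normal_tail (\<lambda>_. 1) x - x * \<rho> x / (1 + x\<^sup>2)" for x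
  have pos: "1 + x\<^sup>2 \<noteq> 0" for x :: real by (metis add_nonneg_eq_0_iff zero_le_one zero_le_power2 zero_neq_one)
  have d: "(B has_real_derivative - 2 * \<rho> u / (1 + u\<^sup>2)\<^sup>2) (at u)" for u
  proof -
    have "(normal_tail (\<lambda>_. 1) has_real_derivative - (1 * \<rho> u)) (at u)"
      by (rule normal_tail_deriv) (auto simp: integrable_rho)
    then have "(B has_real_derivative - \<rho> u - ((1 * \<rho> u + (- u * \<rho> u) * u) * (1 + u\<^sup>2) - u * \<rho> u * (2 * u)) / ((1 + u\<^sup>2) * (1 + u\<^sup>2))) (at u)"
      unfolding B_def[abs_def]
      by (auto intro!: derivative_eq_intros rho_deriv simp: pos)
    also have "- \<rho> u - ((1 * \<rho> u + (- u * \<rho> u) * u) * (1 + u\<^sup>2) - u * \<rho> u * (2 * u)) / ((1 + u\<^sup>2) * (1 + u\<^sup>2)) = - 2 * \<rho> u / (1 + u\<^sup>2)\<^sup>2"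
      using pos[of u] by (simp add: divide_simps) (simp add: power2_eq_square algebra_simps)
    finally show ?thesis .
  qed
  have anti: "B v \<le> B u" if "u \<le> v" for u v
    using that d by (intro DERIV_nonpos_imp_nonincreasing[of u v B]) (auto intro!: exI[of _ "- 2 * \<rho> x / (1 + x\<^sup>2)\<^sup>2" for x] divide_nonpos_nonneg)
  have "(B \<longlongrightarrow> 0 - 0) at_top" unfolding B_def[abs_def]
  proof (rule tendsto_diff)
    have l: "((\<lambda>x. 3 * \<rho> x) \<longlongrightarrow> 0) at_top" unfolding std_normal_density_def by real_asymp
    show "(normal_tail (\<lambda>_. 1) \<longlongrightarrow> 0) at_top"
      by (rule tendsto_sandwich[OF _ _ tendsto_const l])
         (auto intro!: eventually_mono[OF eventually_ge_at_top[of 0]] normal_tail_one_le)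
    show "((\<lambda>x. x * \<rho> x / (1 + x\<^sup>2)) \<longlongrightarrow> 0) at_top" unfolding std_normal_density_def by real_asymp
  qed
  then have "0 \<le> B x"
    by (intro tendsto_upperbound[where F = at_top and f = B]) (auto intro!: eventually_mono[OF eventually_ge_at_top[of x]] anti)
  then have "x * \<rho> x / (1 + x\<^sup>2) \<le> normal_tail (\<lambda>_. 1) x" unfolding B_def by simp
  moreover have "0 < 1 + x\<^sup>2" by (simp add: add_pos_nonneg)
  ultimately show ?thesis by (simp add: pos_divide_le_eq mult.commute)
qed

text \<open>
  The three estimates bound the solution \<open>h\<close>, the product \<open>x h x\<close> and the derivative
  \<open>(1 + x\<^sup>2) h x + x g x\<close> of that product. In the last one the two summands are large separately. They
  cancel because \<open>g\<close> lies between the lines of slope \<open>1\<close> and \<open>- 1\<close> through its value at \<open>x\<close>, which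
  reduces \<open>normal_tail g x\<close> to \<open>g x\<close> times the tail of a constant; there \<open>mills_lower\<close> applies.
\<close>

lemma normal_tail_estimates:
  assumes x: "0 \<le> x" and b: "\<And>y. \<bar>g y\<bar> \<le> 2" and lip: "\<And>y z. \<bar>g y - g z\<bar> \<le> \<bar>y - z\<bar>"
    and m: "g \<in> borel_measurable borel"
  shows "\<bar>normal_tail g x\<bar> \<le> 6 * \<rho> x" "\<bar>x * normal_tail g x\<bar> \<le> 2 * \<rho> x"
    "\<bar>(1 + x\<^sup>2) * normal_tail g x - x * g x * \<rho> x\<bar> \<le> 7 * \<rho> x"
proof -
  let ?M = "normal_tail (\<lambda>_. 1) x"
  have i: "integrable lborel (\<lambda>y. g y * \<rho> y)" by (rule integrable_times_rho[OF m b])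
  have c: "normal_tail (\<lambda>_. a) x = a * ?M" for a
  proof -
    have "(\<lambda>y. indicator {x..} y * (a * \<rho> y)) = (\<lambda>y. a * (indicator {x..} y * (1 * \<rho> y)))" by auto
    then show ?thesis unfolding normal_tail_def by simp
  qed
  have ic: "integrable lborel (\<lambda>y. a * \<rho> y)" for a by (intro integrable_mult_right integrable_rho)
  have b': "g y \<le> 2" "- 2 \<le> g y" for y using b[of y] by linarith+
  have T: "\<bar>normal_tail g x\<bar> \<le> 2 * ?M"
  proof -
    have "normal_tail g x \<le> normal_tail (\<lambda>_. 2) x"
      by (rule normal_tail_mono[where g = g and g' = "\<lambda>_. 2"]) (rule i ic b')+
    moreover have "normal_tail (\<lambda>_. - 2) x \<le> normal_tail g x"
      by (rule normal_tail_mono[where g = "\<lambda>_. - 2" and g' = g]) (rule i ic b')+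
    ultimately show ?thesis using c[of 2] c[of "- 2"] by linarith
  qed
  show "\<bar>normal_tail g x\<bar> \<le> 6 * \<rho> x" using T normal_tail_one_le[OF x] by linarith
  have "\<bar>x * normal_tail g x\<bar> \<le> x * (2 * ?M)" using T x by (simp add: abs_mult mult_left_mono)
  then show "\<bar>x * normal_tail g x\<bar> \<le> 2 * \<rho> x" using normal_tail_one_le(1)[OF x] by linarith
  have lin: "normal_tail (\<lambda>y. g x + a * (y - x)) x = g x * ?M + a * (\<rho> x - x * ?M)" for a
  proof -
    have i1: "integrable lborel (\<lambda>y. indicator {x..} y * (1 * \<rho> y))"
      using integrable_tail[of "\<lambda>_. 1" x] integrable_rho by simp
    have i2: "integrable lborel (\<lambda>y. indicator {x..} y * (y * \<rho> y))"
      using integrable_tail[of "\<lambda>y. y" x] integrable_rho_id by simp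
    have "(\<lambda>y. indicator {x..} y * ((g x + a * (y - x)) * \<rho> y))
      = (\<lambda>y. (g x - a * x) * (indicator {x..} y * (1 * \<rho> y)) + a * (indicator {x..} y * (y * \<rho> y)))"
      by (auto simp: algebra_simps)
    then have "normal_tail (\<lambda>y. g x + a * (y - x)) x = (\<integral>y. (g x - a * x) * (indicator {x..} y * (1 * \<rho> y))
        + a * (indicator {x..} y * (y * \<rho> y)) \<partial>lborel)"
      unfolding normal_tail_def by simp
    also have "\<dots> = (\<integral>y. (g x - a * x) * (indicator {x..} y * (1 * \<rho> y)) \<partial>lborel)
        + (\<integral>y. a * (indicator {x..} y * (y * \<rho> y)) \<partial>lborel)"
      by (intro Bochner_Integration.integral_add integrable_mult_right i1 i2)
    also have "\<dots> = (g x - a * x) * ?M + a * normal_tail (\<lambda>y. y) x"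
      unfolding normal_tail_def integral_mult_right_zero ..
    finally show ?thesis unfolding normal_tail_id[OF x] by (simp add: algebra_simps)
  qed
  have il: "integrable lborel (\<lambda>y. (g x + a * (y - x)) * \<rho> y)" for a
  proof -
    have "integrable lborel (\<lambda>y. (g x - a * x) * \<rho> y + a * (y * \<rho> y))"
      by (intro Bochner_Integration.integrable_add integrable_mult_right integrable_rho integrable_rho_id)
    then show ?thesis by (simp add: algebra_simps)
  qed
  have "normal_tail g x \<le> normal_tail (\<lambda>y. g x + 1 * (y - x)) x"
  proof (rule normal_tail_mono[where g = g and g' = "\<lambda>y. g x + 1 * (y - x)"])
    show "g y \<le> g x + 1 * (y - x)" if "x \<le> y" for y
      using that lip[of y x] by (simp add: abs_le_iff abs_of_nonneg)
  qed (rule i il)+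
  note up = this[unfolded lin[of 1]]
  have "normal_tail (\<lambda>y. g x + (-1) * (y - x)) x \<le> normal_tail g x"
  proof (rule normal_tail_mono[where g = "\<lambda>y. g x + (-1) * (y - x)" and g' = g])
    show "g x + (-1) * (y - x) \<le> g y" if "x \<le> y" for y
      using that lip[of y x] by (simp add: abs_le_iff abs_of_nonneg)
  qed (rule i il)+
  note low = this[unfolded lin[of "- 1"]]
  have e: "\<bar>normal_tail g x - g x * ?M\<bar> \<le> \<rho> x - x * ?M"
  proof (rule abs_leI)
    show "normal_tail g x - g x * ?M \<le> \<rho> x - x * ?M" using up by (simp only: mult_1 diff_le_eq add.commute)
    show "- (normal_tail g x - g x * ?M) \<le> \<rho> x - x * ?M" using low by argo
  qed
  \<comment> \<open>The defect in \<open>mills_lower\<close>; it is nonnegative and at most \<open>3 \<rho> x\<close>.\<close>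
  let ?g = "(1 + x\<^sup>2) * ?M - x * \<rho> x"
  have g0: "0 \<le> ?g" using mills_lower[OF x] by linarith
  have "?g = ?M - x * (\<rho> x - x * ?M)" by (simp add: power2_eq_square algebra_simps)
  also have "\<dots> \<le> ?M" using x normal_tail_one_le(1)[OF x] by simp
  also have "\<dots> \<le> 3 * \<rho> x" by (rule normal_tail_one_le(2)[OF x])
  finally have g1: "?g \<le> 3 * \<rho> x" .
  have first: "\<bar>g x * ?g\<bar> \<le> 2 * (3 * \<rho> x)"
    unfolding abs_mult using b g0 g1 by (intro mult_mono) auto
  have "(1 + x\<^sup>2) * (\<rho> x - x * ?M) = \<rho> x - x * ?g" by (simp add: power2_eq_square algebra_simps)
  moreover have "0 \<le> x * ?g" using g0 x by simp
  ultimately have le: "(1 + x\<^sup>2) * (\<rho> x - x * ?M) \<le> \<rho> x" by linarith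
  have "\<bar>(1 + x\<^sup>2) * (normal_tail g x - g x * ?M)\<bar> \<le> (1 + x\<^sup>2) * (\<rho> x - x * ?M)"
    unfolding abs_mult using e by (simp add: mult_left_mono)
  also note le
  finally have second: "\<bar>(1 + x\<^sup>2) * (normal_tail g x - g x * ?M)\<bar> \<le> \<rho> x" .
  have eq: "(1 + x\<^sup>2) * normal_tail g x - x * g x * \<rho> x
     = (1 + x\<^sup>2) * (normal_tail g x - g x * ?M) + g x * ?g"
    by (simp add: algebra_simps)
  have "\<bar>(1 + x\<^sup>2) * normal_tail g x - x * g x * \<rho> x\<bar> \<le> \<rho> x + 2 * (3 * \<rho> x)"
    unfolding eq by (rule order_trans[OF abs_triangle_ineq add_mono[OF second first]])
  then show "\<bar>(1 + x\<^sup>2) * normal_tail g x - x * g x * \<rho> x\<bar> \<le> 7 * \<rho> x"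
    by simp
qed

text \<open>
  Since \<open>h' x = x h x + g x\<close>, the derivative is Lipschitz as soon as \<open>x h x\<close> is, and that follows from
  the third tail estimate.
\<close>

lemma normal_stein_solution:
  assumes b: "\<And>y. \<bar>\<phi> y\<bar> \<le> 1" and lip: "\<And>y z. \<bar>\<phi> y - \<phi> z\<bar> \<le> \<bar>y - z\<bar>"
  obtains h h' :: "real \<Rightarrow> real"
  where "\<And>x. (h has_real_derivative h' x) (at x)"
    and "\<And>x. h' x - x * h x = \<phi> x - (\<integral>y. \<phi> y * \<rho> y \<partial>lborel)"
    and "\<And>x. \<bar>h x\<bar> \<le> 6" and "\<And>x. \<bar>h' x\<bar> \<le> 4"
    and "\<And>x y. \<bar>h' x - h' y\<bar> \<le> 8 * \<bar>x - y\<bar>"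
proof -
  define g where "g y = \<phi> y - (\<integral>y. \<phi> y * \<rho> y \<partial>lborel)" for y
  have "1-lipschitz_on UNIV \<phi>" using lip by (auto simp: lipschitz_on_def dist_real_def)
  then have cphi: "continuous_on UNIV \<phi>" by (rule lipschitz_on_continuous_on)
  then have mphi: "\<phi> \<in> borel_measurable borel" by (rule borel_measurable_continuous_onI)
  have cchi: "continuous_on UNIV g" unfolding g_def by (intro continuous_intros cphi)
  then have mchi: "g \<in> borel_measurable borel" by (rule borel_measurable_continuous_onI)
  have iphi: "integrable lborel (\<lambda>y. \<phi> y * \<rho> y)" by (rule integrable_times_rho[OF mphi b])
  have one: "(\<integral>y. \<rho> y \<partial>lborel) = 1"
    using std_normal_moment_even[of 0] by (simp add: has_bochner_integral_iff)
  have "\<bar>\<integral>y. \<phi> y * \<rho> y \<partial>lborel\<bar> \<le> (\<integral>y. 1 * \<rho> y \<partial>lborel)"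
  proof (rule order_trans[OF integral_abs_bound integral_mono])
    show "\<bar>\<phi> y * \<rho> y\<bar> \<le> 1 * \<rho> y" for y using b[of y] by (simp add: abs_mult mult_left_le_one_le)
  qed (use iphi integrable_rho in auto)
  then have mean: "\<bar>\<integral>y. \<phi> y * \<rho> y \<partial>lborel\<bar> \<le> 1" using one by simp
  have bchi: "\<bar>g y\<bar> \<le> 2" for y unfolding g_def using b[of y] mean by linarith
  have lchi: "\<bar>g y - g z\<bar> \<le> \<bar>y - z\<bar>" for y z unfolding g_def using lip[of y z] by simp
  have ichi: "integrable lborel (\<lambda>y. g y * \<rho> y)" by (rule integrable_times_rho[OF mchi bchi])
  have zero: "(\<integral>y. g y * \<rho> y \<partial>lborel) = 0"
    unfolding g_def using iphi integrable_rho one by (simp add: left_diff_distrib)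
  define g' where "g' y = g (- y)" for y
  have bchi': "\<bar>g' y\<bar> \<le> 2" for y unfolding g'_def by (rule bchi)
  have lchi': "\<bar>g' y - g' z\<bar> \<le> \<bar>y - z\<bar>" for y z unfolding g'_def using lchi[of "-y" "-z"] by simp
  have mchi': "g' \<in> borel_measurable borel" unfolding g'_def using mchi by measurable
  \<comment> \<open>As \<open>g\<close> is centred, its upper tail is minus its lower tail; the reflected function reduces \<open>x < 0\<close> to \<open>0 \<le> x\<close>.\<close>
  have refl: "normal_tail g x = - normal_tail g' (- x)" for x
  proof -
    have "normal_tail g' (- x) = (\<integral>y. indicator {..x} y * (g y * \<rho> y) \<partial>lborel)"
      unfolding normal_tail_def
      using lborel_integral_real_affine[of "-1" "\<lambda>y. indicator {- x..} y * (g' y * \<rho> y)" 0]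
      by (simp add: g'_def rho_even indicator_def)
    moreover have "(\<integral>y. indicator {..x} y * (g y * \<rho> y) + indicator {x..} y * (g y * \<rho> y) \<partial>lborel)
        = (\<integral>y. g y * \<rho> y \<partial>lborel)"
      using mchi by (intro integral_cong_AE) (auto simp: indicator_def intro!: AE_I[where N = "{x}"])
    moreover have "(\<integral>y. indicator {..x} y * (g y * \<rho> y) + indicator {x..} y * (g y * \<rho> y) \<partial>lborel)
       = (\<integral>y. indicator {..x} y * (g y * \<rho> y) \<partial>lborel) + normal_tail g x"
      unfolding normal_tail_def using integrable_mult_indicator[OF _ ichi, of "{..x}"] integrable_tail[OF ichi, of x]
      by (subst Bochner_Integration.integral_add) auto
    ultimately show ?thesis using zero by simp
  qed
  have pos: "0 < \<rho> x" for x by (simp add: normal_density_pos)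
  have est: "\<bar>normal_tail g x\<bar> \<le> 6 * \<rho> x \<and> \<bar>x * normal_tail g x\<bar> \<le> 2 * \<rho> x
     \<and> \<bar>(1 + x\<^sup>2) * normal_tail g x - x * g x * \<rho> x\<bar> \<le> 7 * \<rho> x" for x
  proof (cases "0 \<le> x")
    case True
    then show ?thesis using normal_tail_estimates[OF True bchi lchi mchi] by blast
  next
    case False
    have x: "0 \<le> - x" using False by simp
    have eq: "(1 + x\<^sup>2) * - normal_tail g' (- x) - x * g x * \<rho> x
      = - ((1 + (- x)\<^sup>2) * normal_tail g' (- x) - (- x) * g' (- x) * \<rho> (- x))"
      by (simp add: g'_def rho_even)
    show ?thesis
      using normal_tail_estimates[OF x bchi' lchi' mchi']
      unfolding refl[of x] eq abs_minus_cancel by (simp only: rho_even) simp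
  qed
  define h where "h x = - normal_tail g x / \<rho> x" for x
  have hd: "(h has_real_derivative x * h x + g x) (at x)" for x
  proof -
    have "(h has_real_derivative (- (- (g x * \<rho> x)) * \<rho> x - (- normal_tail g x) * (- x * \<rho> x)) / (\<rho> x * \<rho> x)) (at x)"
      unfolding h_def[abs_def] using pos[of x]
      by (intro DERIV_divide DERIV_minus normal_tail_deriv[OF cchi ichi] rho_deriv) auto
    moreover have "(- (- (g x * \<rho> x)) * \<rho> x - (- normal_tail g x) * (- x * \<rho> x)) / (\<rho> x * \<rho> x) = x * h x + g x"
      unfolding h_def using pos[of x] by (simp add: divide_simps) (simp add: algebra_simps)
    ultimately show ?thesis by simp
  qed
  have h1: "\<bar>h x\<bar> \<le> 6" for x using est[of x] pos[of x] by (simp add: h_def abs_divide divide_le_eq)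
  have h2: "\<bar>x * h x\<bar> \<le> 2" for x
    using est[of x] pos[of x] by (simp add: h_def abs_divide abs_mult divide_le_eq)
  have h3: "\<bar>(1 + x\<^sup>2) * h x + x * g x\<bar> \<le> 7" for x
  proof -
    have "(1 + x\<^sup>2) * h x + x * g x = - ((1 + x\<^sup>2) * normal_tail g x - x * g x * \<rho> x) / \<rho> x"
      unfolding h_def using pos[of x] by (simp add: divide_simps)
    then show ?thesis using est[of x] pos[of x]
      by (simp add: abs_divide divide_le_eq abs_minus_commute[of "x * g x * \<rho> x"])
  qed
  have xh: "\<bar>x * h x - y * h y\<bar> \<le> 7 * \<bar>x - y\<bar>" for x y
  proof -
    have "((\<lambda>x. x * h x) has_real_derivative (1 + x\<^sup>2) * h x + x * g x) (at x)" for x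
      by (auto intro!: derivative_eq_intros hd simp: power2_eq_square algebra_simps)
    then show ?thesis
      using field_differentiable_bound[of UNIV "\<lambda>x. x * h x" "\<lambda>x. (1 + x\<^sup>2) * h x + x * g x" 7 x y] h3
      by simp
  qed
  show thesis
  proof (rule that[of h "\<lambda>x. x * h x + g x"])
    show "(h has_real_derivative x * h x + g x) (at x)" for x by (rule hd)
    show "x * h x + g x - x * h x = \<phi> x - (\<integral>y. \<phi> y * \<rho> y \<partial>lborel)" for x by (simp add: g_def)
    show "\<bar>h x\<bar> \<le> 6" for x by (rule h1)
    show "\<bar>x * h x + g x\<bar> \<le> 4" for x
      using order_trans[OF abs_triangle_ineq add_mono[OF h2 bchi], of x x] by simp
    show "\<bar>x * h x + g x - (y * h y + g y)\<bar> \<le> 8 * \<bar>x - y\<bar>" for x y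
      using order_trans[OF abs_triangle_ineq add_mono[OF xh lchi], of x y x y]
      by (simp add: algebra_simps)
  qed
qed

section \<open>Copies of a graph in a disk graph\<close>

text \<open>
  The isomorphism is a bijection from the indices rather than from the points, so that it behaves well
  under reindexing and rescaling; coinciding points would be one vertex of the disk graph.
\<close>

definition forms_copy ::
  "real \<Rightarrow> 'v pair_pre_digraph \<Rightarrow> (nat \<Rightarrow> 'a::real_normed_vector) \<Rightarrow> nat set \<Rightarrow> bool" where
  "forms_copy r \<Gamma> y I \<longleftrightarrow> (\<exists>b. bij_betw b I (pverts \<Gamma>) \<and> inj_on y I \<and>
     (\<forall>i\<in>I. \<forall>j\<in>I. (b i, b j) \<in> parcs \<Gamma> \<longleftrightarrow> norm (y i - y j) \<in> {0<..<r}))"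

definition copies ::
  "real \<Rightarrow> 'v pair_pre_digraph \<Rightarrow> (nat \<Rightarrow> 'a::real_normed_vector) \<Rightarrow> nat set \<Rightarrow> nat set set" where
  "copies r \<Gamma> y A = {I. I \<subseteq> A \<and> forms_copy r \<Gamma> y I}"

lemma wf_disk_graph: "wf_digraph (with_proj (disk_graph r V))"
  by unfold_locales (auto simp: disk_graph_def)

lemma induce_disk_graph:
  assumes "W \<subseteq> V"
  shows "induce_subgraph (with_proj (disk_graph r V)) W = with_proj (disk_graph r W)"
  using assms by (auto simp: induce_subgraph_def disk_graph_def with_proj_def)

text \<open>
  In a pair digraph an arc is the pair of its end vertices, so the arc map of an isomorphism is
  determined by its vertex map.
\<close>

lemma digraph_iso_with_proj_iff:
  assumes G: "wf_digraph (with_proj G)" and H: "wf_digraph (with_proj H)"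
  shows "digraph_iso (with_proj G) (with_proj H) \<longleftrightarrow>
    (\<exists>b. bij_betw b (pverts G) (pverts H) \<and>
      (\<forall>u\<in>pverts G. \<forall>v\<in>pverts G. (b u, b v) \<in> parcs H \<longleftrightarrow> (u, v) \<in> parcs G))"
proof
  assume "digraph_iso (with_proj G) (with_proj H)"
  then obtain h where h: "pre_digraph.digraph_isomorphism (with_proj G) h"
    and H: "with_proj H = app_iso h (with_proj G)" unfolding digraph_iso_def by blast
  have inj: "inj_on (iso_verts h) (pverts G)" using h by (auto simp: pre_digraph.digraph_isomorphism_def)
  from H have v: "pverts H = iso_verts h ` pverts G" and a: "parcs H = iso_arcs h ` parcs G"
    and t: "iso_tail h = fst" "iso_head h = snd" by (auto simp: app_iso_def with_proj_def)
  have ia: "iso_arcs h e = (iso_verts h (fst e), iso_verts h (snd e))" if "e \<in> parcs G" for e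
    using h that t by (auto simp: pre_digraph.digraph_isomorphism_def prod_eq_iff)
  have wf: "fst e \<in> pverts G" "snd e \<in> pverts G" if "e \<in> parcs G" for e
    using wf_digraph.tail_in_verts[OF G, of e] wf_digraph.head_in_verts[OF G, of e] that by auto
  have "(iso_verts h u, iso_verts h v) \<in> parcs H \<longleftrightarrow> (u, v) \<in> parcs G"
    if uv: "u \<in> pverts G" "v \<in> pverts G" for u v
  proof
    assume "(iso_verts h u, iso_verts h v) \<in> parcs H"
    then obtain e where e: "e \<in> parcs G" "(iso_verts h u, iso_verts h v) = iso_arcs h e"
      unfolding a by blast
    then have "u = fst e" "v = snd e" using ia[OF e(1)] wf[OF e(1)] uv inj by (auto dest: inj_onD)
    then show "(u, v) \<in> parcs G" using e by simp
  next
    assume "(u, v) \<in> parcs G"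
    then show "(iso_verts h u, iso_verts h v) \<in> parcs H" unfolding a using ia[of "(u, v)"]
      by (metis fst_conv snd_conv image_eqI)
  qed
  then show "\<exists>b. bij_betw b (pverts G) (pverts H) \<and>
      (\<forall>u\<in>pverts G. \<forall>v\<in>pverts G. (b u, b v) \<in> parcs H \<longleftrightarrow> (u, v) \<in> parcs G)"
    using inj v by (intro exI[of _ "iso_verts h"]) (auto simp: bij_betw_def)
next
  assume "\<exists>b. bij_betw b (pverts G) (pverts H) \<and>
      (\<forall>u\<in>pverts G. \<forall>v\<in>pverts G. (b u, b v) \<in> parcs H \<longleftrightarrow> (u, v) \<in> parcs G)"
  then obtain b where b: "inj_on b (pverts G)" "pverts H = b ` pverts G"
    and e: "\<And>u v. u \<in> pverts G \<Longrightarrow> v \<in> pverts G \<Longrightarrow> (b u, b v) \<in> parcs H \<longleftrightarrow> (u, v) \<in> parcs G"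
    by (auto simp: bij_betw_def)
  have wf: "u \<in> pverts G" "v \<in> pverts G" if "(u, v) \<in> parcs G" for u v
    using wf_digraph.tail_in_verts[OF G, of "(u,v)"] wf_digraph.head_in_verts[OF G, of "(u,v)"] that by auto
  have wfH: "u \<in> pverts H" "v \<in> pverts H" if "(u, v) \<in> parcs H" for u v
    using wf_digraph.tail_in_verts[OF H, of "(u,v)"] wf_digraph.head_in_verts[OF H, of "(u,v)"] that by auto
  define h where "h = \<lparr>iso_verts = b, iso_arcs = (\<lambda>(u, v). (b u, b v)), iso_head = snd, iso_tail = fst\<rparr>"
  have "parcs H = (\<lambda>(u, v). (b u, b v)) ` parcs G"
  proof (intro equalityI subrelI)
    fix u v assume uv: "(u, v) \<in> parcs H"
    then obtain u' v' where "u' \<in> pverts G" "v' \<in> pverts G" "u = b u'" "v = b v'"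
      using wfH[OF uv] b(2) by blast
    then show "(u, v) \<in> (\<lambda>(u, v). (b u, b v)) ` parcs G" using e uv by force
  next
    fix u v assume "(u, v) \<in> (\<lambda>(u, v). (b u, b v)) ` parcs G"
    then show "(u, v) \<in> parcs H" using e wf by force
  qed
  then have "with_proj H = app_iso h (with_proj G)"
    using b by (simp add: app_iso_def with_proj_def h_def)
  moreover have "pre_digraph.digraph_isomorphism (with_proj G) h"
    unfolding pre_digraph.digraph_isomorphism_def h_def using G b wf
    by (auto intro!: inj_onI dest: inj_onD)
  ultimately show "digraph_iso (with_proj G) (with_proj H)" unfolding digraph_iso_def by blast
qed

lemma forms_copy_iff_digraph_iso:
  assumes "pair_graph \<Gamma>" "finite I"
  shows "forms_copy r \<Gamma> y I \<longleftrightarrow> card I = card (pverts \<Gamma>) \<and>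
    digraph_iso (with_proj (disk_graph r (y ` I))) (with_proj \<Gamma>)"
proof -
  interpret pair_graph \<Gamma> by fact
  have wf: "wf_digraph (with_proj \<Gamma>)" by unfold_locales
  let ?D = "disk_graph r (y ` I)"
  show ?thesis unfolding digraph_iso_with_proj_iff[OF wf_disk_graph wf]
  proof
    assume "forms_copy r \<Gamma> y I"
    then obtain b where b: "bij_betw b I (pverts \<Gamma>)" "inj_on y I"
      and e: "\<forall>i\<in>I. \<forall>j\<in>I. (b i, b j) \<in> parcs \<Gamma> \<longleftrightarrow> norm (y i - y j) \<in> {0<..<r}"
      unfolding forms_copy_def by blast
    have inv: "the_inv_into I y (y i) = i" if "i \<in> I" for i using that b(2) by (simp add: the_inv_into_f_f)
    have "bij_betw (b \<circ> the_inv_into I y) (pverts ?D) (pverts \<Gamma>)"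
      using bij_betw_trans[OF bij_betw_the_inv_into[OF inj_on_imp_bij_betw[OF b(2)]] b(1)]
      by (simp add: disk_graph_def)
    moreover have "\<forall>u\<in>pverts ?D. \<forall>v\<in>pverts ?D.
       ((b \<circ> the_inv_into I y) u, (b \<circ> the_inv_into I y) v) \<in> parcs \<Gamma> \<longleftrightarrow> (u, v) \<in> parcs ?D"
      using e by (auto simp: disk_graph_def inv)
    ultimately show "card I = card (pverts \<Gamma>) \<and> (\<exists>b. bij_betw b (pverts ?D) (pverts \<Gamma>) \<and>
      (\<forall>u\<in>pverts ?D. \<forall>v\<in>pverts ?D. (b u, b v) \<in> parcs \<Gamma> \<longleftrightarrow> (u, v) \<in> parcs ?D))"
      using bij_betw_same_card[OF b(1)] by blast
  next
    assume "card I = card (pverts \<Gamma>) \<and> (\<exists>b. bij_betw b (pverts ?D) (pverts \<Gamma>) \<and>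
      (\<forall>u\<in>pverts ?D. \<forall>v\<in>pverts ?D. (b u, b v) \<in> parcs \<Gamma> \<longleftrightarrow> (u, v) \<in> parcs ?D))"
    then obtain b where c: "card I = card (pverts \<Gamma>)" and b: "bij_betw b (y ` I) (pverts \<Gamma>)"
      and e: "\<forall>u\<in>y ` I. \<forall>v\<in>y ` I. (b u, b v) \<in> parcs \<Gamma> \<longleftrightarrow> norm (u - v) \<in> {0<..<r}"
      by (auto simp: disk_graph_def)
    have "inj_on y I" using bij_betw_same_card[OF b] c assms(2) by (intro eq_card_imp_inj_on) auto
    moreover from this have "bij_betw (b \<circ> y) I (pverts \<Gamma>)"
      using bij_betw_trans[OF inj_on_imp_bij_betw b] by blast
    ultimately show "forms_copy r \<Gamma> y I"
      unfolding forms_copy_def using e by (intro exI[of _ "b \<circ> y"]) auto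
  qed
qed

lemma induced_count_eq_card_copies:
  assumes "pair_graph \<Gamma>"
  shows "induced_count r y n \<Gamma> = card (copies r \<Gamma> y {1..n})"
proof -
  have "digraph_iso (induce_subgraph (with_proj (disk_graph r (y ` {1..n}))) (y ` I)) (with_proj \<Gamma>)
      \<and> card I = card (pverts \<Gamma>) \<longleftrightarrow> forms_copy r \<Gamma> y I" if "I \<subseteq> {1..n}" for I
    using that finite_subset[OF that]
    by (subst induce_disk_graph) (auto simp: forms_copy_iff_digraph_iso[OF assms])
  then show ?thesis unfolding induced_count_def copies_def by (intro arg_cong[of _ _ card]) blast
qed

lemma forms_copy_cong:
  assumes "\<And>i. i \<in> I \<Longrightarrow> y i = y' i"
  shows "forms_copy r \<Gamma> y I \<longleftrightarrow> forms_copy r \<Gamma> y' I"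
proof -
  have "inj_on y I \<longleftrightarrow> inj_on y' I" using assms by (intro inj_on_cong) auto
  then show ?thesis unfolding forms_copy_def using assms by simp
qed

lemma forms_copy_reindex:
  assumes "inj_on \<pi> I"
  shows "forms_copy r \<Gamma> (\<lambda>i. y (\<pi> i)) I \<longleftrightarrow> forms_copy r \<Gamma> y (\<pi> ` I)"
proof
  assume "forms_copy r \<Gamma> (\<lambda>i. y (\<pi> i)) I"
  then obtain b where b: "bij_betw b I (pverts \<Gamma>)" "inj_on (\<lambda>i. y (\<pi> i)) I"
    and e: "\<forall>i\<in>I. \<forall>j\<in>I. (b i, b j) \<in> parcs \<Gamma> \<longleftrightarrow> norm (y (\<pi> i) - y (\<pi> j)) \<in> {0<..<r}"
    unfolding forms_copy_def by blast
  have inv: "the_inv_into I \<pi> (\<pi> i) = i" if "i \<in> I" for i using that assms by (simp add: the_inv_into_f_f)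
  have "bij_betw (b \<circ> the_inv_into I \<pi>) (\<pi> ` I) (pverts \<Gamma>)"
    by (rule bij_betw_trans[OF bij_betw_the_inv_into[OF inj_on_imp_bij_betw[OF assms]] b(1)])
  moreover have "inj_on y (\<pi> ` I)" using b(2) by (auto simp: inj_on_def)
  ultimately show "forms_copy r \<Gamma> y (\<pi> ` I)" unfolding forms_copy_def
    using e by (intro exI[of _ "b \<circ> the_inv_into I \<pi>"]) (auto simp: inv)
next
  assume "forms_copy r \<Gamma> y (\<pi> ` I)"
  then obtain b where b: "bij_betw b (\<pi> ` I) (pverts \<Gamma>)" "inj_on y (\<pi> ` I)"
    and e: "\<forall>i\<in>\<pi> ` I. \<forall>j\<in>\<pi> ` I. (b i, b j) \<in> parcs \<Gamma> \<longleftrightarrow> norm (y i - y j) \<in> {0<..<r}"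
    unfolding forms_copy_def by blast
  have "bij_betw (b \<circ> \<pi>) I (pverts \<Gamma>)"
    by (rule bij_betw_trans[OF inj_on_imp_bij_betw[OF assms] b(1)])
  moreover have "inj_on (\<lambda>i. y (\<pi> i)) I" using comp_inj_on[OF assms b(2)] by (simp add: comp_def)
  ultimately show "forms_copy r \<Gamma> (\<lambda>i. y (\<pi> i)) I" unfolding forms_copy_def
    using e by (intro exI[of _ "b \<circ> \<pi>"]) auto
qed

lemma forms_copy_card: "forms_copy r \<Gamma> y I \<Longrightarrow> card I = card (pverts \<Gamma>)"
  unfolding forms_copy_def by (auto dest: bij_betw_same_card)

lemma forms_copy_affine:
  assumes "0 < t"
  shows "forms_copy t \<Gamma> (\<lambda>i. x + t *\<^sub>R u i) I \<longleftrightarrow> forms_copy 1 \<Gamma> u I"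
proof -
  have n: "norm ((x + t *\<^sub>R u i) - (x + t *\<^sub>R u j)) \<in> {0<..<t} \<longleftrightarrow> norm (u i - u j) \<in> {0<..<1}" for i j
  proof -
    have "(x + t *\<^sub>R u i) - (x + t *\<^sub>R u j) = t *\<^sub>R (u i - u j)" by (simp add: algebra_simps)
    then show ?thesis using assms by (simp add: zero_less_mult_iff)
  qed
  have i: "inj_on (\<lambda>i. x + t *\<^sub>R u i) I \<longleftrightarrow> inj_on u I" using assms by (auto simp: inj_on_def)
  show ?thesis unfolding forms_copy_def n i ..
qed

lemma forms_copy_unique_graph:
  assumes "pair_graph \<Gamma>" "pair_graph \<Gamma>'" "forms_copy r \<Gamma> y I" "forms_copy r \<Gamma>' y I"
  shows "digraph_iso (with_proj \<Gamma>) (with_proj \<Gamma>')"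
proof -
  interpret G: pair_graph \<Gamma> by fact
  interpret G': pair_graph \<Gamma>' by fact
  have wf: "wf_digraph (with_proj \<Gamma>)" "wf_digraph (with_proj \<Gamma>')" by unfold_locales
  from assms obtain b c where b: "bij_betw b I (pverts \<Gamma>)" and c: "bij_betw c I (pverts \<Gamma>')"
    and e: "\<forall>i\<in>I. \<forall>j\<in>I. (b i, b j) \<in> parcs \<Gamma> \<longleftrightarrow> (c i, c j) \<in> parcs \<Gamma>'"
    unfolding forms_copy_def by blast
  have inv: "the_inv_into I b (b i) = i" if "i \<in> I" for i
    using that b by (simp add: the_inv_into_f_f bij_betw_def)
  have V: "pverts \<Gamma> = b ` I" using b by (simp add: bij_betw_def)
  show ?thesis unfolding digraph_iso_with_proj_iff[OF wf]
    using bij_betw_trans[OF bij_betw_the_inv_into[OF b] c] e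
    by (intro exI[of _ "c \<circ> the_inv_into I b"]) (auto simp: V inv)
qed

text \<open>
  Adjacent points are at distance below \<open>r\<close>, and a simple path has at most as many arcs as there are
  vertices.
\<close>

lemma forms_copy_dist:
  assumes G: "pair_graph \<Gamma>" and conn: "Digraph_Component.connected (with_proj \<Gamma>)"
    and f: "forms_copy r \<Gamma> y I" and ij: "i \<in> I" "j \<in> I" and r: "0 \<le> r"
  shows "norm (y i - y j) \<le> real (card (pverts \<Gamma>)) * r"
proof -
  interpret pair_graph \<Gamma> by fact
  have wf: "wf_digraph (with_proj \<Gamma>)" by unfold_locales
  from f obtain b where b: "bij_betw b I (pverts \<Gamma>)"
    and e: "\<And>i j. i\<in>I \<Longrightarrow> j\<in>I \<Longrightarrow> (b i, b j) \<in> parcs \<Gamma> \<Longrightarrow> norm (y i - y j) \<in> {0<..<r}"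
    unfolding forms_copy_def by blast
  define z where "z v = y (the_inv_into I b v)" for v
  have z: "z (b i) = y i" if "i \<in> I" for i
    using that b by (simp add: the_inv_into_f_f bij_betw_def z_def)
  have V: "pverts \<Gamma> = b ` I" using b by (simp add: bij_betw_def)
  have step: "norm (z u - z v) \<le> r" if "(u, v) \<in> parcs \<Gamma>" for u v
  proof -
    have "u \<in> b ` I" "v \<in> b ` I" using in_arcsD1[OF that] in_arcsD2[OF that] V by auto
    then show ?thesis using e that by (force simp: z)
  qed
  have walk: "norm (z u - z v) \<le> real (length p) * r" if "pcas u p v" "set p \<subseteq> parcs \<Gamma>" for u v p
    using that
  proof (induction p arbitrary: u)
    case (Cons a p)
    have "norm (z u - z v) \<le> norm (z u - z (snd a)) + norm (z (snd a) - z v)"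
      using dist_triangle[of "z u" "z v" "z (snd a)"] by (simp add: dist_norm)
    also have "\<dots> \<le> r + real (length p) * r"
      using Cons step[of u "snd a"] by (intro add_mono) (auto simp: prod_eq_iff)
    finally show ?case by (simp add: algebra_simps)
  qed simp
  have "(b i) \<rightarrow>\<^sup>*\<^bsub>with_proj (mk_symmetric \<Gamma>)\<^esub> (b j)"
    using conn ij V by (auto simp: Digraph_Component.connected_def)
  then have "b i \<rightarrow>\<^sup>*\<^bsub>with_proj \<Gamma>\<^esub> b j"
    using wf_digraph.reachable_mk_symmetric_eq[of "with_proj \<Gamma>"] pair_sym_arcs wf by blast
  then obtain p where p: "apath (b i) p (b j)" unfolding reachable_apath by blast
  have "length p \<le> card (pverts \<Gamma>)" using length_apath[OF p] by simp
  moreover have "norm (z (b i) - z (b j)) \<le> real (length p) * r"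
    using p by (intro walk) (auto simp: apath_def awalk_def)
  moreover have "real (length p) * r \<le> real (card (pverts \<Gamma>)) * r"
    using calculation(1) r by (intro mult_right_mono) auto
  ultimately show ?thesis using ij by (simp add: z)
qed

text \<open>
  This yields the measurability of every random variable that is computed from a finite family of
  events, in particular of the numbers of copies.
\<close>

lemma measurable_finite_selection:
  fixes P :: "'i \<Rightarrow> 'x \<Rightarrow> bool"
  assumes "finite F" "\<And>i. i \<in> F \<Longrightarrow> {x \<in> space M. P i x} \<in> sets M"
  shows "(\<lambda>x. {i \<in> F. P i x}) \<in> measurable M (count_space UNIV)"
proof (rule measurableI)
  fix X :: "'i set set"
  have "{x \<in> space M. {i \<in> F. P i x} = S} \<in> sets M" if "S \<subseteq> F" for S
  proof -
    have "{x \<in> space M. {i \<in> F. P i x} = S} = {x \<in> space M. \<forall>i\<in>F. P i x \<longleftrightarrow> i \<in> S}"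
      using that by auto
    also have "\<dots> \<in> sets M"
      using assms(2) by (intro sets.sets_Collect_finite_All[OF _ assms(1)] sets.sets_Collect) auto
    finally show ?thesis .
  qed
  moreover have "(\<lambda>x. {i \<in> F. P i x}) -` X \<inter> space M
    = (\<Union>S\<in>Pow F \<inter> X. {x \<in> space M. {i \<in> F. P i x} = S})" by auto
  ultimately show "(\<lambda>x. {i \<in> F. P i x}) -` X \<inter> space M \<in> sets M"
    using assms(1) by (auto intro!: sets.finite_UN)
qed simp

lemma forms_copy_measurable:
  fixes D :: "'a::{real_normed_vector, second_countable_topology} measure"
  assumes D: "sets D = sets borel" and G: "finite (pverts \<Gamma>)" and I: "finite I" "I \<subseteq> K"
  shows "{y \<in> space (PiM K (\<lambda>_. D)). forms_copy r \<Gamma> y I} \<in> sets (PiM K (\<lambda>_. D))"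
proof -
  let ?M = "PiM K (\<lambda>_. D)"
  have comp[measurable]: "(\<lambda>y. y i) \<in> borel_measurable ?M" if "i \<in> I" for i
  proof -
    have "(\<lambda>y. y i) \<in> measurable ?M D" using that I by (intro measurable_component_singleton) auto
    then show ?thesis by (simp only: measurable_cong_sets[OF refl D])
  qed
  \<comment> \<open>Only the values of the bijection on \<open>I\<close> matter, so finitely many candidates suffice.\<close>
  define B where "B = {b \<in> I \<rightarrow>\<^sub>E pverts \<Gamma>. bij_betw b I (pverts \<Gamma>)}"
  have "finite B" unfolding B_def using finite_PiE[of I "\<lambda>_. pverts \<Gamma>"] I G by simp
  have eq: "forms_copy r \<Gamma> y I \<longleftrightarrow> (\<exists>b\<in>B. (\<forall>i\<in>I. \<forall>j\<in>I. (norm (y i - y j) = 0 \<longrightarrow> i = j) \<and>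
     ((b i, b j) \<in> parcs \<Gamma> \<longleftrightarrow> norm (y i - y j) \<in> {0<..<r})))" (is "?L = ?R") for y
  proof
    assume ?L
    then obtain b where b: "bij_betw b I (pverts \<Gamma>)" "inj_on y I"
      "\<forall>i\<in>I. \<forall>j\<in>I. (b i, b j) \<in> parcs \<Gamma> \<longleftrightarrow> norm (y i - y j) \<in> {0<..<r}"
      unfolding forms_copy_def by blast
    have "bij_betw (restrict b I) I (pverts \<Gamma>)" using b(1) by (subst bij_betw_cong[of I _ b]) auto
    then have "restrict b I \<in> B" unfolding B_def by (auto simp: bij_betw_def)
    then show ?R using b(2,3) by (intro bexI[of _ "restrict b I"]) (auto dest: inj_onD)
  next
    assume ?R then show ?L unfolding forms_copy_def B_def inj_on_def by force
  qed
  have "{y \<in> space ?M. (norm (y i - y j) = 0 \<longrightarrow> i = j) \<and>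
     ((b i, b j) \<in> parcs \<Gamma> \<longleftrightarrow> norm (y i - y j) \<in> {0<..<r})} \<in> sets ?M" if "i \<in> I" "j \<in> I" for i j b
  proof -
    have d: "(\<lambda>y. norm (y i - y j)) \<in> borel_measurable ?M"
      using comp[OF that(1)] comp[OF that(2)] by measurable
    have "{v. (v = 0 \<longrightarrow> i = j) \<and> ((b i, b j) \<in> parcs \<Gamma> \<longleftrightarrow> v \<in> {0<..<r})}
      = (if i = j then UNIV else - {0}) \<inter> (if (b i, b j) \<in> parcs \<Gamma> then {0<..<r} else - {0<..<r})"
      by auto
    also have "\<dots> \<in> sets borel" by auto
    finally have "(\<lambda>y. norm (y i - y j)) -` {v. (v = 0 \<longrightarrow> i = j) \<and> ((b i, b j) \<in> parcs \<Gamma> \<longleftrightarrow> v \<in> {0<..<r})}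
        \<inter> space ?M \<in> sets ?M" by (rule measurable_sets[OF d])
    also have "(\<lambda>y. norm (y i - y j)) -` {v. (v = 0 \<longrightarrow> i = j) \<and> ((b i, b j) \<in> parcs \<Gamma> \<longleftrightarrow> v \<in> {0<..<r})}
        \<inter> space ?M = {y \<in> space ?M. (norm (y i - y j) = 0 \<longrightarrow> i = j) \<and>
          ((b i, b j) \<in> parcs \<Gamma> \<longleftrightarrow> norm (y i - y j) \<in> {0<..<r})}" by auto
    finally show ?thesis .
  qed
  then show ?thesis unfolding eq
    by (intro sets.sets_Collect_finite_Ex[OF _ \<open>finite B\<close>] sets.sets_Collect_finite_All[OF _ I(1)]) auto
qed

section \<open>Poisson samples and the Mecke formula\<close>

text \<open>
  A functional of the points with indices in a finite set that does not depend on how these points are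
  numbered. As the restriction shows, it also ignores the points with other indices.
\<close>

definition equivariant :: "((nat \<Rightarrow> 'a) \<Rightarrow> nat set \<Rightarrow> 'b) \<Rightarrow> bool" where
  "equivariant H \<longleftrightarrow> (\<forall>y \<pi> A. inj_on \<pi> A \<longrightarrow> H (\<lambda>i\<in>A. y (\<pi> i)) A = H y (\<pi> ` A))"

lemma equivariantD: "equivariant H \<Longrightarrow> inj_on \<pi> A \<Longrightarrow> H (\<lambda>i\<in>A. y (\<pi> i)) A = H y (\<pi> ` A)"
  unfolding equivariant_def by blast

lemma equivariant_restrict:
  assumes "equivariant H" shows "H (restrict y A) A = H y A"
  using equivariantD[OF assms, of "\<lambda>i. i" A y] by simp

lemma equivariant_cong:
  assumes "equivariant H" "\<And>i. i \<in> A \<Longrightarrow> y i = z i" shows "H y A = H z A"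
proof -
  have "restrict y A = restrict z A" using assms(2) by (rule restrict_ext)
  then have "H (restrict y A) A = H (restrict z A) A" by (rule arg_cong)
  then show ?thesis unfolding equivariant_restrict[OF assms(1)] .
qed

lemma equivariant_reindex:
  assumes "equivariant H" "inj_on \<pi> I" "I \<subseteq> A"
  shows "H (\<lambda>i\<in>A. y (\<pi> i)) I = H y (\<pi> ` I)"
proof -
  have "H (\<lambda>i\<in>A. y (\<pi> i)) I = H (\<lambda>i\<in>I. y (\<pi> i)) I"
    by (rule equivariant_cong[OF assms(1)]) (use assms(3) in auto)
  then show ?thesis using equivariantD[OF assms(1,2)] by simp
qed

definition local_measurable :: "'a measure \<Rightarrow> ((nat \<Rightarrow> 'a) \<Rightarrow> nat set \<Rightarrow> 'b) \<Rightarrow> bool" where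
  "local_measurable D H \<longleftrightarrow> (\<forall>A. finite A \<longrightarrow>
     (\<lambda>y. H y A) \<in> measurable (PiM A (\<lambda>_. D)) (count_space UNIV))"

lemma local_measurable_PiM:
  assumes e: "equivariant H" and m: "local_measurable D H" and A: "finite A" "A \<subseteq> K"
  shows "(\<lambda>y. H y A) \<in> measurable (PiM K (\<lambda>_. D)) (count_space UNIV)"
proof -
  have "(\<lambda>y. H (restrict y A) A) \<in> measurable (PiM K (\<lambda>_. D)) (count_space UNIV)"
    using A m by (intro measurable_compose[OF measurable_restrict_subset]) (auto simp: local_measurable_def)
  then show ?thesis by (simp add: equivariant_restrict[OF e])
qed

lemma nn_integral_poisson:
  assumes "0 < n"
  shows "(\<integral>\<^sup>+i. f i \<partial>measure_pmf (poisson_pmf n)) = (\<Sum>i. ennreal (n ^ i / fact i * exp (- n)) * f i)"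
  using assms by (simp add: nn_integral_measure_pmf nn_integral_count_space_nat)

lemma suminf_ennreal_shift:
  fixes f :: "nat \<Rightarrow> ennreal"
  assumes "\<And>i. i < p \<Longrightarrow> f i = 0"
  shows "(\<Sum>i. f i) = (\<Sum>i. f (i + p))"
proof -
  have "(\<Sum>i. f i) = (\<integral>\<^sup>+i. f i \<partial>count_space UNIV)" by (simp add: nn_integral_count_space_nat)
  also have "\<dots> = (\<integral>\<^sup>+i. f i \<partial>count_space {p..})"
    using assms by (intro nn_integral_count_space_eq) auto
  also have "\<dots> = (\<integral>\<^sup>+i. f (i + p) \<partial>count_space UNIV)"
  proof (rule nn_integral_bij_count_space[of "\<lambda>i. i + p" UNIV "{p..}" f, symmetric])
    show "bij_betw (\<lambda>i. i + p) UNIV {p..}"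
      by (rule bij_betw_byWitness[of _ "\<lambda>i. i - p"]) auto
  qed
  finally show ?thesis by (simp add: nn_integral_count_space_nat)
qed

text \<open>
  A Poisson sample is modelled as the first \<open>i\<close> points of an infinite sequence of independent points
  with law \<open>D\<close>, where \<open>i\<close> is an independent Poisson variable with mean \<open>n\<close>. The points are numbered
  from \<open>1\<close>.
\<close>

locale poisson_sample = prob_space D for D :: "'a measure" +
  fixes n :: real
  assumes n_pos: "0 < n"
begin

definition Q where "Q = PiM {1::nat..} (\<lambda>_. D)"

definition \<Omega> where "\<Omega> = measure_pmf (poisson_pmf n) \<Otimes>\<^sub>M Q"

sublocale S: product_prob_space "\<lambda>_. D" "{1::nat..}" ..

sublocale Q: prob_space Q
  unfolding Q_def by (rule prob_space_PiM) (rule prob_space_axioms)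

sublocale PQ: pair_prob_space "measure_pmf (poisson_pmf n)" Q ..

sublocale P: prob_space \<Omega>
  unfolding \<Omega>_def by (rule PQ.prob_space_axioms)

lemma measurable_\<Omega>:
  assumes "\<And>i. (\<lambda>y. f i y) \<in> measurable Q N"
  shows "(\<lambda>(i, y). f i y) \<in> measurable \<Omega> N"
proof -
  have "(\<lambda>(i, y). f i y) \<in> measurable (count_space UNIV \<Otimes>\<^sub>M Q) N"
    using assms by (intro measurable_pair_measure_countable1) auto
  moreover have "measurable \<Omega> N = measurable (count_space UNIV \<Otimes>\<^sub>M Q) N"
    unfolding \<Omega>_def by (intro measurable_cong_sets sets_pair_measure_cong) auto
  ultimately show ?thesis by simp
qed

lemma nn_integral_\<Omega>:
  assumes f: "\<And>i. f i \<in> borel_measurable Q"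
  shows "(\<integral>\<^sup>+\<omega>. (case \<omega> of (i, y) \<Rightarrow> f i y) \<partial>\<Omega>)
    = (\<Sum>i. ennreal (n ^ i / fact i * exp (- n)) * (\<integral>\<^sup>+y. f i y \<partial>Q))"
proof -
  have "case_prod f \<in> borel_measurable (measure_pmf (poisson_pmf n) \<Otimes>\<^sub>M Q)"
    using measurable_\<Omega>[OF f] unfolding \<Omega>_def .
  from Q.nn_integral_fst[OF this]
  have "(\<integral>\<^sup>+\<omega>. case_prod f \<omega> \<partial>\<Omega>) = (\<integral>\<^sup>+i. \<integral>\<^sup>+y. f i y \<partial>Q \<partial>measure_pmf (poisson_pmf n))"
    unfolding \<Omega>_def by simp
  then show ?thesis unfolding nn_integral_poisson[OF n_pos] .
qed

lemma nn_integral_Q_reindex: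
  assumes A: "finite A" "inj_on \<pi> A" "\<pi> ` A \<subseteq> {1..}" and F: "F \<in> borel_measurable (PiM A (\<lambda>_. D))"
  shows "(\<integral>\<^sup>+y. F (\<lambda>i\<in>A. y (\<pi> i)) \<partial>Q) = (\<integral>\<^sup>+z. F z \<partial>PiM A (\<lambda>_. D))"
proof -
  have m: "(\<lambda>y. \<lambda>i\<in>A. y (\<pi> i)) \<in> measurable Q (PiM A (\<lambda>_. D))"
    unfolding Q_def using A by (intro measurable_restrict measurable_component_singleton) auto
  have "PiM A (\<lambda>_. D) = distr Q (PiM A (\<lambda>_. D)) (\<lambda>y. \<lambda>i\<in>A. y (\<pi> i))"
    unfolding Q_def using A prob_space_axioms by (intro distr_PiM_reindex[symmetric]) auto
  then have "(\<integral>\<^sup>+z. F z \<partial>PiM A (\<lambda>_. D)) = (\<integral>\<^sup>+z. F z \<partial>distr Q (PiM A (\<lambda>_. D)) (\<lambda>y. \<lambda>i\<in>A. y (\<pi> i)))"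
    by simp
  then show ?thesis using nn_integral_distr[OF m] F by simp
qed

lemma nn_integral_Q_restrict:
  assumes "finite A" "A \<subseteq> {1..}" "F \<in> borel_measurable (PiM A (\<lambda>_. D))"
  shows "(\<integral>\<^sup>+y. F (restrict y A) \<partial>Q) = (\<integral>\<^sup>+z. F z \<partial>PiM A (\<lambda>_. D))"
  using nn_integral_Q_reindex[of A "\<lambda>i. i" F] assms by simp

end

text \<open>
  Here \<open>u\<close> selects the index sets of the patterns to be counted, all of size \<open>p\<close>, and \<open>c\<close> is the
  random element, computed from a set of points, whose law is to be approximated.
\<close>

locale poisson_sample_functionals = poisson_sample D n for D :: "'a measure" and n +
  fixes u :: "(nat \<Rightarrow> 'a) \<Rightarrow> nat set \<Rightarrow> bool" and c :: "(nat \<Rightarrow> 'a) \<Rightarrow> nat set \<Rightarrow> 'c" and p :: nat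
  assumes u: "equivariant u" "local_measurable D u" and c: "equivariant c" "local_measurable D c"
    and u_card: "\<And>y I. u y I \<Longrightarrow> card I = p"
begin

lemma meas_u: "finite A \<Longrightarrow> A \<subseteq> K \<Longrightarrow> (\<lambda>y. F (u y A)) \<in> borel_measurable (PiM K (\<lambda>_. D))"
  using measurable_compose[OF local_measurable_PiM[OF u], of A K F borel] by simp

lemma meas_c: "finite A \<Longrightarrow> A \<subseteq> K \<Longrightarrow> (\<lambda>y. F (c y A)) \<in> borel_measurable (PiM K (\<lambda>_. D))"
  using measurable_compose[OF local_measurable_PiM[OF c], of A K F borel] by simp

lemma nn_integral_block_cong:
  fixes \<Phi> :: "'c \<Rightarrow> ennreal"
  assumes A: "finite A" "A \<subseteq> {1..}" and I: "I \<subseteq> A" and pi: "inj_on \<pi> A" "\<pi> ` A \<subseteq> {1..}"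
  shows "(\<integral>\<^sup>+y. of_bool (u y (\<pi> ` I)) * \<Phi> (c y (\<pi> ` A)) \<partial>Q) = (\<integral>\<^sup>+y. of_bool (u y I) * \<Phi> (c y A) \<partial>Q)"
proof -
  define F where "F z = of_bool (u z I) * \<Phi> (c z A)" for z
  have fI: "finite I" using I A finite_subset by blast
  have F: "F \<in> borel_measurable (PiM A (\<lambda>_. D))" unfolding F_def
    by (intro borel_measurable_times_ennreal meas_u meas_c) (use A I fI in auto)
  have "(\<integral>\<^sup>+y. of_bool (u y (\<pi> ` I)) * \<Phi> (c y (\<pi> ` A)) \<partial>Q) = (\<integral>\<^sup>+y. F (\<lambda>i\<in>A. y (\<pi> i)) \<partial>Q)"
    unfolding F_def equivariant_reindex[OF u(1) inj_on_subset[OF pi(1) I] I]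
      equivariantD[OF c(1) pi(1)] ..
  also have "\<dots> = (\<integral>\<^sup>+z. F z \<partial>PiM A (\<lambda>_. D))" by (rule nn_integral_Q_reindex[OF A(1) pi F])
  also have "\<dots> = (\<integral>\<^sup>+y. F (restrict y A) \<partial>Q)" by (rule nn_integral_Q_restrict[OF A F, symmetric])
  also have "\<dots> = (\<integral>\<^sup>+y. of_bool (u y I) * \<Phi> (c y A) \<partial>Q)"
  proof -
    have "u (restrict y A) I = u y I" for y using I by (intro equivariant_cong[OF u(1)]) auto
    then show ?thesis unfolding F_def equivariant_restrict[OF c(1)] by (simp only:)
  qed
  finally show ?thesis .
qed

text \<open>
  A permutation of \<open>{1..N}\<close> that maps \<open>{1..p}\<close> onto \<open>I\<close> preserves the law of the points.
\<close>

lemma nn_integral_block_std: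
  fixes \<Phi> :: "'c \<Rightarrow> ennreal"
  assumes "I \<subseteq> {1..N}" "card I = p"
  shows "(\<integral>\<^sup>+y. of_bool (u y I) * \<Phi> (c y {1..N}) \<partial>Q)
    = (\<integral>\<^sup>+y. of_bool (u y {1..p}) * \<Phi> (c y {1..N}) \<partial>Q)"
proof -
  have pN: "p \<le> N" using card_mono[OF _ assms(1)] assms(2) by simp
  have fI: "finite I" using assms(1) finite_subset by blast
  have "card {1..p} = card I" using assms(2) by simp
  then obtain a where a: "bij_betw a {1..p} I"
    using finite_same_card_bij[OF finite_atLeastAtMost fI] by blast
  have "card ({1..N} - {1..p}) = card ({1..N} - I)"
    using assms pN fI by (subst (1 2) card_Diff_subset) auto
  then obtain b where b: "bij_betw b ({1..N} - {1..p}) ({1..N} - I)"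
    using finite_same_card_bij by (metis finite_Diff finite_atLeastAtMost)
  define \<pi> where "\<pi> i = (if i \<in> {1..p} then a i else b i)" for i
  have "bij_betw \<pi> ({1..p} \<union> ({1..N} - {1..p})) (I \<union> ({1..N} - I))"
    unfolding \<pi>_def using a b by (intro bij_betw_disjoint_Un) auto
  moreover have "{1..p} \<union> ({1..N} - {1..p}) = {1..N}" "I \<union> ({1..N} - I) = {1..N}" using pN assms by auto
  ultimately have pi: "bij_betw \<pi> {1..N} {1..N}" by simp
  have "\<pi> ` {1..p} = a ` {1..p}" unfolding \<pi>_def by auto
  then have "\<pi> ` {1..p} = I" using a by (simp add: bij_betw_def)
  moreover have "inj_on \<pi> {1..N}" "\<pi> ` {1..N} = {1..N}" using pi by (auto simp only: bij_betw_def)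
  moreover have "{1..p} \<subseteq> {1..N}" "{1..N} \<subseteq> {1..}" using pN by auto
  ultimately show ?thesis
    using nn_integral_block_cong[of "{1..N}" "{1..p}" \<pi> \<Phi>] by (simp only: finite_atLeastAtMost)
qed

text \<open>
  Summing over the \<open>i choose p\<close> index sets, which contribute equally by symmetry, and using
  \<open>n ^ i / i! (i choose p) = n ^ p / p! (n ^ (i - p) / (i - p)!)\<close>, the number of points besides the
  pattern is again a Poisson variable with mean \<open>n\<close>. On the right the points of the pattern are numbered
  \<open>{1..p}\<close> and the others, called old below, \<open>{p + 1..p + i}\<close>.
\<close>

theorem mecke:
  fixes \<Phi> :: "'c \<Rightarrow> ennreal"
  shows "(\<integral>\<^sup>+(i, y). of_nat (card {I. I \<subseteq> {1..i} \<and> u y I}) * \<Phi> (c y {1..i}) \<partial>\<Omega>)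
    = ennreal (n ^ p / fact p) * (\<integral>\<^sup>+(i, y). of_bool (u y {1..p}) * \<Phi> (c y {1..p + i}) \<partial>\<Omega>)"
proof -
  let ?w = "\<lambda>i. ennreal (n ^ i / fact i * exp (- n))"
  define a where "a i = (\<integral>\<^sup>+y. of_bool (u y {1..p}) * \<Phi> (c y {1..i}) \<partial>Q)" for i
  have mQ[measurable]: "(\<lambda>y. of_bool (u y A) * \<Phi> (c y B)) \<in> borel_measurable Q"
    if "finite A" "A \<subseteq> {1..}" "finite B" "B \<subseteq> {1..}" for A B
    unfolding Q_def using that by (intro borel_measurable_times_ennreal meas_u meas_c)
  have card_eq: "of_nat (card {I. I \<subseteq> {1..i} \<and> u y I}) * \<Phi> (c y {1..i})
    = (\<Sum>I | I \<subseteq> {1..i} \<and> card I = p. of_bool (u y I) * \<Phi> (c y {1..i}))" for i y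
  proof -
    have f: "finite {I. I \<subseteq> {1..i} \<and> card I = p}"
      by (rule finite_subset[of _ "Pow {1..i}"]) auto
    have "{I. I \<subseteq> {1..i} \<and> u y I} = {I. I \<subseteq> {1..i} \<and> card I = p} \<inter> {I. u y I}" using u_card by auto
    then have "of_nat (card {I. I \<subseteq> {1..i} \<and> u y I})
      = (\<Sum>I | I \<subseteq> {1..i} \<and> card I = p. of_bool (u y I) :: ennreal)"
      using f by (simp add: of_bool_def sum.If_cases)
    then show ?thesis by (simp add: sum_distrib_right)
  qed
  have inner: "(\<integral>\<^sup>+y. of_nat (card {I. I \<subseteq> {1..i} \<and> u y I}) * \<Phi> (c y {1..i}) \<partial>Q)
    = of_nat (i choose p) * a i" for i
  proof -
    have "(\<integral>\<^sup>+y. of_nat (card {I. I \<subseteq> {1..i} \<and> u y I}) * \<Phi> (c y {1..i}) \<partial>Q)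
      = (\<Sum>I | I \<subseteq> {1..i} \<and> card I = p. \<integral>\<^sup>+y. of_bool (u y I) * \<Phi> (c y {1..i}) \<partial>Q)"
      unfolding card_eq by (intro nn_integral_sum mQ) (auto intro: finite_subset)
    also have "\<dots> = (\<Sum>I | I \<subseteq> {1..i} \<and> card I = p. a i)"
      unfolding a_def by (intro sum.cong refl nn_integral_block_std) auto
    also have "\<dots> = of_nat (i choose p) * a i"
      using n_subsets[of "{1..i}" p] by simp
    finally show ?thesis .
  qed
  have mL: "(\<lambda>y. of_nat (card {I. I \<subseteq> {1..i} \<and> u y I}) * \<Phi> (c y {1..i})) \<in> borel_measurable Q" for i
    unfolding card_eq by (intro borel_measurable_sum mQ) (auto intro: finite_subset)
  have "(\<integral>\<^sup>+(i, y). of_nat (card {I. I \<subseteq> {1..i} \<and> u y I}) * \<Phi> (c y {1..i}) \<partial>\<Omega>)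
    = (\<Sum>i. ?w i * (of_nat (i choose p) * a i))"
    unfolding nn_integral_\<Omega>[OF mL] inner ..
  also have "\<dots> = (\<Sum>i. ?w (i + p) * (of_nat ((i + p) choose p) * a (i + p)))"
    by (rule suminf_ennreal_shift) simp
  also have "\<dots> = (\<Sum>i. ennreal (n ^ p / fact p) * (?w i * a (i + p)))"
  proof (intro arg_cong[of _ _ suminf] ext)
    fix i
    have "n ^ (i + p) / fact (i + p) * exp (- n) * real ((i + p) choose p)
      = n ^ p / fact p * (n ^ i / fact i * exp (- n))"
      by (simp add: binomial_fact power_add field_simps)
    then have "?w (i + p) * of_nat ((i + p) choose p) = ennreal (n ^ p / fact p) * ?w i"
      using n_pos by (simp add: ennreal_of_nat_eq_real_of_nat ennreal_mult''[symmetric] del: of_nat_binomial_eq_mult_binomial_Suc)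
    then show "?w (i + p) * (of_nat ((i + p) choose p) * a (i + p)) = ennreal (n ^ p / fact p) * (?w i * a (i + p))"
      by (simp add: mult.assoc[symmetric])
  qed
  also have "\<dots> = ennreal (n ^ p / fact p) * (\<Sum>i. ?w i * a (i + p))"
    by (rule ennreal_suminf_cmult)
  also have "(\<Sum>i. ?w i * a (i + p)) = (\<integral>\<^sup>+(i, y). of_bool (u y {1..p}) * \<Phi> (c y {1..p + i}) \<partial>\<Omega>)"
    by (subst nn_integral_\<Omega>[OF mQ]) (auto simp: a_def add.commute)
  finally show ?thesis .
qed

lemma nn_integral_split_block:
  assumes F: "F \<in> borel_measurable (PiM {1..p + i} (\<lambda>_. D))"
  shows "(\<integral>\<^sup>+y. F (restrict y {1..p + i}) \<partial>Q)
    = (\<integral>\<^sup>+x. \<integral>\<^sup>+z. F (merge {1..p} {p + 1..p + i} (x, z)) \<partial>PiM {p + 1..p + i} (\<lambda>_. D) \<partial>PiM {1..p} (\<lambda>_. D))"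
proof -
  have eq: "{1..p + i} = {1..p} \<union> {p + 1..p + i}" by auto
  have "(\<integral>\<^sup>+y. F (restrict y {1..p + i}) \<partial>Q) = (\<integral>\<^sup>+z. F z \<partial>PiM {1..p + i} (\<lambda>_. D))"
    by (rule nn_integral_Q_restrict[OF _ _ F]) auto
  also have "\<dots> = (\<integral>\<^sup>+x. \<integral>\<^sup>+z. F (merge {1..p} {p + 1..p + i} (x, z)) \<partial>PiM {p + 1..p + i} (\<lambda>_. D) \<partial>PiM {1..p} (\<lambda>_. D))"
    unfolding eq by (rule S.product_nn_integral_fold) (use F eq in auto)
  finally show ?thesis .
qed

lemma nn_integral_u_Q: "(\<integral>\<^sup>+y. of_bool (u y {1..p}) \<partial>Q) = (\<integral>\<^sup>+x. of_bool (u x {1..p}) \<partial>PiM {1..p} (\<lambda>_. D))"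
proof -
  have "(\<integral>\<^sup>+y. of_bool (u (restrict y {1..p}) {1..p}) \<partial>Q) = (\<integral>\<^sup>+x. of_bool (u x {1..p}) \<partial>PiM {1..p} (\<lambda>_. D))"
    by (rule nn_integral_Q_restrict) (auto intro: meas_u)
  then show ?thesis by (simp add: equivariant_restrict[OF u(1)])
qed

text \<open>
  Given the number of old points, these and the planted ones are disjoint blocks of a sequence of
  independent points.
\<close>

theorem old_points_independent:
  fixes \<Phi> :: "'c \<Rightarrow> ennreal"
  shows "(\<integral>\<^sup>+(i, y). of_bool (u y {1..p}) * \<Phi> (c y {p + 1..p + i}) \<partial>\<Omega>)
    = (\<integral>\<^sup>+y. of_bool (u y {1..p}) \<partial>Q) * (\<integral>\<^sup>+(i, y). \<Phi> (c y {1..i}) \<partial>\<Omega>)"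
proof -
  let ?w = "\<lambda>i. ennreal (n ^ i / fact i * exp (- n))"
  let ?U = "\<integral>\<^sup>+y. of_bool (u y {1..p}) \<partial>Q"
  have *: "(\<integral>\<^sup>+y. of_bool (u y {1..p}) * \<Phi> (c y {p + 1..p + i}) \<partial>Q) = ?U * (\<integral>\<^sup>+y. \<Phi> (c y {1..i}) \<partial>Q)" for i
  proof -
    let ?B = "{p + 1..p + i}"
    define F where "F y = of_bool (u y {1..p}) * \<Phi> (c y ?B)" for y
    have F: "F \<in> borel_measurable (PiM {1..p + i} (\<lambda>_. D))" unfolding F_def
      by (intro borel_measurable_times_ennreal meas_u meas_c) auto
    have mc: "(\<lambda>z. \<Phi> (c z A)) \<in> borel_measurable (PiM A (\<lambda>_. D))" if "finite A" for A
      using that by (intro meas_c) auto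
    have "(\<integral>\<^sup>+y. of_bool (u y {1..p}) * \<Phi> (c y ?B) \<partial>Q) = (\<integral>\<^sup>+y. F (restrict y {1..p + i}) \<partial>Q)"
      unfolding F_def
      by (intro nn_integral_cong arg_cong2[of _ _ _ _ "(*)"] arg_cong[of _ _ of_bool] arg_cong[of _ _ \<Phi>]
          equivariant_cong[OF u(1)] equivariant_cong[OF c(1)]) auto
    also have "\<dots> = (\<integral>\<^sup>+x. \<integral>\<^sup>+z. F (merge {1..p} ?B (x, z)) \<partial>PiM ?B (\<lambda>_. D) \<partial>PiM {1..p} (\<lambda>_. D))"
      by (rule nn_integral_split_block[OF F])
    also have "(\<lambda>x z. F (merge {1..p} ?B (x, z))) = (\<lambda>x z. of_bool (u x {1..p}) * \<Phi> (c z ?B))"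
      unfolding F_def
      by (intro ext arg_cong2[of _ _ _ _ "(*)"] arg_cong[of _ _ of_bool] arg_cong[of _ _ \<Phi>]
          equivariant_cong[OF u(1)] equivariant_cong[OF c(1)]) (auto simp: merge_def)
    also have "(\<integral>\<^sup>+x. \<integral>\<^sup>+z. of_bool (u x {1..p}) * \<Phi> (c z ?B) \<partial>PiM ?B (\<lambda>_. D) \<partial>PiM {1..p} (\<lambda>_. D))
      = (\<integral>\<^sup>+x. of_bool (u x {1..p}) \<partial>PiM {1..p} (\<lambda>_. D)) * (\<integral>\<^sup>+z. \<Phi> (c z ?B) \<partial>PiM ?B (\<lambda>_. D))"
      by (subst nn_integral_cmult[OF mc]) (auto intro!: nn_integral_multc meas_u)
    also have "(\<integral>\<^sup>+z. \<Phi> (c z ?B) \<partial>PiM ?B (\<lambda>_. D)) = (\<integral>\<^sup>+y. \<Phi> (c y {1..i}) \<partial>Q)"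
    proof -
      define \<pi> where "\<pi> j = j - p" for j :: nat
      have inj: "inj_on \<pi> ?B" by (auto simp: inj_on_def \<pi>_def)
      have im: "\<pi> ` ?B = {1..i}"
      proof (intro equalityI subsetI)
        fix j assume "j \<in> {1..i}"
        then have "\<pi> (j + p) = j" "j + p \<in> ?B" by (auto simp: \<pi>_def)
        then show "j \<in> \<pi> ` ?B" by (metis imageI)
      qed (auto simp: \<pi>_def)
      have "(\<integral>\<^sup>+y. \<Phi> (c (\<lambda>j\<in>?B. y (\<pi> j)) ?B) \<partial>Q) = (\<integral>\<^sup>+z. \<Phi> (c z ?B) \<partial>PiM ?B (\<lambda>_. D))"
        using inj im by (intro nn_integral_Q_reindex mc) auto
      then show ?thesis unfolding equivariantD[OF c(1) inj] im by simp
    qed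
    finally show ?thesis unfolding nn_integral_u_Q .
  qed
  have m1: "(\<lambda>y. of_bool (u y {1..p}) * \<Phi> (c y {p + 1..p + i})) \<in> borel_measurable Q" for i
    unfolding Q_def by (intro borel_measurable_times_ennreal meas_u meas_c) auto
  have m2: "(\<lambda>y. \<Phi> (c y {1..i})) \<in> borel_measurable Q" for i
    unfolding Q_def by (intro meas_c) auto
  show ?thesis
    unfolding nn_integral_\<Omega>[OF m1] nn_integral_\<Omega>[OF m2] *
    by (simp add: ennreal_suminf_cmult[symmetric] ac_simps)
qed

text \<open>
  Given the first planted point the factors are independent with mean at most \<open>m\<close>, and the Poisson
  generating function at \<open>m\<close> is \<open>exp (n (m - 1))\<close>.
\<close>

theorem old_points_multiplicative:
  assumes p: "1 \<le> p" and g: "case_prod g \<in> borel_measurable (D \<Otimes>\<^sub>M D)"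
    and m: "\<And>x. x \<in> space D \<Longrightarrow> (\<integral>\<^sup>+z. g x z \<partial>D) \<le> ennreal m" "0 \<le> m"
  shows "(\<integral>\<^sup>+(i, y). of_bool (u y {1..p}) * (\<Prod>j\<in>{p + 1..p + i}. g (y 1) (y j)) \<partial>\<Omega>)
    \<le> (\<integral>\<^sup>+y. of_bool (u y {1..p}) \<partial>Q) * ennreal (exp (n * (m - 1)))"
proof -
  let ?w = "\<lambda>i. ennreal (n ^ i / fact i * exp (- n))"
  let ?U = "\<integral>\<^sup>+y. of_bool (u y {1..p}) \<partial>Q"
  have mg: "(\<lambda>y. g (y 1) (y j)) \<in> borel_measurable (PiM K (\<lambda>_. D))" if "1 \<in> K" "j \<in> K" for j K
    using measurable_compose[OF measurable_Pair[OF measurable_component_singleton[OF that(1)]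
        measurable_component_singleton[OF that(2)]] g] by simp
  have mF: "(\<lambda>y. of_bool (u y {1..p}) * (\<Prod>j\<in>{p + 1..p + i}. g (y 1) (y j))) \<in> borel_measurable (PiM K (\<lambda>_. D))"
    if "{1..p + i} \<subseteq> K" for i K
    using that p by (intro borel_measurable_times_ennreal meas_u borel_measurable_prod_ennreal mg) auto
  have *: "(\<integral>\<^sup>+y. of_bool (u y {1..p}) * (\<Prod>j\<in>{p + 1..p + i}. g (y 1) (y j)) \<partial>Q) \<le> ?U * ennreal m ^ i" for i
  proof -
    let ?B = "{p + 1..p + i}"
    define F where "F y = of_bool (u y {1..p}) * (\<Prod>j\<in>?B. g (y 1) (y j))" for y
    have "(\<integral>\<^sup>+y. of_bool (u y {1..p}) * (\<Prod>j\<in>?B. g (y 1) (y j)) \<partial>Q) = (\<integral>\<^sup>+y. F (restrict y {1..p + i}) \<partial>Q)"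
      unfolding F_def using p
      by (intro nn_integral_cong arg_cong2[of _ _ _ _ "(*)"] arg_cong[of _ _ of_bool]
          equivariant_cong[OF u(1)] prod.cong) auto
    also have "\<dots> = (\<integral>\<^sup>+x. \<integral>\<^sup>+z. F (merge {1..p} ?B (x, z)) \<partial>PiM ?B (\<lambda>_. D) \<partial>PiM {1..p} (\<lambda>_. D))"
      by (rule nn_integral_split_block) (unfold F_def, intro mF, auto)
    also have "(\<lambda>x z. F (merge {1..p} ?B (x, z))) = (\<lambda>x z. of_bool (u x {1..p}) * (\<Prod>j\<in>?B. g (x 1) (z j)))"
      unfolding F_def using p
      by (intro ext arg_cong2[of _ _ _ _ "(*)"] arg_cong[of _ _ of_bool]
          equivariant_cong[OF u(1)] prod.cong) (auto simp: merge_def)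
    also have "(\<integral>\<^sup>+x. \<integral>\<^sup>+z. of_bool (u x {1..p}) * (\<Prod>j\<in>?B. g (x 1) (z j)) \<partial>PiM ?B (\<lambda>_. D) \<partial>PiM {1..p} (\<lambda>_. D))
      \<le> (\<integral>\<^sup>+x. of_bool (u x {1..p}) * ennreal m ^ i \<partial>PiM {1..p} (\<lambda>_. D))"
    proof (rule nn_integral_mono)
      fix x assume x: "x \<in> space (PiM {1..p} (\<lambda>_. D))"
      then have x1: "x 1 \<in> space D" using p by (auto simp: space_PiM)
      have mgx: "(\<lambda>z. g (x 1) z) \<in> borel_measurable D"
        using measurable_compose[OF measurable_Pair1'[OF x1] g] by simp
      have mp: "(\<lambda>z. \<Prod>j\<in>?B. g (x 1) (z j)) \<in> borel_measurable (PiM ?B (\<lambda>_. D))"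
      proof (rule borel_measurable_prod_ennreal)
        fix j assume "j \<in> ?B"
        from measurable_compose[OF measurable_component_singleton[OF this, of "\<lambda>_. D"] mgx]
        show "(\<lambda>z. g (x 1) (z j)) \<in> borel_measurable (PiM ?B (\<lambda>_. D))" .
      qed
      have "(\<integral>\<^sup>+z. (\<Prod>j\<in>?B. g (x 1) (z j)) \<partial>PiM ?B (\<lambda>_. D)) = (\<Prod>j\<in>?B. \<integral>\<^sup>+z. g (x 1) z \<partial>D)"
        by (rule S.product_nn_integral_prod[OF finite_atLeastAtMost mgx])
      also have "\<dots> \<le> (\<Prod>j\<in>?B. ennreal m)" by (rule prod_mono_ennreal) (rule m(1)[OF x1])
      also have "\<dots> = ennreal m ^ i" by simp
      finally show "(\<integral>\<^sup>+z. of_bool (u x {1..p}) * (\<Prod>j\<in>?B. g (x 1) (z j)) \<partial>PiM ?B (\<lambda>_. D))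
          \<le> of_bool (u x {1..p}) * ennreal m ^ i"
        by (subst nn_integral_cmult[OF mp]) (rule mult_left_mono, auto)
    qed
    also have "\<dots> = ?U * ennreal m ^ i"
      unfolding nn_integral_u_Q by (rule nn_integral_multc) (auto intro: meas_u)
    finally show ?thesis .
  qed
  have "(\<integral>\<^sup>+(i, y). of_bool (u y {1..p}) * (\<Prod>j\<in>{p + 1..p + i}. g (y 1) (y j)) \<partial>\<Omega>)
      = (\<Sum>i. ?w i * (\<integral>\<^sup>+y. of_bool (u y {1..p}) * (\<Prod>j\<in>{p + 1..p + i}. g (y 1) (y j)) \<partial>Q))"
    by (rule nn_integral_\<Omega>) (unfold Q_def, intro mF, auto)
  also have "\<dots> \<le> (\<Sum>i. ?w i * (?U * ennreal m ^ i))"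
    by (intro suminf_le mult_left_mono * summableI) auto
  also have "\<dots> = ?U * (\<Sum>i. ?w i * ennreal m ^ i)"
    by (simp add: ennreal_suminf_cmult[symmetric] ac_simps)
  also have "(\<Sum>i. ?w i * ennreal m ^ i) = (\<Sum>i. ennreal ((n * m) ^ i / fact i * exp (- n)))"
    using n_pos m(2) by (intro arg_cong[of _ _ suminf] ext)
      (simp add: ennreal_power ennreal_mult[symmetric] power_mult_distrib field_simps)
  also have "\<dots> = ennreal (exp (n * m) * exp (- n))"
  proof (rule suminf_ennreal_eq)
    show "(\<lambda>i. (n * m) ^ i / fact i * exp (- n)) sums (exp (n * m) * exp (- n))"
      using exp_converges[of "n * m"] by (intro sums_mult2) (simp add: field_simps)
  qed (use n_pos m in auto)
  also have "exp (n * m) * exp (- n) = exp (n * (m - 1))" by (simp add: mult_exp_exp algebra_simps)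
  finally show ?thesis .
qed

end

section \<open>Expectations over a Poisson sample\<close>

context poisson_sample
begin

definition expect :: "(nat \<Rightarrow> (nat \<Rightarrow> 'a) \<Rightarrow> real) \<Rightarrow> real" where
  "expect f = (\<integral>\<omega>. case_prod f \<omega> \<partial>\<Omega>)"

text \<open>
  A class of integrable functions: the Poisson law integrates \<open>4 ^ i\<close>. The base \<open>4\<close> accommodates the
  product of two numbers of subsets, each at most \<open>2 ^ i\<close>.
\<close>

definition admissible :: "(nat \<Rightarrow> (nat \<Rightarrow> 'a) \<Rightarrow> real) \<Rightarrow> bool" where
  "admissible f \<longleftrightarrow> (\<forall>i. f i \<in> borel_measurable Q) \<and> (\<exists>C. \<forall>i y. \<bar>f i y\<bar> \<le> C * 4 ^ i)"

lemma admissibleI: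
  assumes "\<And>i. f i \<in> borel_measurable Q" "\<And>i y. \<bar>f i y\<bar> \<le> C * 4 ^ i"
  shows "admissible f"
  using assms unfolding admissible_def by blast

lemma integrable_admissible:
  assumes "admissible f" shows "integrable \<Omega> (case_prod f)"
proof -
  from assms obtain C where m: "\<And>i. f i \<in> borel_measurable Q" and C: "\<And>i y. \<bar>f i y\<bar> \<le> C * 4 ^ i"
    unfolding admissible_def by blast
  have C0: "0 \<le> C" using order_trans[OF abs_ge_zero C[of 0 undefined]] by simp
  have "(\<integral>\<^sup>+\<omega>. (case \<omega> of (i, y) \<Rightarrow> ennreal (norm (f i y))) \<partial>\<Omega>)
    = (\<Sum>i. ennreal (n ^ i / fact i * exp (- n)) * (\<integral>\<^sup>+y. ennreal (norm (f i y)) \<partial>Q))"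
    using m by (intro nn_integral_\<Omega>) auto
  also have "\<dots> \<le> (\<Sum>i. ennreal (n ^ i / fact i * exp (- n)) * (\<integral>\<^sup>+y. ennreal (C * 4 ^ i) \<partial>Q))"
    using C by (intro suminf_le mult_left_mono nn_integral_mono summableI ennreal_leI) auto
  also have "\<dots> = (\<Sum>i. ennreal (C * exp (- n) * ((n * 4) ^ i / fact i)))"
    using n_pos C0 by (simp add: Q.emeasure_space_1 ennreal_mult[symmetric] power_mult_distrib field_simps)
  also have "\<dots> = ennreal (C * exp (- n) * exp (n * 4))"
  proof (rule suminf_ennreal_eq)
    show "(\<lambda>i. C * exp (- n) * ((n * 4) ^ i / fact i)) sums (C * exp (- n) * exp (n * 4))"
      using exp_converges[of "n * 4"] by (intro sums_mult) (simp add: field_simps)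
  qed (use n_pos C0 in auto)
  also have "\<dots> < \<infinity>" by simp
  finally have "(\<integral>\<^sup>+\<omega>. ennreal (norm (case_prod f \<omega>)) \<partial>\<Omega>) < \<infinity>"
    by (simp add: case_prod_unfold)
  then show ?thesis using measurable_\<Omega>[OF m] by (intro integrableI_bounded) auto
qed

lemma admissible_add: "admissible f \<Longrightarrow> admissible g \<Longrightarrow> admissible (\<lambda>i y. f i y + g i y)"
proof -
  assume "admissible f" "admissible g"
  then obtain C C' where m: "\<And>i. f i \<in> borel_measurable Q" "\<And>i. g i \<in> borel_measurable Q"
    and C: "\<And>i y. \<bar>f i y\<bar> \<le> C * 4 ^ i" "\<And>i y. \<bar>g i y\<bar> \<le> C' * 4 ^ i"
    unfolding admissible_def by blast
  show ?thesis
  proof (rule admissibleI[where C = "C + C'"])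
    show "\<bar>f i y + g i y\<bar> \<le> (C + C') * 4 ^ i" for i y
      using add_mono[OF C, of i y i y] abs_triangle_ineq[of "f i y" "g i y"] by (simp add: distrib_right)
  qed (use m in measurable)
qed

lemma admissible_cmult: "admissible f \<Longrightarrow> admissible (\<lambda>i y. a * f i y)"
proof -
  assume "admissible f"
  then obtain C where m: "\<And>i. f i \<in> borel_measurable Q" and C: "\<And>i y. \<bar>f i y\<bar> \<le> C * 4 ^ i"
    unfolding admissible_def by blast
  show ?thesis
  proof (rule admissibleI[where C = "\<bar>a\<bar> * C"])
    show "\<bar>a * f i y\<bar> \<le> \<bar>a\<bar> * C * 4 ^ i" for i y
      using mult_left_mono[OF C, of "\<bar>a\<bar>" i y] by (simp add: abs_mult mult.assoc)
  qed (use m in measurable)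
qed

lemma admissible_diff: "admissible f \<Longrightarrow> admissible g \<Longrightarrow> admissible (\<lambda>i y. f i y - g i y)"
  using admissible_add[of f "\<lambda>i y. - 1 * g i y"] admissible_cmult[of g "- 1"] by simp

lemma admissible_bounded:
  assumes "\<And>i. f i \<in> borel_measurable Q" "\<And>i y. \<bar>f i y\<bar> \<le> C" shows "admissible f"
proof (rule admissibleI[where C = C])
  have C0: "0 \<le> C" using order_trans[OF abs_ge_zero assms(2)[of 0 undefined]] by simp
  show "\<bar>f i y\<bar> \<le> C * 4 ^ i" for i y
    using assms(2)[of i y] mult_left_mono[OF one_le_power[of 4 i] C0] by simp
qed (use assms in auto)

lemma expect_add: "admissible f \<Longrightarrow> admissible g \<Longrightarrow> expect (\<lambda>i y. f i y + g i y) = expect f + expect g"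
  using Bochner_Integration.integral_add[OF integrable_admissible integrable_admissible, of f g]
  by (simp add: expect_def case_prod_unfold)

lemma expect_diff: "admissible f \<Longrightarrow> admissible g \<Longrightarrow> expect (\<lambda>i y. f i y - g i y) = expect f - expect g"
  using Bochner_Integration.integral_diff[OF integrable_admissible integrable_admissible, of f g]
  by (simp add: expect_def case_prod_unfold)

lemma expect_cmult: "expect (\<lambda>i y. a * f i y) = a * expect f"
  by (simp add: expect_def case_prod_unfold)

lemma expect_mono:
  assumes "admissible f" "admissible g" "\<And>i y. f i y \<le> g i y"
  shows "expect f \<le> expect g"
  unfolding expect_def using assms by (intro integral_mono integrable_admissible) auto

lemma expect_abs_le:
  assumes "admissible f" "admissible g" "\<And>i y. \<bar>f i y\<bar> \<le> g i y"
  shows "\<bar>expect f\<bar> \<le> expect g"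
proof -
  have "expect f \<le> expect g" using assms by (intro expect_mono) (auto intro: order_trans[OF abs_ge_self])
  moreover have "expect (\<lambda>i y. - 1 * f i y) \<le> expect g"
    using assms by (intro expect_mono admissible_cmult) (auto intro: order_trans[OF abs_ge_minus_self])
  ultimately show ?thesis unfolding expect_cmult by simp
qed

lemma expect_const: "expect (\<lambda>i y. a) = a"
  by (simp add: expect_def case_prod_unfold P.prob_space)

lemma expect_eq_nn_integral:
  assumes "admissible f"
  shows "expect f = enn2real (\<integral>\<^sup>+(i, y). ennreal (f i y) \<partial>\<Omega>) - enn2real (\<integral>\<^sup>+(i, y). ennreal (- f i y) \<partial>\<Omega>)"
  unfolding expect_def real_lebesgue_integral_def[OF integrable_admissible[OF assms]]
  by (simp add: case_prod_unfold)

lemma expect_nonneg_eq_nn_integral: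
  assumes "admissible f" "\<And>i y. 0 \<le> f i y"
  shows "ennreal (expect f) = (\<integral>\<^sup>+(i, y). ennreal (f i y) \<partial>\<Omega>)"
  using nn_integral_eq_integral[OF integrable_admissible[OF assms(1)]] assms(2)
  by (simp add: expect_def case_prod_unfold)

end

context poisson_sample_functionals
begin

definition U :: "(nat \<Rightarrow> 'a) \<Rightarrow> real" where "U y = of_bool (u y {1..p})"

definition \<kappa> :: real where "\<kappa> = n ^ p / fact p"

definition occurrences :: "nat \<Rightarrow> (nat \<Rightarrow> 'a) \<Rightarrow> real" where
  "occurrences i y = real (card {I. I \<subseteq> {1..i} \<and> u y I})"

lemma U_range: "0 \<le> U y" "U y \<le> 1" "\<bar>U y\<bar> = U y" by (auto simp: U_def)

lemma kappa_nonneg: "0 \<le> \<kappa>" using n_pos by (simp add: \<kappa>_def)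

lemma U_meas: "U \<in> borel_measurable Q"
  unfolding U_def[abs_def] Q_def by (rule meas_u[where F = of_bool]) auto

lemma c_meas: "finite A \<Longrightarrow> A \<subseteq> {1..} \<Longrightarrow> (\<lambda>y. F (c y A)) \<in> borel_measurable Q" for F :: "'c \<Rightarrow> real"
  unfolding Q_def using measurable_compose[OF local_measurable_PiM[OF c], of A "{1..}" F borel] by simp

lemma occurrences_meas: "occurrences i \<in> borel_measurable Q"
proof -
  have "(\<lambda>y. {I \<in> Pow {1..i}. u y I}) \<in> measurable Q (count_space UNIV)"
  proof (rule measurable_finite_selection)
    fix I assume "I \<in> Pow {1..i}"
    then have "(\<lambda>y. u y I) \<in> measurable Q (count_space UNIV)"
      unfolding Q_def by (intro local_measurable_PiM[OF u]) (auto intro: finite_subset)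
    from measurable_sets[OF this, of "{True}"]
    show "{x \<in> space Q. u x I} \<in> sets Q" by (simp add: vimage_def Int_def conj_commute)
  qed simp
  from measurable_compose[OF this, of "\<lambda>S. real (card S)" borel]
  show ?thesis unfolding occurrences_def[abs_def] by (simp add: Pow_def)
qed

lemma occurrences_le: "0 \<le> occurrences i y" "occurrences i y \<le> 2 ^ i"
proof -
  have "card {I. I \<subseteq> {1..i} \<and> u y I} \<le> card (Pow {1..i})" by (intro card_mono) auto
  then have "card {I. I \<subseteq> {1..i} \<and> u y I} \<le> 2 ^ i" by (simp add: card_Pow)
  then show "occurrences i y \<le> 2 ^ i" unfolding occurrences_def
    by (metis of_nat_le_iff of_nat_numeral of_nat_power)
qed (simp add: occurrences_def)

lemma two_le_four_pow: "(2::real) ^ i \<le> 4 ^ i" by (rule power_mono) auto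

lemma admissible_U_times:
  assumes "\<And>i. f i \<in> borel_measurable Q" "\<And>i y. U y = 1 \<Longrightarrow> \<bar>f i y\<bar> \<le> C * 4 ^ i" "0 \<le> C"
  shows "admissible (\<lambda>i y. U y * f i y)"
proof (rule admissibleI[where C = C])
  show "(\<lambda>y. U y * f i y) \<in> borel_measurable Q" for i
    using U_meas assms(1)[of i] by measurable
  show "\<bar>U y * f i y\<bar> \<le> C * 4 ^ i" for i y
    using assms(2)[of y i] assms(3) by (cases "u y {1..p}") (auto simp: U_def)
qed

lemma nn_integral_U: "(\<integral>\<^sup>+y. of_bool (u y {1..p}) \<partial>Q) = ennreal (expect (\<lambda>i y. U y))"
proof -
  have "admissible (\<lambda>i y. U y)" using U_meas U_range by (intro admissible_bounded[where C = 1]) auto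
  from expect_nonneg_eq_nn_integral[OF this]
  have "ennreal (expect (\<lambda>i y. U y)) = (\<integral>\<^sup>+(i, y). ennreal (U y) \<partial>\<Omega>)" using U_range by simp
  also have "\<dots> = (\<integral>\<^sup>+y. ennreal (U y) \<partial>Q)"
    using nn_integral_\<Omega>[of "\<lambda>i y. ennreal (U y)"] U_meas nn_integral_poisson[OF n_pos, of "\<lambda>_. \<integral>\<^sup>+y. ennreal (U y) \<partial>Q"]
    by (simp add: measure_pmf.emeasure_space_1[simplified])
  also have "\<dots> = (\<integral>\<^sup>+y. of_bool (u y {1..p}) \<partial>Q)"
    by (intro nn_integral_cong) (simp add: U_def)
  finally show ?thesis ..
qed

lemma expect_U:
  "expect (\<lambda>i y. U y) = measure (PiM {1..p} (\<lambda>_. D)) {x \<in> space (PiM {1..p} (\<lambda>_. D)). u x {1..p}}"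
proof -
  have "(\<lambda>x. u x {1..p}) \<in> measurable (PiM {1..p} (\<lambda>_. D)) (count_space UNIV)"
    by (rule local_measurable_PiM[OF u]) auto
  then have s: "{x \<in> space (PiM {1..p} (\<lambda>_. D)). u x {1..p}} \<in> sets (PiM {1..p} (\<lambda>_. D))"
    unfolding pred_def .
  have "0 \<le> expect (\<lambda>i y. U y)" unfolding expect_def using U_range by (intro integral_nonneg_AE) auto
  moreover have "(\<integral>\<^sup>+x. of_bool (u x {1..p}) \<partial>PiM {1..p} (\<lambda>_. D))
      = emeasure (PiM {1..p} (\<lambda>_. D)) {x \<in> space (PiM {1..p} (\<lambda>_. D)). u x {1..p}}"
    unfolding nn_integral_indicator[OF s, symmetric] by (intro nn_integral_cong) (auto simp: indicator_def)
  ultimately show ?thesis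
    using nn_integral_U unfolding nn_integral_u_Q measure_def by simp
qed

context
  fixes \<Phi> :: "'c \<Rightarrow> real" and C :: real
  assumes growth: "\<And>y A. finite A \<Longrightarrow> \<bar>\<Phi> (c y A)\<bar> \<le> C * 2 ^ card A"
begin

lemma growth_nonneg: "0 \<le> C"
  using order_trans[OF abs_ge_zero growth[of "{}" undefined]] by simp

lemma admissible_all: "admissible (\<lambda>i y. \<Phi> (c y {1..i}))"
proof (rule admissibleI[where C = C])
  show "\<bar>\<Phi> (c y {1..i})\<bar> \<le> C * 4 ^ i" for i y
    using growth[of "{1..i}" y] mult_left_mono[OF two_le_four_pow[of i] growth_nonneg] by simp
qed (auto intro: c_meas)

lemma admissible_occ: "admissible (\<lambda>i y. occurrences i y * \<Phi> (c y {1..i}))"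
proof (rule admissibleI[where C = C])
  show "\<bar>occurrences i y * \<Phi> (c y {1..i})\<bar> \<le> C * 4 ^ i" for i y
  proof -
    have "\<bar>occurrences i y * \<Phi> (c y {1..i})\<bar> \<le> 2 ^ i * (C * 2 ^ i)"
      unfolding abs_mult using growth[of "{1..i}" y] occurrences_le[of i y] by (intro mult_mono) auto
    also have "\<dots> = C * 4 ^ i" by (simp add: power_mult_distrib[symmetric])
    finally show ?thesis .
  qed
  show "(\<lambda>y. occurrences i y * \<Phi> (c y {1..i})) \<in> borel_measurable Q" for i
    using occurrences_meas c_meas[of "{1..i}" \<Phi>] by (intro borel_measurable_times) auto
qed

lemma admissible_new: "admissible (\<lambda>i y. U y * \<Phi> (c y {1..p + i}))"
proof (rule admissible_U_times[where C = "C * 2 ^ p"])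
  show "\<bar>\<Phi> (c y {1..p + i})\<bar> \<le> C * 2 ^ p * 4 ^ i" for i y
    using growth[of "{1..p + i}" y] mult_left_mono[OF two_le_four_pow[of i], of "C * 2 ^ p"] growth_nonneg
    by (simp add: power_add mult.assoc)
qed (use growth_nonneg in \<open>auto intro: c_meas\<close>)

lemma admissible_old: "admissible (\<lambda>i y. U y * \<Phi> (c y {p + 1..p + i}))"
proof (rule admissible_U_times[where C = C])
  show "\<bar>\<Phi> (c y {p + 1..p + i})\<bar> \<le> C * 4 ^ i" for i y
    using growth[of "{p + 1..p + i}" y] mult_left_mono[OF two_le_four_pow[of i] growth_nonneg] by simp
qed (use growth_nonneg in \<open>auto intro: c_meas\<close>)

text \<open>
  The formula for nonnegative functions, applied to the positive and the negative part.
\<close>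

theorem expect_mecke:
  "expect (\<lambda>i y. occurrences i y * \<Phi> (c y {1..i})) = \<kappa> * expect (\<lambda>i y. U y * \<Phi> (c y {1..p + i}))"
proof -
  have 1: "ennreal (occurrences i y * a) = of_nat (card {I. I \<subseteq> {1..i} \<and> u y I}) * ennreal a" for i y a
    using occurrences_le(1)[of i y] by (simp add: occurrences_def ennreal_mult' ennreal_of_nat_eq_real_of_nat)
  have 2: "ennreal (U y * a) = of_bool (u y {1..p}) * ennreal a" for y a
    by (simp add: U_def)
  have k: "enn2real (ennreal (n ^ p / fact p) * a) = \<kappa> * enn2real a" for a
    using kappa_nonneg by (simp add: \<kappa>_def enn2real_mult)
  show ?thesis
    unfolding expect_eq_nn_integral[OF admissible_occ] expect_eq_nn_integral[OF admissible_new]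
      mult_minus_right[symmetric] 1 2 mecke[of "\<lambda>v. ennreal (\<Phi> v)"] mecke[of "\<lambda>v. ennreal (- \<Phi> v)"] k
    by (simp add: right_diff_distrib)
qed

theorem expect_old_independent:
  "expect (\<lambda>i y. U y * \<Phi> (c y {p + 1..p + i})) = expect (\<lambda>i y. U y) * expect (\<lambda>i y. \<Phi> (c y {1..i}))"
proof -
  have 2: "ennreal (U y * a) = of_bool (u y {1..p}) * ennreal a" for y a
    by (simp add: U_def)
  note U = nn_integral_U
  have nn: "0 \<le> expect (\<lambda>i y. U y)"
    unfolding expect_def using U_range by (intro integral_nonneg_AE) auto
  then have k: "enn2real (ennreal (expect (\<lambda>i y. U y)) * a) = expect (\<lambda>i y. U y) * enn2real a" for a
    by (simp add: enn2real_mult)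
  show ?thesis
    unfolding expect_eq_nn_integral[OF admissible_old] expect_eq_nn_integral[OF admissible_all]
      mult_minus_right[symmetric] 2 old_points_independent[of "\<lambda>v. ennreal (\<Phi> v)"]
      old_points_independent[of "\<lambda>v. ennreal (- \<Phi> v)"] U k
    by (simp add: right_diff_distrib)
qed

end

end

section \<open>Copies created by planting a graph\<close>

lemma finite_copies: "finite A \<Longrightarrow> finite (copies r \<Gamma> y A)"
  by (rule finite_subset[of _ "Pow A"]) (auto simp: copies_def)

lemma card_copies_le: "finite A \<Longrightarrow> card (copies r \<Gamma> y A) \<le> 2 ^ card A"
  using card_mono[of "Pow A" "copies r \<Gamma> y A"] by (auto simp: copies_def card_Pow)

lemma card_copies_reindex:
  assumes "inj_on \<pi> A"
  shows "card (copies r \<Gamma> (\<lambda>i\<in>A. y (\<pi> i)) A) = card (copies r \<Gamma> y (\<pi> ` A))"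
proof (rule bij_betw_same_card[of "image \<pi>"], unfold bij_betw_def, intro conjI)
  have eq: "forms_copy r \<Gamma> (\<lambda>i\<in>A. y (\<pi> i)) I \<longleftrightarrow> forms_copy r \<Gamma> y (\<pi> ` I)" if "I \<subseteq> A" for I
  proof -
    have "forms_copy r \<Gamma> (\<lambda>i\<in>A. y (\<pi> i)) I \<longleftrightarrow> forms_copy r \<Gamma> (\<lambda>i. y (\<pi> i)) I"
      using that by (intro forms_copy_cong) auto
    then show ?thesis using forms_copy_reindex[OF inj_on_subset[OF assms that]] by simp
  qed
  show "inj_on ((`) \<pi>) (copies r \<Gamma> (\<lambda>i\<in>A. y (\<pi> i)) A)"
    by (rule inj_on_subset[OF inj_on_image_Pow[OF assms]]) (auto simp: copies_def)
  show "(`) \<pi> ` copies r \<Gamma> (\<lambda>i\<in>A. y (\<pi> i)) A = copies r \<Gamma> y (\<pi> ` A)"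
  proof (intro equalityI subsetI)
    fix I' assume "I' \<in> copies r \<Gamma> y (\<pi> ` A)"
    then obtain I where "I \<subseteq> A" "I' = \<pi> ` I" "forms_copy r \<Gamma> y I'"
      unfolding copies_def by (auto simp: subset_image_iff)
    then show "I' \<in> (`) \<pi> ` copies r \<Gamma> (\<lambda>i\<in>A. y (\<pi> i)) A" using eq by (auto simp: copies_def)
  qed (use eq in \<open>auto simp: copies_def\<close>)
qed

lemma copies_self:
  assumes "finite J" "card J = card (pverts \<Gamma>)"
  shows "copies r \<Gamma> y J = (if forms_copy r \<Gamma> y J then {J} else {})"
proof -
  have "I = J" if "I \<subseteq> J" "forms_copy r \<Gamma> y I" for I
    using card_subset_eq[OF assms(1) that(1)] forms_copy_card[OF that(2)] assms(2) by simp
  then show ?thesis by (auto simp: copies_def)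
qed

definition mixed_copies ::
  "real \<Rightarrow> 'v pair_pre_digraph \<Rightarrow> (nat \<Rightarrow> 'a::real_normed_vector) \<Rightarrow> nat set \<Rightarrow> nat set \<Rightarrow> nat set set" where
  "mixed_copies r \<Gamma> y J A = {I \<in> copies r \<Gamma> y (J \<union> A). I \<inter> J \<noteq> {} \<and> I \<inter> A \<noteq> {}}"

lemma card_copies_Un:
  assumes "finite J" "finite A" "J \<inter> A = {}" and ne: "card (pverts \<Gamma>) \<noteq> 0"
  shows "card (copies r \<Gamma> y (J \<union> A))
    = card (copies r \<Gamma> y A) + card (copies r \<Gamma> y J) + card (mixed_copies r \<Gamma> y J A)"
proof -
  have ne': "I \<noteq> {}" if "forms_copy r \<Gamma> y I" for I using forms_copy_card[OF that] ne by auto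
  let ?A = "copies r \<Gamma> y A" and ?J = "copies r \<Gamma> y J" and ?M = "mixed_copies r \<Gamma> y J A"
  have inA: "I \<subseteq> A \<and> I \<noteq> {}" if "I \<in> ?A" for I using that ne' by (auto simp: copies_def)
  have inJ: "I \<subseteq> J \<and> I \<noteq> {}" if "I \<in> ?J" for I using that ne' by (auto simp: copies_def)
  have inM: "I \<inter> J \<noteq> {} \<and> I \<inter> A \<noteq> {}" if "I \<in> ?M" for I using that by (auto simp: mixed_copies_def)
  have disj: "?A \<inter> (?J \<union> ?M) = {}" "?J \<inter> ?M = {}" using inA inJ inM assms(3) by blast+
  have fM: "finite ?M"
    by (rule finite_subset[of _ "copies r \<Gamma> y (J \<union> A)"])
      (use assms in \<open>auto simp: mixed_copies_def intro: finite_copies\<close>)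
  have "copies r \<Gamma> y (J \<union> A) = ?A \<union> (?J \<union> ?M)"
    unfolding copies_def mixed_copies_def by auto
  also have "card \<dots> = card ?A + card (?J \<union> ?M)"
    by (intro card_Un_disjoint disj finite_UnI finite_copies assms fM)
  also have "card (?J \<union> ?M) = card ?J + card ?M"
    by (intro card_Un_disjoint disj finite_copies assms fM)
  finally show ?thesis by simp
qed

text \<open>
  A mixed copy of \<open>\<Gamma>\<close> meets the planted copy \<open>J\<close> of \<open>\<Gamma>'\<close>, and both have diameter at most \<open>k r\<close>. So
  the mixed copy is the union of a subset of \<open>J\<close> and of a nonempty set of points of \<open>A\<close> at distance
  at most \<open>2 k r\<close> from any given point of \<open>J\<close>.
\<close>

lemma card_mixed_copies_le:
  assumes G: "pair_graph \<Gamma>" "Digraph_Component.connected (with_proj \<Gamma>)" "card (pverts \<Gamma>) \<le> k"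
    and G': "pair_graph \<Gamma>'" "Digraph_Component.connected (with_proj \<Gamma>')" "card (pverts \<Gamma>') \<le> k"
    and J: "forms_copy r \<Gamma>' y J" "x \<in> J" and fin: "finite J" "finite A" and r: "0 \<le> r"
  shows "card (mixed_copies r \<Gamma> y J A) \<le> 2 ^ card J * (2 ^ card {i \<in> A. norm (y i - y x) \<le> 2 * real k * r} - 1)"
proof -
  let ?N = "{i \<in> A. norm (y i - y x) \<le> 2 * real k * r}"
  have "mixed_copies r \<Gamma> y J A \<subseteq> (\<lambda>(S, T). S \<union> T) ` (Pow J \<times> (Pow ?N - {{}}))"
  proof
    fix I assume I: "I \<in> mixed_copies r \<Gamma> y J A"
    then obtain i where i: "i \<in> I" "i \<in> J" unfolding mixed_copies_def by blast
    have fI: "forms_copy r \<Gamma> y I" using I by (auto simp: mixed_copies_def copies_def)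
    have "norm (y a - y x) \<le> 2 * real k * r" if "a \<in> I" for a
    proof -
      have "norm (y a - y x) \<le> norm (y a - y i) + norm (y i - y x)"
        using dist_triangle[of "y a" "y x" "y i"] by (simp add: dist_norm)
      also have "norm (y a - y i) \<le> real (card (pverts \<Gamma>)) * r"
        by (rule forms_copy_dist[OF G(1,2) fI that i(1) r])
      also have "norm (y i - y x) \<le> real (card (pverts \<Gamma>')) * r"
        by (rule forms_copy_dist[OF G'(1,2) J(1) i(2) J(2) r])
      also have "real (card (pverts \<Gamma>)) * r + real (card (pverts \<Gamma>')) * r \<le> real k * r + real k * r"
        using G(3) G'(3) r by (intro add_mono mult_right_mono) auto
      finally show ?thesis by (simp add: mult.commute)
    qed
    then have "(I \<inter> J, I \<inter> A) \<in> Pow J \<times> (Pow ?N - {{}})" using I by (auto simp: mixed_copies_def)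
    moreover have "I = (\<lambda>(S, T). S \<union> T) (I \<inter> J, I \<inter> A)"
      using I by (auto simp: mixed_copies_def copies_def)
    ultimately show "I \<in> (\<lambda>(S, T). S \<union> T) ` (Pow J \<times> (Pow ?N - {{}}))" by (rule rev_image_eqI)
  qed
  then have "card (mixed_copies r \<Gamma> y J A) \<le> card ((\<lambda>(S, T). S \<union> T) ` (Pow J \<times> (Pow ?N - {{}})))"
    using fin by (intro card_mono) auto
  also have "\<dots> \<le> card (Pow J \<times> (Pow ?N - {{}}))" using fin by (intro card_image_le) auto
  also have "\<dots> = 2 ^ card J * (2 ^ card ?N - 1)" using fin by (simp add: card_cartesian_product card_Pow card_Diff_singleton)
  finally show ?thesis .
qed

section \<open>The neighbourhood of a planted graph\<close>

locale poisson_neighbours = poisson_sample_functionals D n u c p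
  for D :: "'a::euclidean_space measure" and n u and c :: "(nat \<Rightarrow> 'a) \<Rightarrow> nat set \<Rightarrow> 'c" and p +
  fixes s q :: real
  assumes D_borel: "sets D = sets borel" and p_pos: "1 \<le> p"
    and ball_prob: "\<And>x. measure D (cball x s) \<le> q"
begin

definition near :: "nat \<Rightarrow> (nat \<Rightarrow> 'a) \<Rightarrow> nat" where
  "near i y = card {j \<in> {p + 1..p + i}. norm (y j - y 1) \<le> s}"

lemma near_le: "near i y \<le> i"
proof -
  have "near i y \<le> card {p + 1..p + i}" unfolding near_def by (intro card_mono) auto
  then show ?thesis by simp
qed

lemma component_meas:
  assumes "1 \<le> j" shows "(\<lambda>y. y j) \<in> borel_measurable Q"
proof -
  have "(\<lambda>y. y j) \<in> measurable Q D"
    unfolding Q_def using assms by (intro measurable_component_singleton) simp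
  then show ?thesis by (simp only: measurable_cong_sets[OF refl D_borel])
qed

lemma near_meas: "(\<lambda>y. F (near i y)) \<in> borel_measurable Q" for F :: "nat \<Rightarrow> real"
proof -
  have "(\<lambda>y. {j \<in> {p + 1..p + i}. norm (y j - y 1) \<le> s}) \<in> measurable Q (count_space UNIV)"
  proof (rule measurable_finite_selection)
    fix j assume "j \<in> {p + 1..p + i}"
    then have "1 \<le> j" by simp
    from measurable_compose[OF borel_measurable_diff[OF component_meas[OF this] component_meas[OF order_refl]]
        borel_measurable_norm]
    have "(\<lambda>y. norm (y j - y 1)) \<in> borel_measurable Q" .
    then show "{y \<in> space Q. norm (y j - y 1) \<le> s} \<in> sets Q"
      by (rule borel_measurable_le[OF _ borel_measurable_const])
  qed simp
  moreover have "(\<lambda>S :: nat set. F (card S)) \<in> measurable (count_space UNIV) borel"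
    by (simp only: measurable_count_space_eq1) simp
  ultimately show ?thesis unfolding near_def by (rule measurable_compose)
qed

text \<open>
  The mean of a functional of the sample with a planted pattern, integrated over all patterns. Its total
  mass is the expected number \<open>\<mu>\<close> of patterns.
\<close>

definition palm :: "(nat \<Rightarrow> (nat \<Rightarrow> 'a) \<Rightarrow> real) \<Rightarrow> real" where
  "palm f = \<kappa> * expect (\<lambda>i y. U y * f i y)"

definition \<mu> :: real where "\<mu> = expect occurrences"

definition \<delta> :: real where "\<delta> = exp (3 * n * q) - 1"

lemma palm_one: "palm (\<lambda>i y. 1) = \<mu>"
  using expect_mecke[of "\<lambda>_. 1" 1] by (simp add: palm_def \<mu>_def one_le_power)

lemma admissible_U_near: "admissible (\<lambda>i y. U y * 4 ^ near i y)"
proof (rule admissible_U_times[where C = 1])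
  show "\<bar>4 ^ near i y\<bar> \<le> 1 * (4::real) ^ i" for i y using near_le[of i y] by simp
qed (use near_meas[of "\<lambda>k. 4 ^ k"] in auto)

lemma admissible_U: "admissible (\<lambda>i y. U y * a)"
  by (rule admissible_U_times[where C = "\<bar>a\<bar>"]) (use mult_left_mono[OF one_le_power[of 4], of "\<bar>a\<bar>"] in auto)

lemma q_nonneg: "0 \<le> q" using order_trans[OF measure_nonneg ball_prob] .

lemma \<delta>_nonneg: "0 \<le> \<delta>" using q_nonneg n_pos by (simp add: \<delta>_def)

text \<open>
  Each old point contributes a factor \<open>4\<close> if it is near and \<open>1\<close> otherwise, with mean at most
  \<open>1 + 3 q\<close>. The base \<open>4\<close> rather than \<open>2\<close> allows squares of bounds in terms of \<open>2 ^ near i y\<close>.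
\<close>

lemma palm_near: "palm (\<lambda>i y. 4 ^ near i y) \<le> \<mu> * (1 + \<delta>)"
proof -
  define g :: "'a \<Rightarrow> 'a \<Rightarrow> ennreal" where "g x z = (if norm (z - x) \<le> s then 4 else 1)" for x z
  have "case_prod g \<in> borel_measurable (borel \<Otimes>\<^sub>M borel)"
  proof -
    have "{z \<in> space (borel \<Otimes>\<^sub>M borel). norm (snd z - fst z :: 'a) \<le> s} \<in> sets (borel \<Otimes>\<^sub>M borel)"
      by (intro borel_measurable_le borel_measurable_const measurable_compose[OF _ borel_measurable_norm]
          borel_measurable_diff measurable_fst measurable_snd)
    then show ?thesis
      unfolding g_def case_prod_unfold by (intro measurable_If) auto
  qed
  moreover have "measurable (D \<Otimes>\<^sub>M D) borel = (measurable (borel \<Otimes>\<^sub>M borel) borel :: ('a \<times> 'a \<Rightarrow> ennreal) set)"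
    using D_borel by (intro measurable_cong_sets sets_pair_measure_cong) auto
  ultimately have g: "case_prod g \<in> borel_measurable (D \<Otimes>\<^sub>M D)" by simp
  have m: "(\<integral>\<^sup>+z. g x z \<partial>D) \<le> ennreal (1 + 3 * q)" for x
  proof -
    have s: "cball x s \<in> sets D" using D_borel by simp
    have "(\<integral>\<^sup>+z. g x z \<partial>D) = (\<integral>\<^sup>+z. 1 + 3 * indicator (cball x s) z \<partial>D)"
      by (intro nn_integral_cong) (auto simp: g_def indicator_def dist_norm norm_minus_commute)
    also have "\<dots> = 1 + 3 * emeasure D (cball x s)"
      using s by (subst nn_integral_add) (auto simp: nn_integral_cmult emeasure_space_1)
    also have "\<dots> = ennreal (1 + 3 * measure D (cball x s))"
      by (simp add: emeasure_eq_measure ennreal_mult' ennreal_plus)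
    also have "\<dots> \<le> ennreal (1 + 3 * q)" using ball_prob[of x] by (intro ennreal_leI) simp
    finally show ?thesis .
  qed
  have prod: "(\<Prod>j\<in>{p + 1..p + i}. g (y 1) (y j)) = ennreal (4 ^ near i y)" for i y
    unfolding g_def near_def by (simp add: prod.If_cases Int_def ennreal_power[symmetric])
  note UQ = nn_integral_U
  have U0: "0 \<le> expect (\<lambda>i y. U y)" unfolding expect_def using U_range by (intro integral_nonneg_AE) auto
  have "ennreal (expect (\<lambda>i y. U y * 4 ^ near i y)) = (\<integral>\<^sup>+(i, y). ennreal (U y * 4 ^ near i y) \<partial>\<Omega>)"
    using U_range by (intro expect_nonneg_eq_nn_integral admissible_U_near) simp
  also have "\<dots> = (\<integral>\<^sup>+(i, y). of_bool (u y {1..p}) * (\<Prod>j\<in>{p + 1..p + i}. g (y 1) (y j)) \<partial>\<Omega>)"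
    unfolding prod by (intro nn_integral_cong) (auto simp: U_def)
  also have "\<dots> \<le> (\<integral>\<^sup>+y. of_bool (u y {1..p}) \<partial>Q) * ennreal (exp (n * ((1 + 3 * q) - 1)))"
    using q_nonneg by (intro old_points_multiplicative p_pos g m) auto
  also have "\<dots> = ennreal (expect (\<lambda>i y. U y) * exp (3 * n * q))"
    unfolding UQ using U0 by (simp add: ennreal_mult' mult.commute mult.left_commute)
  finally have "expect (\<lambda>i y. U y * 4 ^ near i y) \<le> expect (\<lambda>i y. U y) * exp (3 * n * q)"
    using U0 by (subst (asm) ennreal_le_iff) auto
  from mult_left_mono[OF this kappa_nonneg] show ?thesis
    unfolding palm_one[symmetric] palm_def \<delta>_def by (simp add: mult.assoc)
qed

text \<open>
  All errors are controlled through this bound. Choosing \<open>b = - a\<close> exploits that a function vanishes when no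
  old point is near: the bound becomes \<open>a \<mu> \<delta>\<close> by \<open>palm_near\<close>.
\<close>

lemma palm_le:
  assumes f: "admissible (\<lambda>i y. U y * f i y)"
    and le: "\<And>i y. u y {1..p} \<Longrightarrow> \<bar>f i y\<bar> \<le> a * 4 ^ near i y + b"
  shows "\<bar>palm f\<bar> \<le> a * palm (\<lambda>i y. 4 ^ near i y) + b * \<mu>"
proof -
  have "\<bar>expect (\<lambda>i y. U y * f i y)\<bar> \<le> expect (\<lambda>i y. a * (U y * 4 ^ near i y) + U y * b)"
  proof (rule expect_abs_le[OF f])
    show "admissible (\<lambda>i y. a * (U y * 4 ^ near i y) + U y * b)"
      by (intro admissible_add admissible_cmult admissible_U_near admissible_U)
    show "\<bar>U y * f i y\<bar> \<le> a * (U y * 4 ^ near i y) + U y * b" for i y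
      using le[of y i] by (cases "u y {1..p}") (auto simp: U_def)
  qed
  also have "\<dots> = a * expect (\<lambda>i y. U y * 4 ^ near i y) + b * expect (\<lambda>i y. U y)"
    using expect_add[OF admissible_cmult[OF admissible_U_near] admissible_U, of a b]
      expect_cmult[of a "\<lambda>i y. U y * 4 ^ near i y"] expect_cmult[of b "\<lambda>i y. U y"]
    by (simp add: mult.commute)
  finally have "\<kappa> * \<bar>expect (\<lambda>i y. U y * f i y)\<bar>
      \<le> \<kappa> * (a * expect (\<lambda>i y. U y * 4 ^ near i y) + b * expect (\<lambda>i y. U y))"
    by (rule mult_left_mono[OF _ kappa_nonneg])
  moreover have "\<mu> = \<kappa> * expect (\<lambda>i y. U y)" using palm_one by (simp add: palm_def)
  ultimately show ?thesis
    using kappa_nonneg unfolding palm_def by (simp add: abs_mult algebra_simps)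
qed

end

section \<open>Poisson and normal approximation of the copy counts\<close>

lemma vec_upd_simps [simp]:
  "vec_upd v j a $ j = a" "vec_upd (vec_upd v j a) j b = vec_upd v j b" "vec_upd v j (v $ j) = v"
  by (auto simp: vec_upd_def vec_eq_iff)

lemma equivariant_forms_copy: "equivariant (forms_copy r \<Gamma>)"
  unfolding equivariant_def
proof (intro allI impI)
  fix y :: "nat \<Rightarrow> 'a" and \<pi> :: "nat \<Rightarrow> nat" and A assume "inj_on \<pi> A"
  have "forms_copy r \<Gamma> (\<lambda>i\<in>A. y (\<pi> i)) A = forms_copy r \<Gamma> (\<lambda>i. y (\<pi> i)) A"
    by (rule forms_copy_cong) simp
  then show "forms_copy r \<Gamma> (\<lambda>i\<in>A. y (\<pi> i)) A = forms_copy r \<Gamma> y (\<pi> ` A)"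
    using forms_copy_reindex[OF \<open>inj_on \<pi> A\<close>, of r \<Gamma> y] by blast
qed

lemma local_measurable_forms_copy:
  fixes D :: "'a::{real_normed_vector, second_countable_topology} measure"
  assumes "sets D = sets borel" "pair_graph \<Gamma>"
  shows "local_measurable D (forms_copy r \<Gamma>)"
proof -
  have "finite (pverts \<Gamma>)"
    using assms(2) by (simp add: pair_graph_def pair_digraph_def pair_fin_digraph_def pair_fin_digraph_axioms_def)
  then show ?thesis
    unfolding local_measurable_def pred_def using forms_copy_measurable[OF assms(1)] by blast
qed

text \<open>
  The radius \<open>2 k r\<close> is the one in the bound on mixed copies.
\<close>

locale disk_sample = poisson_sample D n for D :: "'a::euclidean_space measure" and n +
  fixes r q :: real and k0 k :: nat and \<Gamma>\<^sub>0 :: "'v pair_pre_digraph"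
    and \<Gamma> :: "'d::finite \<Rightarrow> 'v pair_pre_digraph"
  assumes D_borel: "sets D = sets borel" and r_pos: "0 < r" and orders: "1 \<le> k0" "k0 \<le> k"
    and G0: "pair_graph \<Gamma>\<^sub>0" "Digraph_Component.connected (with_proj \<Gamma>\<^sub>0)" "card (pverts \<Gamma>\<^sub>0) = k0"
    and G: "\<And>j. pair_graph (\<Gamma> j)" "\<And>j. Digraph_Component.connected (with_proj (\<Gamma> j))"
      "\<And>j. card (pverts (\<Gamma> j)) = k"
    and non_iso: "\<And>i j. i \<noteq> j \<Longrightarrow> \<not> digraph_iso (with_proj (\<Gamma> i)) (with_proj (\<Gamma> j))"
    and ball_prob: "\<And>x. measure D (cball x (2 * real k * r)) \<le> q"
begin

definition counts :: "(nat \<Rightarrow> 'a) \<Rightarrow> nat set \<Rightarrow> (nat ^ 'd) \<times> nat" where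
  "counts y A = ((\<chi> j. card (copies r (\<Gamma> j) y A)), card (copies r \<Gamma>\<^sub>0 y A))"

lemma equivariant_counts: "equivariant counts"
  unfolding equivariant_def counts_def using card_copies_reindex by (auto simp: vec_eq_iff)

text \<open>
  The counts are a function of the finite set of pairs of a graph and an index set that form a copy.
\<close>

lemma local_measurable_counts: "local_measurable D counts"
  unfolding local_measurable_def
proof (intro allI impI)
  fix A :: "nat set" assume A: "finite A"
  define gr where "gr g = (case g of None \<Rightarrow> \<Gamma>\<^sub>0 | Some j \<Rightarrow> \<Gamma> j)" for g
  define sel where "sel y = {x \<in> (UNIV :: 'd option set) \<times> Pow A. forms_copy r (gr (fst x)) y (snd x)}" for y :: "nat \<Rightarrow> 'a"
  define H where "H S = ((\<chi> j. card {I. (Some j, I) \<in> S}), card {I. (None, I) \<in> S})"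
    for S :: "('d option \<times> nat set) set"
  have gr: "pair_graph (gr g)" for g using G0 G by (auto simp: gr_def split: option.split)
  have "sel \<in> measurable (PiM A (\<lambda>_. D)) (count_space UNIV)" unfolding sel_def
  proof (rule measurable_finite_selection)
    fix x :: "'d option \<times> nat set" assume "x \<in> UNIV \<times> Pow A"
    then have x1: "snd x \<subseteq> A" by auto
    note x = x1 finite_subset[OF x1 A]
    have "(\<lambda>y. forms_copy r (gr (fst x)) y (snd x)) \<in> measurable (PiM A (\<lambda>_. D)) (count_space UNIV)"
      by (rule local_measurable_PiM[OF equivariant_forms_copy local_measurable_forms_copy[OF D_borel gr] x(2,1)])
    then show "{y \<in> space (PiM A (\<lambda>_. D)). forms_copy r (gr (fst x)) y (snd x)} \<in> sets (PiM A (\<lambda>_. D))"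
      unfolding pred_def .
  qed (use A in auto)
  then have "(\<lambda>y. H (sel y)) \<in> measurable (PiM A (\<lambda>_. D)) (count_space UNIV)"
    by (rule measurable_compose) simp
  moreover have "H (sel y) = counts y A" for y
    unfolding H_def sel_def counts_def copies_def gr_def by simp
  ultimately show "(\<lambda>y. counts y A) \<in> measurable (PiM A (\<lambda>_. D)) (count_space UNIV)" by simp
qed

lemma functionals:
  assumes "pair_graph \<Gamma>'" "card (pverts \<Gamma>') = p" "1 \<le> p"
  shows "poisson_neighbours D n (forms_copy r \<Gamma>') counts p (2 * real k * r) q"
proof -
  have "poisson_sample_functionals D n (forms_copy r \<Gamma>') counts p"
    using assms forms_copy_card equivariant_forms_copy local_measurable_forms_copy[OF D_borel assms(1)]
      equivariant_counts local_measurable_counts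
    by (intro poisson_sample_functionals.intro poisson_sample_axioms poisson_sample_functionals_axioms.intro) auto
  then show ?thesis
    using assms D_borel ball_prob
    by (intro poisson_neighbours.intro poisson_neighbours_axioms.intro) auto
qed

definition mean :: "'d \<Rightarrow> real" where
  "mean j = expect (\<lambda>i y. real (card (copies r (\<Gamma> j) y {1..i})))"

definition mean0 :: real where
  "mean0 = expect (\<lambda>i y. real (card (copies r \<Gamma>\<^sub>0 y {1..i})))"

definition var0 :: real where
  "var0 = expect (\<lambda>i y. (real (card (copies r \<Gamma>\<^sub>0 y {1..i})) - mean0)\<^sup>2)"

definition excess :: real where "excess = exp (3 * n * q) - 1"

lemma card_copies_planted:
  assumes G1: "pair_graph \<Gamma>1" "Digraph_Component.connected (with_proj \<Gamma>1)" "card (pverts \<Gamma>1) \<le> k" "1 \<le> card (pverts \<Gamma>1)"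
    and G2: "pair_graph \<Gamma>2" "Digraph_Component.connected (with_proj \<Gamma>2)" "card (pverts \<Gamma>2) = p" "1 \<le> p" "p \<le> k"
    and J: "forms_copy r \<Gamma>2 y {1..p}"
  obtains m where "card (copies r \<Gamma>1 y {1..p + i})
      = card (copies r \<Gamma>1 y {p + 1..p + i}) + card (copies r \<Gamma>1 y {1..p}) + m"
    "m \<le> 2 ^ p * (2 ^ card {j \<in> {p + 1..p + i}. norm (y j - y 1) \<le> 2 * real k * r} - 1)"
proof
  have "{1..p + i} = {1..p} \<union> {p + 1..p + i}" by auto
  moreover have "{1..p} \<inter> {p + 1..p + i} = {}" by auto
  ultimately show "card (copies r \<Gamma>1 y {1..p + i})
      = card (copies r \<Gamma>1 y {p + 1..p + i}) + card (copies r \<Gamma>1 y {1..p})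
        + card (mixed_copies r \<Gamma>1 y {1..p} {p + 1..p + i})"
    using card_copies_Un[of "{1..p}" "{p + 1..p + i}" \<Gamma>1 r y] G1(4) by (simp only: finite_atLeastAtMost)
  have "card (mixed_copies r \<Gamma>1 y {1..p} {p + 1..p + i})
      \<le> 2 ^ card {1..p} * (2 ^ card {j \<in> {p + 1..p + i}. norm (y j - y 1) \<le> 2 * real k * r} - 1)"
    using G2 J r_pos by (intro card_mixed_copies_le[OF G1(1-3)]) auto
  then show "card (mixed_copies r \<Gamma>1 y {1..p} {p + 1..p + i})
      \<le> 2 ^ p * (2 ^ card {j \<in> {p + 1..p + i}. norm (y j - y 1) \<le> 2 * real k * r} - 1)"
    by simp
qed

text \<open>
  The error of replacing the \<open>j\<close>-th count by an independent Poisson variable. With \<open>g\<close> the Stein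
  solution in this coordinate, the Mecke formula turns the error into the Palm mean of the difference
  between \<open>g\<close> at the old counts with the \<open>j\<close>-th one raised by one and \<open>g\<close> at the new counts. Without a
  nearby old point the two vectors agree, and only the count of \<open>\<Gamma>\<^sub>0\<close> moves, by at most \<open>2 ^ k\<close>.
  Otherwise the difference is bounded by \<open>4 exp l \<le> 4 exp l (4 ^ D - 1)\<close>, with \<open>D\<close> nearby points.
\<close>

theorem poisson_step:
  fixes \<Psi> :: "nat ^ 'd \<Rightarrow> real \<Rightarrow> real"
  assumes b: "\<And>v x. \<bar>\<Psi> v x\<bar> \<le> 1" and lip: "\<And>v x x'. \<bar>\<Psi> v x - \<Psi> v x'\<bar> \<le> L * \<bar>x - x'\<bar>" and L: "0 \<le> L"
    and s: "0 \<le> s" and pos: "0 < mean j"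
  shows "\<bar>expect (\<lambda>i y. \<Psi> (fst (counts y {1..i})) (s * (real (snd (counts y {1..i})) - a)))
      - expect (\<lambda>i y. measure_pmf.expectation (poisson_pmf (mean j))
          (\<lambda>m. \<Psi> (vec_upd (fst (counts y {1..i})) j m) (s * (real (snd (counts y {1..i})) - a))))\<bar>
    \<le> mean j * exp (mean j) * (4 * excess + 2 * L * s * 2 ^ k)"
proof -
  have k1: "1 \<le> k" using orders by simp
  interpret A: poisson_neighbours D n "forms_copy r (\<Gamma> j)" counts k "2 * real k * r" q
    by (rule functionals[OF G(1) G(3) k1])
  define l where "l = mean j"
  have l: "0 < l" using pos by (simp add: l_def)
  define X where "X w = s * (real w - a)" for w :: nat
  define g where "g v x = poisson_stein l (\<lambda>m. \<Psi> (vec_upd v j m) x) (v $ j)" for v x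
  define \<Phi>1 where "\<Phi>1 c = g (vec_upd (fst c) j (Suc (fst c $ j))) (X (snd c))" for c
  define \<Phi>2 where "\<Phi>2 c = g (fst c) (X (snd c))" for c
  define \<Theta> where "\<Theta> c = \<Psi> (fst c) (X (snd c))" for c
  define \<Theta>' where "\<Theta>' c = measure_pmf.expectation (poisson_pmf l) (\<lambda>m. \<Psi> (vec_upd (fst c) j m) (X (snd c)))" for c
  have gb: "\<bar>g v x\<bar> \<le> 2 * exp l" for v x
    unfolding g_def using poisson_stein_bound[OF l, of "\<lambda>m. \<Psi> (vec_upd v j m) x" 1] b by (simp add: mult.commute)
  have gl: "\<bar>g v x - g v x'\<bar> \<le> exp l * (2 * (L * \<bar>x - x'\<bar>))" for v x x'
    unfolding g_def by (rule poisson_stein_lipschitz[OF l, where B = 1]) (rule b lip)+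
  have stein: "\<Theta> c - \<Theta>' c = l * \<Phi>1 c - real (fst c $ j) * \<Phi>2 c" for c
    using poisson_stein_eq[OF l, of "\<lambda>m. \<Psi> (vec_upd (fst c) j m) (X (snd c))" 1 "fst c $ j"] b
    by (simp add: \<Theta>_def \<Theta>'_def \<Phi>1_def \<Phi>2_def g_def)
  have bd: "\<bar>F (counts y A)\<bar> \<le> C * 2 ^ card A" if "\<And>c. \<bar>F c\<bar> \<le> C" for F :: "_ \<Rightarrow> real" and C y A
  proof -
    have "0 \<le> C" using order_trans[OF abs_ge_zero that] .
    then show ?thesis using that[of "counts y A"] mult_left_mono[OF one_le_power[of 2 "card A"], of C] by simp
  qed
  have b1: "\<bar>\<Phi>1 c\<bar> \<le> 2 * exp l" for c unfolding \<Phi>1_def by (rule gb)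
  have b2: "\<bar>\<Phi>2 c\<bar> \<le> 2 * exp l" for c unfolding \<Phi>2_def by (rule gb)
  have b3: "\<bar>\<Theta> c\<bar> \<le> 1" for c unfolding \<Theta>_def by (rule b)
  have b4: "\<bar>\<Theta>' c\<bar> \<le> 1" for c unfolding \<Theta>'_def by (rule pmf_expectation_bound) (rule b)
  have bd1: "\<bar>\<Phi>1 (counts y A)\<bar> \<le> (2 * exp l) * 2 ^ card A" for y A by (rule bd[OF b1])
  have bd2: "\<bar>\<Phi>2 (counts y A)\<bar> \<le> (2 * exp l) * 2 ^ card A" for y A by (rule bd[OF b2])
  have bd3: "\<bar>\<Theta> (counts y A)\<bar> \<le> 1 * 2 ^ card A" for y A by (rule bd[OF b3])
  have bd4: "\<bar>\<Theta>' (counts y A)\<bar> \<le> 1 * 2 ^ card A" for y A by (rule bd[OF b4])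
  have occ: "A.occurrences i y = real (fst (counts y {1..i}) $ j)" for i y
    by (simp add: A.occurrences_def counts_def copies_def)
  have mu: "A.\<mu> = l" unfolding A.\<mu>_def l_def mean_def by (simp add: occ[abs_def] counts_def)
  have kU: "A.\<kappa> * expect (\<lambda>i y. A.U y) = l"
    using A.palm_one mu by (simp add: A.palm_def)
  define f where "f i y = \<Phi>1 (counts y {k + 1..k + i}) - \<Phi>2 (counts y {1..k + i})" for i y
  have adm_f: "admissible (\<lambda>i y. A.U y * f i y)"
    using admissible_diff[OF A.admissible_old[of \<Phi>1, OF bd1] A.admissible_new[of \<Phi>2, OF bd2]]
    by (simp add: f_def right_diff_distrib)
  have "expect (\<lambda>i y. \<Theta> (counts y {1..i})) - expect (\<lambda>i y. \<Theta>' (counts y {1..i}))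
    = expect (\<lambda>i y. \<Theta> (counts y {1..i}) - \<Theta>' (counts y {1..i}))"
    by (rule expect_diff[symmetric, OF A.admissible_all[of \<Theta>, OF bd3] A.admissible_all[of \<Theta>', OF bd4]])
  also have "\<dots> = expect (\<lambda>i y. l * \<Phi>1 (counts y {1..i}) - A.occurrences i y * \<Phi>2 (counts y {1..i}))"
    unfolding stein occ ..
  also have "\<dots> = l * expect (\<lambda>i y. \<Phi>1 (counts y {1..i})) - expect (\<lambda>i y. A.occurrences i y * \<Phi>2 (counts y {1..i}))"
    unfolding expect_cmult[of l, symmetric]
    by (rule expect_diff[OF admissible_cmult[OF A.admissible_all[of \<Phi>1, OF bd1]] A.admissible_occ[of \<Phi>2, OF bd2]])
  also have "\<dots> = A.\<kappa> * expect (\<lambda>i y. A.U y * \<Phi>1 (counts y {k + 1..k + i}))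
      - A.\<kappa> * expect (\<lambda>i y. A.U y * \<Phi>2 (counts y {1..k + i}))"
    unfolding A.expect_mecke[of \<Phi>2, OF bd2] A.expect_old_independent[of \<Phi>1, OF bd1] kU[symmetric]
    by (simp add: mult.assoc)
  also have "\<dots> = A.palm f"
    unfolding A.palm_def f_def right_diff_distrib
    by (subst expect_diff[OF A.admissible_old[of \<Phi>1, OF bd1] A.admissible_new[of \<Phi>2, OF bd2]])
      (simp add: right_diff_distrib)
  finally have eq: "expect (\<lambda>i y. \<Theta> (counts y {1..i})) - expect (\<lambda>i y. \<Theta>' (counts y {1..i})) = A.palm f" .
  define B where "B = exp l * (2 * (L * (s * 2 ^ k)))"
  have B0: "0 \<le> B" using L s by (simp add: B_def)
  have "\<bar>A.palm f\<bar> \<le> (4 * exp l) * A.palm (\<lambda>i y. 4 ^ A.near i y) + (B - 4 * exp l) * A.\<mu>"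
  proof (rule A.palm_le[OF adm_f])
    fix i :: nat and y :: "nat \<Rightarrow> 'a" assume J: "forms_copy r (\<Gamma> j) y {1..k}"
    let ?old = "counts y {k + 1..k + i}" and ?new = "counts y {1..k + i}"
    show "\<bar>f i y\<bar> \<le> 4 * exp l * 4 ^ A.near i y + (B - 4 * exp l)"
    proof (cases "A.near i y = 0")
      case False
      then have "(4::real) ^ 1 \<le> 4 ^ A.near i y" by (intro power_increasing) auto
      then have "4 * exp l * 4 \<le> 4 * exp l * (4 ^ A.near i y)" by simp
      moreover have "\<bar>f i y\<bar> \<le> 4 * exp l"
        unfolding f_def using b1[of ?old] b2[of ?new] abs_triangle_ineq4[of "\<Phi>1 ?old" "\<Phi>2 ?new"] by simp
      moreover have "0 < exp l" by simp
      ultimately show ?thesis using B0 by argo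
    next
      case True
      then have near0: "card {j \<in> {k + 1..k + i}. norm (y j - y 1) \<le> 2 * real k * r} = 0"
        unfolding A.near_def .
      have v: "fst ?new = vec_upd (fst ?old) j (Suc (fst ?old $ j))"
      proof -
        have "card (copies r (\<Gamma> j') y {1..k + i})
          = card (copies r (\<Gamma> j') y {k + 1..k + i}) + (if j' = j then 1 else 0)" for j'
        proof -
          obtain m where m: "card (copies r (\<Gamma> j') y {1..k + i})
              = card (copies r (\<Gamma> j') y {k + 1..k + i}) + card (copies r (\<Gamma> j') y {1..k}) + m"
            "m \<le> 2 ^ k * (2 ^ card {j \<in> {k + 1..k + i}. norm (y j - y 1) \<le> 2 * real k * r} - 1)"
            using card_copies_planted[of "\<Gamma> j'" "\<Gamma> j" k y i] G k1 J by auto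
          have "forms_copy r (\<Gamma> j') y {1..k} \<longleftrightarrow> j' = j"
            using J forms_copy_unique_graph[OF G(1) G(1), of r j' y "{1..k}" j] non_iso by blast
          then have "card (copies r (\<Gamma> j') y {1..k}) = (if j' = j then 1 else 0)"
            using copies_self[of "{1..k}" "\<Gamma> j'" r y] G(3) by simp
          moreover have "m = 0" using m(2) unfolding near0 by simp
          ultimately show ?thesis using m(1) by simp
        qed
        then show ?thesis by (simp add: counts_def vec_upd_def vec_eq_iff)
      qed
      obtain m where m: "card (copies r \<Gamma>\<^sub>0 y {1..k + i})
            = card (copies r \<Gamma>\<^sub>0 y {k + 1..k + i}) + card (copies r \<Gamma>\<^sub>0 y {1..k}) + m"
          "m \<le> 2 ^ k * (2 ^ card {j \<in> {k + 1..k + i}. norm (y j - y 1) \<le> 2 * real k * r} - 1)"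
        using card_copies_planted[of "\<Gamma>\<^sub>0" "\<Gamma> j" k y i] G0 G k1 J orders by auto
      have "card (copies r \<Gamma>\<^sub>0 y {1..k}) \<le> 2 ^ k" using card_copies_le[of "{1..k}" r \<Gamma>\<^sub>0 y] by simp
      then have w: "real (card (copies r \<Gamma>\<^sub>0 y {1..k})) \<le> 2 ^ k"
        by (metis of_nat_le_iff of_nat_numeral of_nat_power)
      have "X (snd ?new) - X (snd ?old) = s * real (card (copies r \<Gamma>\<^sub>0 y {1..k}))"
      proof -
        have "m = 0" using m(2) unfolding near0 by simp
        then show ?thesis using m(1) by (simp add: X_def counts_def algebra_simps)
      qed
      then have x: "\<bar>X (snd ?old) - X (snd ?new)\<bar> \<le> s * 2 ^ k"
      proof -
        assume eq: "X (snd ?new) - X (snd ?old) = s * real (card (copies r \<Gamma>\<^sub>0 y {1..k}))"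
        have "\<bar>X (snd ?old) - X (snd ?new)\<bar> = s * real (card (copies r \<Gamma>\<^sub>0 y {1..k}))"
          unfolding abs_minus_commute[of "X (snd ?old)"] eq using s by simp
        then show ?thesis using mult_left_mono[OF w s] by simp
      qed
      have "f i y = g (fst ?new) (X (snd ?old)) - g (fst ?new) (X (snd ?new))"
        unfolding f_def \<Phi>1_def \<Phi>2_def v by simp
      then have "\<bar>f i y\<bar> \<le> exp l * (2 * (L * \<bar>X (snd ?old) - X (snd ?new)\<bar>))" using gl by simp
      also have "\<dots> \<le> B" unfolding B_def using x L by (intro mult_left_mono) auto
      finally show ?thesis using True by simp
    qed
  qed
  also have "\<dots> \<le> (4 * exp l) * (A.\<mu> * (1 + A.\<delta>)) + (B - 4 * exp l) * A.\<mu>"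
    using A.palm_near by (intro add_right_mono mult_left_mono) auto
  also have "\<dots> = l * exp l * (4 * excess + 2 * L * s * 2 ^ k)"
    unfolding mu A.\<delta>_def excess_def B_def by (simp add: algebra_simps)
  finally show ?thesis unfolding eq[symmetric] unfolding \<Theta>_def \<Theta>'_def X_def l_def .
qed

text \<open>
  Induction over the set of coordinates that have been replaced already. Averaging over them
  preserves the bound and the Lipschitz constant of the test function.
\<close>

theorem vector_step:
  fixes \<Psi> :: "nat ^ 'd \<Rightarrow> real \<Rightarrow> real"
  assumes b: "\<And>v x. \<bar>\<Psi> v x\<bar> \<le> 1" and lip: "\<And>v x x'. \<bar>\<Psi> v x - \<Psi> v x'\<bar> \<le> L * \<bar>x - x'\<bar>" and L: "0 \<le> L"
    and s: "0 \<le> s" and pos: "\<And>j. 0 < mean j" and l: "\<And>j. l $ j = mean j"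
  shows "\<bar>expect (\<lambda>i y. \<Psi> (fst (counts y {1..i})) (s * (real (snd (counts y {1..i})) - a)))
      - expect (\<lambda>i y. measure_pmf.expectation (poisson_vec_pmf l)
          (\<lambda>v. \<Psi> v (s * (real (snd (counts y {1..i})) - a))))\<bar>
    \<le> (\<Sum>j\<in>UNIV. mean j * exp (mean j) * (4 * excess + 2 * L * s * 2 ^ k))"
proof -
  let ?X = "\<lambda>i y. s * (real (snd (counts y {1..i})) - a)" and ?v = "\<lambda>i y. fst (counts y {1..i})"
  let ?E = "\<lambda>J. expect (\<lambda>i y. poisson_resample l J (\<lambda>v. \<Psi> v (?X i y)) (?v i y))"
  have "\<bar>?E {} - ?E J\<bar> \<le> (\<Sum>j\<in>J. mean j * exp (mean j) * (4 * excess + 2 * L * s * 2 ^ k))" if "finite J" for J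
    using that
  proof induction
    case (insert j J)
    define \<Psi>' where "\<Psi>' v x = poisson_resample l J (\<lambda>v. \<Psi> v x) v" for v x
    have "poisson_resample l (insert j J) (\<lambda>v. \<Psi> v x) v
        = measure_pmf.expectation (poisson_pmf (mean j)) (\<lambda>m. \<Psi>' (vec_upd v j m) x)" for v x
      unfolding \<Psi>'_def l[symmetric] by (rule poisson_resample_insert[OF insert(2)]) (rule b)
    moreover have "\<bar>\<Psi>' v x\<bar> \<le> 1" for v x unfolding \<Psi>'_def by (rule poisson_resample_bound) (rule b)
    moreover have "\<bar>\<Psi>' v x - \<Psi>' v x'\<bar> \<le> L * \<bar>x - x'\<bar>" for v x x'
      unfolding \<Psi>'_def by (rule poisson_resample_lipschitz[where B = 1]) (rule b lip)+
    ultimately have "\<bar>?E J - ?E (insert j J)\<bar> \<le> mean j * exp (mean j) * (4 * excess + 2 * L * s * 2 ^ k)"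
      using poisson_step[of \<Psi>' L s j a, OF _ _ L s pos] by (simp add: \<Psi>'_def)
    then show ?case using insert by simp
  qed simp
  from this[of UNIV] show ?thesis by (simp add: poisson_resample_empty poisson_resample_UNIV)
qed

lemma derivative_remainder_bound:
  fixes h h' :: "real \<Rightarrow> real"
  assumes d: "\<And>x. (h has_real_derivative h' x) (at x)" and lip: "\<And>x y. \<bar>h' x - h' y\<bar> \<le> C * \<bar>x - y\<bar>"
    and C: "0 \<le> C"
  shows "\<bar>h (x + t) - h x - t * h' x\<bar> \<le> C * t\<^sup>2"
proof -
  have "norm ((h (x + t) - (x + t) * h' x) - (h x - x * h' x)) \<le> C * \<bar>t\<bar> * norm (x + t - x)"
  proof (rule field_differentiable_bound[of "cball x \<bar>t\<bar>" "\<lambda>u. h u - u * h' x" "\<lambda>u. h' u - h' x"])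
    show "((\<lambda>u. h u - u * h' x) has_real_derivative h' u - h' x) (at u within cball x \<bar>t\<bar>)" for u
      by (auto intro!: derivative_eq_intros has_field_derivative_at_within[OF d])
    show "norm (h' u - h' x) \<le> C * \<bar>t\<bar>" if "u \<in> cball x \<bar>t\<bar>" for u
    proof -
      have "\<bar>u - x\<bar> \<le> \<bar>t\<bar>" using that by (simp add: dist_real_def abs_minus_commute)
      then show ?thesis using lip[of u x] mult_left_mono[OF _ C, of "\<bar>u - x\<bar>" "\<bar>t\<bar>"] by simp
    qed
  qed (auto simp: dist_real_def)
  then show ?thesis by (simp add: power2_eq_square abs_mult_self_eq algebra_simps mult.assoc)
qed

text \<open>
  Let \<open>T\<close> be the increase of the count under planting, so \<open>T \<ge> 1\<close>. The Mecke formula gives the variance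
  as the Palm mean of \<open>T\<close>, hence it exceeds the mean by at most \<open>2 ^ k0 mean0 excess\<close>. Let \<open>h\<close> be the Stein
  solution and \<open>x\<close> the normalized count of the old points. The error is the Palm mean of
  \<open>h' x / mean0 - (h (x + T / \<sigma>) - h x) / \<sigma>\<close>, which to first order is \<open>h' x (1 / mean0 - T / \<sigma>\<^sup>2)\<close>. Here
  \<open>mean0\<close> and \<open>\<sigma>\<^sup>2\<close> agree up to mixed copies, as do \<open>T\<close> and \<open>1\<close>; the second order remainder is at
  most \<open>8 T\<^sup>2 / \<sigma>\<^sup>3\<close>, of Palm mean \<open>O (1 / \<sigma>)\<close>.
\<close>

theorem normal_step:
  assumes b: "\<And>x. \<bar>\<phi> x\<bar> \<le> 1" and lip: "\<And>x x'. \<bar>\<phi> x - \<phi> x'\<bar> \<le> \<bar>x - x'\<bar>" and pos: "0 < mean0"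
  shows "mean0 \<le> var0"
    and "\<bar>expect (\<lambda>i y. \<phi> ((real (snd (counts y {1..i})) - mean0) / sqrt var0)) - (\<integral>x. \<phi> x * \<rho> x \<partial>lborel)\<bar>
      \<le> 8 * 2 ^ k0 * excess + 8 * 4 ^ k0 * (1 + excess) / sqrt var0"
proof -
  interpret A: poisson_neighbours D n "forms_copy r \<Gamma>\<^sub>0" counts k0 "2 * real k * r" q
    by (rule functionals[OF G0(1) G0(3) orders(1)])
  let ?K = "(2::real) ^ k0"
  define w where "w c = real (snd c)" for c :: "(nat ^ 'd) \<times> nat"
  have growth_w: "\<bar>w (counts y A)\<bar> \<le> 1 * 2 ^ card A" if "finite A" for y A
  proof -
    have "real (card (copies r \<Gamma>\<^sub>0 y A)) \<le> real (2 ^ card A)"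
      using card_copies_le[OF that, of r \<Gamma>\<^sub>0 y] by (intro of_nat_mono)
    then show ?thesis by (simp add: w_def counts_def)
  qed
  have bd: "\<bar>F (counts y A)\<bar> \<le> C * 2 ^ card A" if "\<And>c. \<bar>F c\<bar> \<le> C" for F :: "_ \<Rightarrow> real" and C y A
  proof -
    have "0 \<le> C" using order_trans[OF abs_ge_zero that] .
    then show ?thesis using that[of "counts y A"] mult_left_mono[OF one_le_power[of 2 "card A"], of C] by simp
  qed
  have occ: "A.occurrences i y = w (counts y {1..i})" for i y
    by (simp add: A.occurrences_def counts_def copies_def w_def)
  have mu: "A.\<mu> = mean0" unfolding A.\<mu>_def mean0_def by (simp add: occ[abs_def] counts_def w_def)
  have kU: "A.\<kappa> * expect (\<lambda>i y. A.U y) = mean0" using A.palm_one mu by (simp add: A.palm_def)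
  have admW: "admissible (\<lambda>i y. w (counts y {1..i}))"
    by (rule A.admissible_all[of w, OF growth_w])
  have admWW: "admissible (\<lambda>i y. w (counts y {1..i}) * w (counts y {1..i}))"
  proof -
    have "admissible (\<lambda>i y. A.occurrences i y * w (counts y {1..i}))"
      by (rule A.admissible_occ[of w, OF growth_w])
    then show ?thesis unfolding occ .
  qed
  have admN: "admissible (\<lambda>i y. A.U y * w (counts y {1..k0 + i}))"
    by (rule A.admissible_new[of w, OF growth_w])
  have admO: "admissible (\<lambda>i y. A.U y * w (counts y {k0 + 1..k0 + i}))"
    by (rule A.admissible_old[of w, OF growth_w])
  have mecke_w: "expect (\<lambda>i y. A.occurrences i y * w (counts y {1..i})) = A.\<kappa> * expect (\<lambda>i y. A.U y * w (counts y {1..k0 + i}))"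
    by (rule A.expect_mecke[of w, OF growth_w])
  have old_w: "expect (\<lambda>i y. A.U y * w (counts y {k0 + 1..k0 + i})) = expect (\<lambda>i y. A.U y) * expect (\<lambda>i y. w (counts y {1..i}))"
    by (rule A.expect_old_independent[of w, OF growth_w])
  have EW: "expect (\<lambda>i y. w (counts y {1..i})) = mean0"
    by (simp add: mean0_def w_def counts_def)
  define T where "T i y = w (counts y {1..k0 + i}) - w (counts y {k0 + 1..k0 + i})" for i y
  have admT: "admissible (\<lambda>i y. A.U y * T i y)"
    using admissible_diff[OF admN admO]
    by (simp add: T_def right_diff_distrib)
  have varT: "var0 = A.palm T"
  proof -
    have "var0 = expect (\<lambda>i y. (w (counts y {1..i}) * w (counts y {1..i}) - (2 * mean0) * w (counts y {1..i})) + mean0\<^sup>2)"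
      unfolding var0_def by (intro arg_cong[of _ _ expect] ext) (simp add: w_def counts_def power2_eq_square algebra_simps)
    also have "\<dots> = expect (\<lambda>i y. w (counts y {1..i}) * w (counts y {1..i}))
        - (2 * mean0) * expect (\<lambda>i y. w (counts y {1..i})) + expect (\<lambda>i y. mean0\<^sup>2)"
      unfolding expect_cmult[symmetric] expect_diff[OF admWW admissible_cmult[OF admW], symmetric]
      by (rule expect_add[OF admissible_diff[OF admWW admissible_cmult[OF admW]]])
        (rule admissible_bounded[where C = "mean0\<^sup>2"], auto)
    also have "\<dots> = expect (\<lambda>i y. w (counts y {1..i}) * w (counts y {1..i})) - (2 * mean0) * mean0 + mean0\<^sup>2"
      unfolding EW expect_const ..
    also have "\<dots> = expect (\<lambda>i y. A.occurrences i y * w (counts y {1..i})) - mean0 * expect (\<lambda>i y. w (counts y {1..i}))"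
      unfolding occ EW by (simp add: power2_eq_square)
    also have "\<dots> = A.palm T"
      unfolding mecke_w A.palm_def T_def right_diff_distrib expect_diff[OF admN admO] old_w EW
      unfolding kU[symmetric] by (simp add: algebra_simps)
    finally show ?thesis .
  qed
  have T: "1 \<le> T i y \<and> T i y - 1 \<le> ?K * (2 ^ A.near i y - 1)" if J: "forms_copy r \<Gamma>\<^sub>0 y {1..k0}" for i y
  proof -
    obtain m where m: "card (copies r \<Gamma>\<^sub>0 y {1..k0 + i})
          = card (copies r \<Gamma>\<^sub>0 y {k0 + 1..k0 + i}) + card (copies r \<Gamma>\<^sub>0 y {1..k0}) + m"
        "m \<le> 2 ^ k0 * (2 ^ card {j \<in> {k0 + 1..k0 + i}. norm (y j - y 1) \<le> 2 * real k * r} - 1)"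
      using card_copies_planted[of "\<Gamma>\<^sub>0" "\<Gamma>\<^sub>0" k0 y i] G0 J orders by auto
    have "card (copies r \<Gamma>\<^sub>0 y {1..k0}) = 1"
      using copies_self[of "{1..k0}" \<Gamma>\<^sub>0 r y] G0(3) J by simp
    then have "T i y = 1 + real m" using m(1) by (simp add: T_def w_def counts_def)
    moreover have "real m \<le> real (2 ^ k0 * (2 ^ A.near i y - 1))"
      using m(2) unfolding A.near_def by (intro of_nat_mono)
    ultimately show ?thesis by (simp add: of_nat_diff)
  qed
  have sq: "((2::real) ^ i)\<^sup>2 = 4 ^ i" for i :: nat
  proof -
    have "((2::real) ^ i)\<^sup>2 = (2\<^sup>2) ^ i" by (simp only: power_mult[symmetric] mult.commute)
    then show ?thesis by simp
  qed
  have T1: "\<bar>T i y - 1\<bar> \<le> ?K * 4 ^ A.near i y - ?K" if "forms_copy r \<Gamma>\<^sub>0 y {1..k0}" for i y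
  proof -
    have "T i y - 1 \<le> ?K * (4 ^ A.near i y - 1)"
      using T[OF that, of i] A.two_le_four_pow[of "A.near i y"]
      by (intro order_trans[OF conjunct2[OF T[OF that, of i]] mult_left_mono]) auto
    then show ?thesis using T[OF that, of i] by (simp add: right_diff_distrib)
  qed
  have T2: "(T i y)\<^sup>2 \<le> 4 ^ k0 * 4 ^ A.near i y" if "forms_copy r \<Gamma>\<^sub>0 y {1..k0}" for i y
  proof -
    have "T i y \<le> ?K * 2 ^ A.near i y"
    proof -
      have "T i y - 1 \<le> ?K * 2 ^ A.near i y - ?K" using T[OF that, of i] by (simp add: right_diff_distrib)
      moreover have "1 \<le> ?K" by simp
      ultimately show ?thesis by linarith
    qed
    then have "(T i y)\<^sup>2 \<le> (?K * 2 ^ A.near i y)\<^sup>2" using T[OF that, of i] by (intro power_mono) auto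
    also have "\<dots> = 4 ^ k0 * 4 ^ A.near i y" by (simp only: power_mult_distrib sq)
    finally show ?thesis .
  qed
  have admT1: "admissible (\<lambda>i y. A.U y * (T i y - 1))"
    using admissible_diff[OF admT A.admissible_U[of 1]] by (simp add: right_diff_distrib)
  have palmT1: "A.palm (\<lambda>i y. T i y - 1) = var0 - mean0"
    using expect_diff[OF admT A.admissible_U[of 1]] A.palm_one
    unfolding varT A.palm_def mu by (simp add: right_diff_distrib)
  have "0 \<le> expect (\<lambda>i y. A.U y * (T i y - 1))"
    unfolding expect_def by (rule integral_nonneg_AE) (use T in \<open>auto simp: A.U_def\<close>)
  then have "0 \<le> A.palm (\<lambda>i y. T i y - 1)" unfolding A.palm_def using A.kappa_nonneg by simp
  then show le: "mean0 \<le> var0" using palmT1 by simp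
  have "\<bar>A.palm (\<lambda>i y. T i y - 1)\<bar> \<le> ?K * A.palm (\<lambda>i y. 4 ^ A.near i y) + (- ?K) * A.\<mu>"
    by (rule A.palm_le[OF admT1]) (use T1 in simp)
  also have "\<dots> \<le> ?K * (A.\<mu> * (1 + A.\<delta>)) + (- ?K) * A.\<mu>"
    using A.palm_near by (intro add_right_mono mult_left_mono) auto
  also have "\<dots> = ?K * mean0 * excess" unfolding mu A.\<delta>_def excess_def by (simp add: algebra_simps)
  finally have var_le: "var0 - mean0 \<le> ?K * mean0 * excess" unfolding palmT1 by simp
  have ex0: "0 \<le> excess" using A.\<delta>_nonneg by (simp add: A.\<delta>_def excess_def)
  define \<sigma> where "\<sigma> = sqrt var0"
  have v: "0 < var0" using pos le by simp
  have \<sigma>: "0 < \<sigma>" "\<sigma>\<^sup>2 = var0" using v by (auto simp: \<sigma>_def)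
  obtain h h' where h: "\<And>x. (h has_real_derivative h' x) (at x)"
    "\<And>x. h' x - x * h x = \<phi> x - (\<integral>y. \<phi> y * \<rho> y \<partial>lborel)"
    "\<And>x. \<bar>h x\<bar> \<le> 6" "\<And>x. \<bar>h' x\<bar> \<le> 4" "\<And>x y. \<bar>h' x - h' y\<bar> \<le> 8 * \<bar>x - y\<bar>"
    using normal_stein_solution[OF b lip] by blast
  define X where "X c = (w c - mean0) / \<sigma>" for c
  define H where "H c = h (X c)" for c
  define H' where "H' c = h' (X c)" for c
  have g1: "\<bar>H (counts y A)\<bar> \<le> 6 * 2 ^ card A" for y A by (rule bd) (simp add: H_def h)
  have g2: "\<bar>H' (counts y A)\<bar> \<le> 4 * 2 ^ card A" for y A by (rule bd) (simp add: H'_def h)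
  have g3: "\<bar>\<phi> (X (counts y A))\<bar> \<le> 1 * 2 ^ card A" for y A by (rule bd) (rule b)
  let ?m = "\<integral>y. \<phi> y * \<rho> y \<partial>lborel"
  define a1 where "a1 i y = (1 / mean0) * H' (counts y {k0 + 1..k0 + i})" for i y
  define a2 where "a2 i y = (1 / \<sigma>) * (H (counts y {1..k0 + i}) - H (counts y {k0 + 1..k0 + i}))" for i y
  have adm1: "admissible (\<lambda>i y. A.U y * a1 i y)"
    using admissible_cmult[OF A.admissible_old[of H', OF g2], of "1 / mean0"]
    by (simp add: a1_def mult.left_commute)
  have adm2: "admissible (\<lambda>i y. A.U y * a2 i y)"
    using admissible_cmult[OF admissible_diff[OF A.admissible_new[of H, OF g1] A.admissible_old[of H, OF g1]], of "1 / \<sigma>"]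
    by (simp add: a2_def mult.left_commute right_diff_distrib)
  have p1: "A.palm a1 = expect (\<lambda>i y. H' (counts y {1..i}))"
  proof -
    have "A.palm a1 = (1 / mean0) * (A.\<kappa> * expect (\<lambda>i y. A.U y * H' (counts y {k0 + 1..k0 + i})))"
      unfolding A.palm_def a1_def mult.left_commute[of _ "1 / mean0"] expect_cmult by simp
    then show ?thesis
      using pos kU unfolding A.expect_old_independent[of H', OF g2] by (simp add: mult.assoc[symmetric])
  qed
  have p2: "A.palm a2 = (1 / \<sigma>) * (expect (\<lambda>i y. A.occurrences i y * H (counts y {1..i})) - mean0 * expect (\<lambda>i y. H (counts y {1..i})))"
    unfolding A.palm_def a2_def mult.left_commute[of _ "1 / \<sigma>"] expect_cmult right_diff_distrib[of "A.U _"]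
      expect_diff[OF A.admissible_new[of H, OF g1] A.admissible_old[of H, OF g1]]
      A.expect_mecke[of H, OF g1] A.expect_old_independent[of H, OF g1] kU[symmetric]
    by (simp add: algebra_simps)
  have "expect (\<lambda>i y. \<phi> (X (counts y {1..i}))) - ?m = expect (\<lambda>i y. \<phi> (X (counts y {1..i})) - ?m)"
    by (subst expect_diff[OF A.admissible_all[of "\<lambda>c. \<phi> (X c)", OF g3]])
      (auto simp: expect_const intro!: admissible_bounded[where C = "\<bar>?m\<bar>"])
  also have "\<dots> = expect (\<lambda>i y. H' (counts y {1..i})
      - (1 / \<sigma>) * (A.occurrences i y * H (counts y {1..i}) - mean0 * H (counts y {1..i})))"
  proof (intro arg_cong[of _ _ expect] ext)
    fix i :: nat and y :: "nat \<Rightarrow> 'a"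
    let ?c = "counts y {1..i}"
    have "\<phi> (X ?c) - ?m = H' ?c - X ?c * H ?c" unfolding H_def H'_def using h(2)[of "X ?c"] by simp
    also have "X ?c * H ?c = (1 / \<sigma>) * (w ?c * H ?c - mean0 * H ?c)" by (simp add: X_def left_diff_distrib)
    finally show "\<phi> (X ?c) - ?m = H' ?c - (1 / \<sigma>) * (A.occurrences i y * H ?c - mean0 * H ?c)" unfolding occ .
  qed
  also have "\<dots> = A.palm a1 - A.palm a2"
  proof -
    note d = admissible_diff[OF A.admissible_occ[of H, OF g1] admissible_cmult[OF A.admissible_all[of H, OF g1], of mean0]]
    show ?thesis
      unfolding p1 p2 expect_diff[OF A.admissible_all[of H', OF g2] admissible_cmult[OF d]] expect_cmult
        expect_diff[OF A.admissible_occ[of H, OF g1] admissible_cmult[OF A.admissible_all[of H, OF g1], of mean0]] ..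
  qed
  also have "\<dots> = A.palm (\<lambda>i y. a1 i y - a2 i y)"
    unfolding A.palm_def right_diff_distrib expect_diff[OF adm1 adm2] ..
  finally have eq: "expect (\<lambda>i y. \<phi> (X (counts y {1..i}))) - ?m = A.palm (\<lambda>i y. a1 i y - a2 i y)" .
  \<comment> \<open>The coefficients of \<open>4 ^ D\<close> and \<open>1\<close> when \<open>T - 1\<close> is bounded by \<open>2 ^ k0 (4 ^ D - 1)\<close> and \<open>T\<^sup>2\<close> by \<open>4 ^ k0 4 ^ D\<close>.\<close>
  define \<alpha> where "\<alpha> = 4 * ?K / var0 + 8 * 4 ^ k0 / (\<sigma> * var0)"
  define \<beta> where "\<beta> = 4 * (1 / mean0 - 1 / var0) - 4 * ?K / var0"
  have "\<bar>A.palm (\<lambda>i y. a1 i y - a2 i y)\<bar> \<le> \<alpha> * A.palm (\<lambda>i y. 4 ^ A.near i y) + \<beta> * A.\<mu>"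
  proof (rule A.palm_le)
    show "admissible (\<lambda>i y. A.U y * (a1 i y - a2 i y))"
      using admissible_diff[OF adm1 adm2] by (simp add: right_diff_distrib)
    fix i :: nat and y :: "nat \<Rightarrow> 'a" assume J: "forms_copy r \<Gamma>\<^sub>0 y {1..k0}"
    let ?x = "X (counts y {k0 + 1..k0 + i})" and ?N = "(4::real) ^ A.near i y"
    define t where "t = T i y / \<sigma>"
    have "X (counts y {1..k0 + i}) = ?x + t"
      by (simp add: X_def T_def t_def diff_divide_distrib)
    define e where "e = h (?x + t) - h ?x - t * h' ?x"
    have e: "\<bar>e\<bar> \<le> 8 * t\<^sup>2" unfolding e_def by (rule derivative_remainder_bound[OF h(1) h(5)]) simp
    have "8 * t\<^sup>2 = 8 * (T i y)\<^sup>2 / var0" by (simp add: t_def power_divide \<sigma>(2))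
    also have "\<dots> \<le> 8 * (4 ^ k0 * ?N) / var0"
      using T2[OF J, of i] v by (intro divide_right_mono mult_left_mono) auto
    finally have e': "\<bar>e\<bar> \<le> 8 * (4 ^ k0 * ?N) / var0" using e by simp
    have "a1 i y - a2 i y = h' ?x * ((1 / mean0 - 1 / var0) - (T i y - 1) / var0) - e / \<sigma>"
    proof -
      have "a2 i y = (1 / \<sigma>) * (t * h' ?x + e)"
        unfolding a2_def H_def \<open>X (counts y {1..k0 + i}) = ?x + t\<close> e_def by simp
      also have "\<dots> = h' ?x * (T i y / var0) + e / \<sigma>"
        unfolding t_def \<sigma>(2)[symmetric] by (simp add: power2_eq_square add_divide_distrib mult.commute)
      finally show ?thesis unfolding a1_def H'_def by (simp add: algebra_simps diff_divide_distrib)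
    qed
    also have "\<bar>\<dots>\<bar> \<le> \<bar>h' ?x\<bar> * \<bar>(1 / mean0 - 1 / var0) - (T i y - 1) / var0\<bar> + \<bar>e\<bar> / \<sigma>"
      using abs_triangle_ineq4[of "h' ?x * ((1 / mean0 - 1 / var0) - (T i y - 1) / var0)" "e / \<sigma>"] \<sigma>(1)
      by (simp add: abs_mult abs_divide)
    also have "\<dots> \<le> 4 * ((1 / mean0 - 1 / var0) + (?K * ?N - ?K) / var0) + (8 * (4 ^ k0 * ?N) / var0) / \<sigma>"
    proof (intro add_mono mult_mono divide_right_mono e')
      have "0 \<le> 1 / mean0 - 1 / var0" using pos le by (simp add: frac_le)
      moreover have "\<bar>(T i y - 1) / var0\<bar> \<le> (?K * ?N - ?K) / var0"
        using T1[OF J, of i] v by (simp add: abs_divide divide_right_mono)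
      ultimately show "\<bar>(1 / mean0 - 1 / var0) - (T i y - 1) / var0\<bar> \<le> (1 / mean0 - 1 / var0) + (?K * ?N - ?K) / var0"
        using abs_triangle_ineq4[of "1 / mean0 - 1 / var0" "(T i y - 1) / var0"] by simp
    qed (use h(4) \<sigma>(1) in auto)
    also have "\<dots> = \<alpha> * ?N + \<beta>"
      unfolding \<alpha>_def \<beta>_def by (simp add: algebra_simps diff_divide_distrib add_divide_distrib)
    finally show "\<bar>a1 i y - a2 i y\<bar> \<le> \<alpha> * ?N + \<beta>" .
  qed
  also have "\<dots> \<le> \<alpha> * (mean0 * (1 + excess)) + \<beta> * mean0"
    using A.palm_near v \<sigma>(1) unfolding mu A.\<delta>_def excess_def
    by (intro add_right_mono mult_left_mono) (auto simp: \<alpha>_def)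
  also have "\<dots> = 4 * ((var0 - mean0) / var0) + 4 * ?K * excess * (mean0 / var0) + 8 * 4 ^ k0 * (1 + excess) / \<sigma> * (mean0 / var0)"
    unfolding \<alpha>_def \<beta>_def using pos v \<sigma>(1) by (simp add: field_simps)
  also have "\<dots> \<le> 4 * (?K * excess) + 4 * ?K * excess * 1 + 8 * 4 ^ k0 * (1 + excess) / \<sigma> * 1"
  proof (intro add_mono mult_left_mono)
    have ratio: "mean0 / var0 \<le> 1" using le v by simp
    show "(var0 - mean0) / var0 \<le> ?K * excess"
    proof -
      have "?K * mean0 * excess \<le> ?K * var0 * excess" using le ex0 by (intro mult_right_mono mult_left_mono) auto
      then have "var0 - mean0 \<le> (?K * excess) * var0" using var_le by (simp add: mult.commute mult.left_commute)
      then show ?thesis using v by (simp add: pos_divide_le_eq)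
    qed
    show "mean0 / var0 \<le> 1" "mean0 / var0 \<le> 1" by (rule ratio)+
  qed (use ex0 \<sigma>(1) in auto)
  finally show "\<bar>expect (\<lambda>i y. \<phi> ((real (snd (counts y {1..i})) - mean0) / sqrt var0)) - ?m\<bar>
      \<le> 8 * 2 ^ k0 * excess + 8 * 4 ^ k0 * (1 + excess) / sqrt var0"
    unfolding eq[symmetric] by (simp add: X_def w_def \<sigma>_def ac_simps)
qed

end

section \<open>Scaling limit of the probability of a copy\<close>

lemma nn_integral_lborel_rescale:
  fixes g :: "'a::euclidean_space \<Rightarrow> ennreal"
  assumes g: "g \<in> borel_measurable borel" and t: "0 < t"
  shows "(\<integral>\<^sup>+u. ennreal (t ^ DIM('a)) * g (x + t *\<^sub>R u) \<partial>lborel) = (\<integral>\<^sup>+z. g z \<partial>lborel)"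
proof -
  have m: "(\<lambda>u::'a. x + t *\<^sub>R u) \<in> borel_measurable borel" by measurable
  have "(\<integral>\<^sup>+z. g z \<partial>lborel)
    = (\<integral>\<^sup>+z. g z \<partial>density (distr lborel borel (\<lambda>u. x + t *\<^sub>R u)) (\<lambda>_. \<bar>t\<bar> ^ DIM('a)))"
    using t by (subst lborel_affine[of t x]) auto
  also have "\<dots> = (\<integral>\<^sup>+z. ennreal (\<bar>t\<bar> ^ DIM('a)) * g z \<partial>distr lborel borel (\<lambda>u. x + t *\<^sub>R u))"
    using g by (intro nn_integral_density) auto
  also have "\<dots> = (\<integral>\<^sup>+u. ennreal (t ^ DIM('a)) * g (x + t *\<^sub>R u) \<partial>lborel)"
    using g t m by (subst nn_integral_distr) auto
  finally show ?thesis ..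
qed

text \<open>
  The linear change of variables in every coordinate. The product measure is identified through its values
  on boxes, so that no Jacobian on the product space is needed.
\<close>

lemma nn_integral_PiM_density_rescale:
  fixes f :: "'a::euclidean_space \<Rightarrow> real" and x :: 'a
  assumes f: "f \<in> borel_measurable borel" "\<And>z. 0 \<le> f z" and D: "prob_space (density lborel f)"
    and t: "0 < t" and I: "finite (I :: 'i set)"
    and F: "F \<in> borel_measurable (PiM I (\<lambda>_. density lborel f))"
  shows "(\<integral>\<^sup>+z. F z \<partial>PiM I (\<lambda>_. density lborel f))
    = ennreal (t ^ (DIM('a) * card I)) *
      (\<integral>\<^sup>+u. ennreal (\<Prod>i\<in>I. f (x + t *\<^sub>R u i)) * F (\<lambda>i\<in>I. x + t *\<^sub>R u i) \<partial>PiM I (\<lambda>_. lborel))"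
proof -
  let ?D = "density lborel f"
  interpret D: prob_space ?D by (rule D)
  interpret PD: product_sigma_finite "\<lambda>_. ?D" by unfold_locales
  interpret PL: product_sigma_finite "\<lambda>_. lborel :: 'a measure" by unfold_locales
  define w where "w u = (\<Prod>i\<in>I. ennreal (t ^ DIM('a)) * ennreal (f (x + t *\<^sub>R u i)))" for u
  define S where "S u = (\<lambda>i\<in>I. x + t *\<^sub>R u i)" for u
  have comp: "(\<lambda>u. x + t *\<^sub>R u i) \<in> borel_measurable (PiM I (\<lambda>_. lborel))" if "i \<in> I" for i
    using measurable_compose[OF measurable_component_singleton[OF that, of "\<lambda>_. lborel :: 'a measure"], of "\<lambda>z. x + t *\<^sub>R z" borel]
    by simp
  have w: "w \<in> borel_measurable (PiM I (\<lambda>_. lborel))"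
    unfolding w_def[abs_def]
    by (intro borel_measurable_prod_ennreal borel_measurable_times_ennreal borel_measurable_const
        measurable_compose[OF comp] measurable_compose[OF f(1) measurable_ennreal])
  have S: "S \<in> measurable (PiM I (\<lambda>_. lborel)) (PiM I (\<lambda>_. ?D))"
    unfolding S_def[abs_def] using comp by (intro measurable_restrict) (simp add: measurable_def)
  have "distr (density (PiM I (\<lambda>_. lborel)) w) (PiM I (\<lambda>_. ?D)) S = PiM I (\<lambda>_. ?D)"
  proof (rule PD.PiM_eqI[OF I])
    fix A :: "'i \<Rightarrow> 'a set" assume A: "\<And>i. i \<in> I \<Longrightarrow> A i \<in> sets ?D"
    have box: "Pi\<^sub>E I A \<in> sets (PiM I (\<lambda>_. ?D))" using A I by (intro sets_PiM_I_finite) auto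
    have S': "S \<in> measurable (density (PiM I (\<lambda>_. lborel)) w) (PiM I (\<lambda>_. ?D))" using S by simp
    have "emeasure (distr (density (PiM I (\<lambda>_. lborel)) w) (PiM I (\<lambda>_. ?D)) S) (Pi\<^sub>E I A)
      = (\<integral>\<^sup>+u. w u * indicator (Pi\<^sub>E I A) (S u) \<partial>PiM I (\<lambda>_. lborel))"
      using box measurable_sets[OF S box] w
      by (simp add: emeasure_distr[OF S' box] emeasure_density)
        (auto intro!: nn_integral_cong simp: indicator_def)
    also have "\<dots> = (\<integral>\<^sup>+u. (\<Prod>i\<in>I. ennreal (t ^ DIM('a)) * (ennreal (f (x + t *\<^sub>R u i)) * indicator (A i) (x + t *\<^sub>R u i)))
        \<partial>PiM I (\<lambda>_. lborel))"
    proof (intro nn_integral_cong)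
      fix u
      have "indicator (Pi\<^sub>E I A) (S u) = (\<Prod>i\<in>I. indicator (A i) (x + t *\<^sub>R u i) :: ennreal)"
      proof -
        have iff: "S u \<in> Pi\<^sub>E I A \<longleftrightarrow> (\<forall>i\<in>I. x + t *\<^sub>R u i \<in> A i)" by (auto simp: S_def PiE_iff)
        show ?thesis
        proof (cases "\<forall>i\<in>I. x + t *\<^sub>R u i \<in> A i")
          case False
          then have "(\<Prod>i\<in>I. indicator (A i) (x + t *\<^sub>R u i) :: ennreal) = 0"
            by (intro prod_zero I) (auto simp: indicator_def)
          then show ?thesis using False iff by (simp add: indicator_def)
        qed (simp add: iff indicator_def)
      qed
      then show "w u * indicator (Pi\<^sub>E I A) (S u) = (\<Prod>i\<in>I. ennreal (t ^ DIM('a)) * (ennreal (f (x + t *\<^sub>R u i)) * indicator (A i) (x + t *\<^sub>R u i)))"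
        unfolding w_def by (simp add: prod.distrib[symmetric] mult.assoc)
    qed
    also have "\<dots> = (\<Prod>i\<in>I. \<integral>\<^sup>+z. ennreal (t ^ DIM('a)) * (ennreal (f (x + t *\<^sub>R z)) * indicator (A i) (x + t *\<^sub>R z)) \<partial>lborel)"
    proof (rule PL.product_nn_integral_prod[OF I])
      fix i assume "i \<in> I"
      then have [measurable]: "A i \<in> sets borel" using A by simp
      note f(1)[measurable]
      show "(\<lambda>z. ennreal (t ^ DIM('a)) * (ennreal (f (x + t *\<^sub>R z)) * indicator (A i) (x + t *\<^sub>R z))) \<in> borel_measurable lborel"
        by measurable
    qed
    also have "\<dots> = (\<Prod>i\<in>I. emeasure ?D (A i))"
    proof (intro prod.cong refl)
      fix i assume "i \<in> I"
      then have Ai[measurable]: "A i \<in> sets borel" using A by simp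
      note f(1)[measurable]
      have "(\<integral>\<^sup>+z. ennreal (t ^ DIM('a)) * (ennreal (f (x + t *\<^sub>R z)) * indicator (A i) (x + t *\<^sub>R z)) \<partial>lborel)
        = (\<integral>\<^sup>+z. ennreal (f z) * indicator (A i) z \<partial>lborel)"
        by (rule nn_integral_lborel_rescale[OF _ t]) measurable
      then show "(\<integral>\<^sup>+z. ennreal (t ^ DIM('a)) * (ennreal (f (x + t *\<^sub>R z)) * indicator (A i) (x + t *\<^sub>R z)) \<partial>lborel) = emeasure ?D (A i)"
        using Ai f(1) by (simp add: emeasure_density)
    qed
    finally show "emeasure (distr (density (PiM I (\<lambda>_. lborel)) w) (PiM I (\<lambda>_. ?D)) S) (Pi\<^sub>E I A) = (\<Prod>i\<in>I. emeasure ?D (A i))" .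
  qed simp
  then have "(\<integral>\<^sup>+z. F z \<partial>PiM I (\<lambda>_. ?D)) = (\<integral>\<^sup>+z. F z \<partial>distr (density (PiM I (\<lambda>_. lborel)) w) (PiM I (\<lambda>_. ?D)) S)"
    by simp
  also have "\<dots> = (\<integral>\<^sup>+u. F (S u) \<partial>density (PiM I (\<lambda>_. lborel)) w)"
    using S F by (intro nn_integral_distr) auto
  also have "\<dots> = (\<integral>\<^sup>+u. w u * F (S u) \<partial>PiM I (\<lambda>_. lborel))"
    using measurable_compose[OF S F] w by (intro nn_integral_density) auto
  also have "\<dots> = (\<integral>\<^sup>+u. ennreal (t ^ (DIM('a) * card I)) * (ennreal (\<Prod>i\<in>I. f (x + t *\<^sub>R u i)) * F (S u)) \<partial>PiM I (\<lambda>_. lborel))"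
  proof (intro nn_integral_cong)
    fix u
    have "w u = ennreal (t ^ DIM('a)) ^ card I * ennreal (\<Prod>i\<in>I. f (x + t *\<^sub>R u i))"
      unfolding w_def using f(2) by (simp add: prod.distrib prod_ennreal)
    also have "ennreal (t ^ DIM('a)) ^ card I = ennreal (t ^ (DIM('a) * card I))"
      using t by (simp add: ennreal_power power_mult)
    finally show "w u * F (S u) = ennreal (t ^ (DIM('a) * card I)) * (ennreal (\<Prod>i\<in>I. f (x + t *\<^sub>R u i)) * F (S u))"
      by (simp add: mult.assoc)
  qed
  also have "\<dots> = ennreal (t ^ (DIM('a) * card I)) * (\<integral>\<^sup>+u. ennreal (\<Prod>i\<in>I. f (x + t *\<^sub>R u i)) * F (S u) \<partial>PiM I (\<lambda>_. lborel))"
  proof (rule nn_integral_cmult)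
    have "(\<lambda>u. ennreal (\<Prod>i\<in>I. f (x + t *\<^sub>R u i))) \<in> borel_measurable (PiM I (\<lambda>_. lborel))"
      by (intro measurable_compose[OF _ measurable_ennreal] borel_measurable_prod measurable_compose[OF comp f(1)])
    then show "(\<lambda>u. ennreal (\<Prod>i\<in>I. f (x + t *\<^sub>R u i)) * F (S u)) \<in> borel_measurable (PiM I (\<lambda>_. lborel))"
      using measurable_compose[OF S F] by (intro borel_measurable_times_ennreal)
  qed
  finally show ?thesis unfolding S_def .
qed

text \<open>
  Placing the first point at \<open>x\<close> and writing the others as \<open>x + t u\<close>, the event that a copy is formed no
  longer depends on \<open>x\<close> and \<open>t\<close>, and the densities converge to \<open>f x\<close> by continuity. Connectedness confines
  \<open>u\<close> to a bounded set, which provides the dominating function. The limit is the integral of \<open>f ^ p\<close>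
  times the volume \<open>V\<close> of the configurations \<open>u\<close>; this volume is positive since otherwise no radius at all
  would give a copy with positive probability.
\<close>

lemma copy_probability_scaling:
  fixes f :: "'a::euclidean_space \<Rightarrow> real" and t :: "nat \<Rightarrow> real" and \<Gamma> :: "'v pair_pre_digraph"
  assumes f: "continuous_on UNIV f" "\<And>z. 0 \<le> f z" "\<And>z. f z \<le> B" and D: "prob_space (density lborel f)"
    and G: "pair_graph \<Gamma>" "Digraph_Component.connected (with_proj \<Gamma>)" "card (pverts \<Gamma>) = p" "1 \<le> p"
    and t: "\<And>n. 0 < t n" "t \<longlonglongrightarrow> 0"
    and feas: "0 < measure (PiM {1..p} (\<lambda>_. density lborel f))
       {z \<in> space (PiM {1..p} (\<lambda>_. density lborel f)). forms_copy (t 0) \<Gamma> z {1..p}}"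
  obtains L where "0 < L" "(\<lambda>n. measure (PiM {1..p} (\<lambda>_. density lborel f))
       {z \<in> space (PiM {1..p} (\<lambda>_. density lborel f)). forms_copy (t n) \<Gamma> z {1..p}}
       / t n ^ (DIM('a) * (p - 1))) \<longlonglongrightarrow> L"
proof -
  let ?D = "density lborel f" and ?I = "{2..p}"
  interpret D: prob_space ?D by (rule D)
  interpret PD: product_sigma_finite "\<lambda>_. ?D" by unfold_locales
  interpret PL: product_sigma_finite "\<lambda>_. lborel :: 'a measure" by unfold_locales
  interpret P: prob_space "PiM {1..p} (\<lambda>_. ?D)" by (rule prob_space_PiM) (rule D)
  let ?L = "PiM ?I (\<lambda>_. lborel :: 'a measure)"
  interpret L: sigma_finite_measure ?L by (rule PL.sigma_finite) simp
  have fm: "f \<in> borel_measurable borel" by (rule borel_measurable_continuous_onI[OF f(1)])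
  have B: "0 \<le> B" using f(2,3) order_trans by blast
  have fin: "finite (pverts \<Gamma>)"
    using G(1) by (simp add: pair_graph_def pair_digraph_def pair_fin_digraph_def pair_fin_digraph_axioms_def)
  have I: "{1..p} = insert 1 ?I" "1 \<notin> ?I" "card ?I = p - 1" using G(4) by auto
  \<comment> \<open>The rescaled configurations of radius \<open>1\<close>, with the first point moved to the origin.\<close>
  define S where "S u = (indicator {u. forms_copy 1 \<Gamma> (u(1 := 0)) {1..p}} u :: ennreal)" for u :: "nat \<Rightarrow> 'a"
  have zero_upd: "(\<lambda>u. u(1 := (0::'a))) \<in> measurable ?L (PiM {1..p} (\<lambda>_. lborel))"
    unfolding I(1) by (intro measurable_fun_upd[where J = ?I]) auto
  have S_meas: "S \<in> borel_measurable ?L"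
  proof -
    have "{z \<in> space (PiM {1..p} (\<lambda>_. lborel :: 'a measure)). forms_copy 1 \<Gamma> z {1..p}} \<in> sets (PiM {1..p} (\<lambda>_. lborel))"
      by (rule forms_copy_measurable) (use fin in auto)
    from measurable_sets[OF zero_upd this]
    have "{u \<in> space ?L. forms_copy 1 \<Gamma> (u(1 := 0)) {1..p}} \<in> sets ?L"
      using measurable_space[OF zero_upd] by (simp add: vimage_def Int_def conj_commute cong: conj_cong)
    also have "{u \<in> space ?L. forms_copy 1 \<Gamma> (u(1 := 0)) {1..p}}
        = {u. forms_copy 1 \<Gamma> (u(1 := 0)) {1..p}} \<inter> space ?L" by blast
    finally show ?thesis unfolding S_def borel_measurable_indicator_iff .
  qed
  have scale: "forms_copy s \<Gamma> ((\<lambda>i\<in>?I. x + s *\<^sub>R u i)(1 := x)) {1..p} \<longleftrightarrow> forms_copy 1 \<Gamma> (u(1 := 0)) {1..p}"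
    if "0 < s" for s x and u :: "nat \<Rightarrow> 'a"
  proof -
    have "forms_copy s \<Gamma> ((\<lambda>i\<in>?I. x + s *\<^sub>R u i)(1 := x)) {1..p}
        \<longleftrightarrow> forms_copy s \<Gamma> (\<lambda>i. x + s *\<^sub>R (u(1 := 0)) i) {1..p}"
      by (rule forms_copy_cong) auto
    then show ?thesis using forms_copy_affine[OF that] by blast
  qed
  define g where "g s x u = ennreal (\<Prod>i\<in>?I. f (x + s *\<^sub>R u i)) * S u" for s x u
  have g_meas: "(\<lambda>(x, u). g s x u) \<in> borel_measurable (borel \<Otimes>\<^sub>M ?L)" for s
  proof -
    have c: "(\<lambda>v. fst v + s *\<^sub>R snd v i) \<in> borel_measurable (borel \<Otimes>\<^sub>M ?L)" if "i \<in> ?I" for i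
    proof -
      have "(\<lambda>v :: 'a \<times> (nat \<Rightarrow> 'a). snd v i) \<in> measurable (borel \<Otimes>\<^sub>M ?L) lborel"
        by (rule measurable_compose[OF measurable_snd measurable_component_singleton[OF that]])
      then have "(\<lambda>v :: 'a \<times> (nat \<Rightarrow> 'a). snd v i) \<in> borel_measurable (borel \<Otimes>\<^sub>M ?L)" by simp
      then show ?thesis by (intro borel_measurable_add borel_measurable_scaleR borel_measurable_const measurable_fst)
    qed
    show ?thesis unfolding g_def case_prod_unfold
      by (intro borel_measurable_times_ennreal measurable_compose[OF _ measurable_ennreal] borel_measurable_prod
          measurable_compose[OF c fm] measurable_compose[OF measurable_snd S_meas])
  qed
  have g_meas': "(\<lambda>u. g s x u) \<in> borel_measurable ?L" for s x
    using measurable_compose[OF measurable_Pair1'[of x borel ?L] g_meas] by simp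
  have prob: "emeasure (PiM {1..p} (\<lambda>_. ?D)) {z \<in> space (PiM {1..p} (\<lambda>_. ?D)). forms_copy s \<Gamma> z {1..p}}
      = ennreal (s ^ (DIM('a) * (p - 1))) * (\<integral>\<^sup>+x. ennreal (f x) * (\<integral>\<^sup>+u. g s x u \<partial>?L) \<partial>lborel)" if s: "0 < s" for s
  proof -
    define F where "F z = (indicator {z. forms_copy s \<Gamma> z {1..p}} z :: ennreal)" for z :: "nat \<Rightarrow> 'a"
    have meas: "{z \<in> space (PiM {1..p} (\<lambda>_. ?D)). forms_copy s \<Gamma> z {1..p}} \<in> sets (PiM {1..p} (\<lambda>_. ?D))"
      by (rule forms_copy_measurable) (use fin in auto)
    have F: "F \<in> borel_measurable (PiM {1..p} (\<lambda>_. ?D))"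
      unfolding F_def borel_measurable_indicator_iff using meas by (simp only: Int_def mem_Collect_eq conj_commute)
    have "emeasure (PiM {1..p} (\<lambda>_. ?D)) {z \<in> space (PiM {1..p} (\<lambda>_. ?D)). forms_copy s \<Gamma> z {1..p}}
        = (\<integral>\<^sup>+z. F z \<partial>PiM {1..p} (\<lambda>_. ?D))"
      unfolding nn_integral_indicator[OF meas, symmetric] by (intro nn_integral_cong) (auto simp: F_def indicator_def)
    also have "\<dots> = (\<integral>\<^sup>+x. (\<integral>\<^sup>+z. F (z(1 := x)) \<partial>PiM ?I (\<lambda>_. ?D)) \<partial>?D)"
      unfolding I(1) by (rule PD.product_nn_integral_insert_rev) (use I F in auto)
    also have "\<dots> = (\<integral>\<^sup>+x. ennreal (s ^ (DIM('a) * (p - 1))) * (\<integral>\<^sup>+u. g s x u \<partial>?L) \<partial>?D)"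
    proof (intro nn_integral_cong)
      fix x :: 'a
      have Fx: "(\<lambda>z. F (z(1 := x))) \<in> borel_measurable (PiM ?I (\<lambda>_. ?D))"
      proof -
        have "(\<lambda>z. z(1 := x)) \<in> measurable (PiM ?I (\<lambda>_. ?D)) (PiM {1..p} (\<lambda>_. ?D))"
          unfolding I(1) by (intro measurable_fun_upd[where J = ?I]) auto
        from measurable_compose[OF this F] show ?thesis .
      qed
      have "(\<integral>\<^sup>+z. F (z(1 := x)) \<partial>PiM ?I (\<lambda>_. ?D)) = ennreal (s ^ (DIM('a) * (p - 1))) *
        (\<integral>\<^sup>+u. ennreal (\<Prod>i\<in>?I. f (x + s *\<^sub>R u i)) * F ((\<lambda>i\<in>?I. x + s *\<^sub>R u i)(1 := x)) \<partial>?L)"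
        using nn_integral_PiM_density_rescale[OF fm f(2) D s _ Fx, of x] I(3) by simp
      also have "(\<lambda>u. F ((\<lambda>i\<in>?I. x + s *\<^sub>R u i)(1 := x))) = S"
        unfolding F_def S_def indicator_def mem_Collect_eq scale[OF s] ..
      finally show "(\<integral>\<^sup>+z. F (z(1 := x)) \<partial>PiM ?I (\<lambda>_. ?D))
        = ennreal (s ^ (DIM('a) * (p - 1))) * (\<integral>\<^sup>+u. g s x u \<partial>?L)"
        unfolding g_def .
    qed
    also have "\<dots> = ennreal (s ^ (DIM('a) * (p - 1))) * (\<integral>\<^sup>+x. (\<integral>\<^sup>+u. g s x u \<partial>?L) \<partial>?D)"
      using L.borel_measurable_nn_integral[OF g_meas] by (intro nn_integral_cmult) simp
    also have "(\<integral>\<^sup>+x. (\<integral>\<^sup>+u. g s x u \<partial>?L) \<partial>?D) = (\<integral>\<^sup>+x. ennreal (f x) * (\<integral>\<^sup>+u. g s x u \<partial>?L) \<partial>lborel)"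
      using L.borel_measurable_nn_integral[OF g_meas] fm by (intro nn_integral_density) auto
    finally show ?thesis .
  qed
  define V where "V = (\<integral>\<^sup>+u. S u \<partial>?L)"
  \<comment> \<open>A connected copy of order \<open>p\<close> with edges shorter than \<open>1\<close> that contains the origin lies in the ball of radius \<open>p\<close>.\<close>
  have V_fin: "V < \<infinity>"
  proof -
    have "V \<le> (\<integral>\<^sup>+u. (\<Prod>i\<in>?I. indicator (cball 0 (real p)) (u i)) \<partial>?L)"
      unfolding V_def
    proof (intro nn_integral_mono)
      fix u
      show "S u \<le> (\<Prod>i\<in>?I. indicator (cball 0 (real p)) (u i))"
      proof (cases "forms_copy 1 \<Gamma> (u(1 := 0)) {1..p}")
        case True
        have "u i \<in> cball 0 (real p)" if "i \<in> ?I" for i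
          using forms_copy_dist[OF G(1,2) True, of i 1] that G(3,4) by auto
        then show ?thesis by (simp add: S_def indicator_def)
      qed (simp add: S_def)
    qed
    also have "\<dots> = (\<Prod>i\<in>?I. \<integral>\<^sup>+z. indicator (cball 0 (real p)) z \<partial>(lborel :: 'a measure))"
      by (rule PL.product_nn_integral_prod) (simp_all add: borel_measurable_indicator_iff)
    also have "\<dots> = emeasure lborel (cball (0::'a) (real p)) ^ card ?I" by simp
    also have "\<dots> < \<infinity>"
      using emeasure_bounded_finite[OF bounded_cball, of "0::'a" "real p"] by (simp add: power_less_top_ennreal)
    finally show ?thesis .
  qed
  have prod_le: "(\<Prod>i\<in>?I. f (x + s *\<^sub>R u i)) \<le> B ^ (p - 1)" for x s and u :: "nat \<Rightarrow> 'a"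
    using prod_mono[of ?I "\<lambda>i. f (x + s *\<^sub>R u i)" "\<lambda>_. B"] f I(3) by simp
  have g_le: "g s x u \<le> ennreal (B ^ (p - 1)) * S u" for s x u
    unfolding g_def by (intro mult_right_mono ennreal_leI prod_le) auto
  have inner: "(\<lambda>n. \<integral>\<^sup>+u. g (t n) x u \<partial>?L) \<longlonglongrightarrow> ennreal (f x ^ (p - 1)) * V" for x
  proof -
    have "(\<lambda>n. \<integral>\<^sup>+u. g (t n) x u \<partial>?L) \<longlonglongrightarrow> (\<integral>\<^sup>+u. ennreal (f x ^ (p - 1)) * S u \<partial>?L)"
    proof (rule nn_integral_dominated_convergence[where w = "\<lambda>u. ennreal (B ^ (p - 1)) * S u"])
      show "(\<integral>\<^sup>+u. ennreal (B ^ (p - 1)) * S u \<partial>?L) < \<infinity>"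
        using V_fin S_meas by (simp add: nn_integral_cmult V_def[symmetric] ennreal_mult_less_top)
      show "AE u in ?L. (\<lambda>n. g (t n) x u) \<longlonglongrightarrow> ennreal (f x ^ (p - 1)) * S u"
      proof (rule AE_I2)
        fix u :: "nat \<Rightarrow> 'a"
        have "(\<lambda>n. x + t n *\<^sub>R u i) \<longlonglongrightarrow> x + 0 *\<^sub>R u i" for i by (intro tendsto_intros t)
        then have "(\<lambda>n. f (x + t n *\<^sub>R u i)) \<longlonglongrightarrow> f x" for i
          using continuous_on_tendsto_compose[OF f(1), of "\<lambda>n. x + t n *\<^sub>R u i" x sequentially] by simp
        then have "(\<lambda>n. \<Prod>i\<in>?I. f (x + t n *\<^sub>R u i)) \<longlonglongrightarrow> (\<Prod>i\<in>?I. f x)" by (intro tendsto_prod)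
        then have "(\<lambda>n. ennreal (\<Prod>i\<in>?I. f (x + t n *\<^sub>R u i))) \<longlonglongrightarrow> ennreal (f x ^ (p - 1))"
          using I(3) by (intro tendsto_ennrealI) simp
        then show "(\<lambda>n. g (t n) x u) \<longlonglongrightarrow> ennreal (f x ^ (p - 1)) * S u"
          unfolding g_def S_def indicator_def by (cases "forms_copy 1 \<Gamma> (u(1 := 0)) {1..p}") auto
      qed
    qed (use g_meas' S_meas g_le in auto)
    then show ?thesis using S_meas by (simp add: nn_integral_cmult V_def)
  qed
  have Gm: "(\<lambda>x. \<integral>\<^sup>+u. g s x u \<partial>?L) \<in> borel_measurable borel" for s
    by (rule L.borel_measurable_nn_integral[OF g_meas])
  have f1: "(\<integral>\<^sup>+x. ennreal (f x) \<partial>lborel) = 1"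
    using D.emeasure_space_1 fm by (simp add: emeasure_density)
  define R where "R n = (\<integral>\<^sup>+x. ennreal (f x) * (\<integral>\<^sup>+u. g (t n) x u \<partial>?L) \<partial>lborel)" for n
  define L where "L = (\<integral>\<^sup>+x. ennreal (f x ^ p) * V \<partial>lborel)"
  have G_le: "(\<integral>\<^sup>+u. g s x u \<partial>?L) \<le> ennreal (B ^ (p - 1)) * V" for s x
    using nn_integral_mono[of ?L "g s x" "\<lambda>u. ennreal (B ^ (p - 1)) * S u"] g_le S_meas
    by (simp add: nn_integral_cmult V_def)
  have fp: "f x ^ p = f x * f x ^ (p - 1)" for x using G(4) by (cases p) auto
  have R_lim: "R \<longlonglongrightarrow> L" unfolding R_def L_def
  proof (rule nn_integral_dominated_convergence[where w = "\<lambda>x. ennreal (f x) * (ennreal (B ^ (p - 1)) * V)"])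
    show "(\<integral>\<^sup>+x. ennreal (f x) * (ennreal (B ^ (p - 1)) * V) \<partial>lborel) < \<infinity>"
      using V_fin fm by (simp add: nn_integral_multc f1 ennreal_mult_less_top)
    show "AE x in lborel. (\<lambda>n. ennreal (f x) * (\<integral>\<^sup>+u. g (t n) x u \<partial>?L)) \<longlonglongrightarrow> ennreal (f x ^ p) * V"
    proof (rule AE_I2)
      fix x
      have "(\<lambda>n. ennreal (f x) * (\<integral>\<^sup>+u. g (t n) x u \<partial>?L)) \<longlonglongrightarrow> ennreal (f x) * (ennreal (f x ^ (p - 1)) * V)"
        by (rule ennreal_tendsto_cmult[OF _ inner]) simp
      then show "(\<lambda>n. ennreal (f x) * (\<integral>\<^sup>+u. g (t n) x u \<partial>?L)) \<longlonglongrightarrow> ennreal (f x ^ p) * V"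
        using f(2) by (simp add: fp ennreal_mult mult.assoc)
    qed
  qed (use fm Gm G_le in \<open>auto intro!: mult_left_mono\<close>)
  have L_fin: "L < \<infinity>"
  proof -
    have "L \<le> (\<integral>\<^sup>+x. ennreal (f x) * (ennreal (B ^ (p - 1)) * V) \<partial>lborel)" unfolding L_def
      using f B by (intro nn_integral_mono)
        (auto simp: fp ennreal_mult mult.assoc intro!: mult_left_mono mult_right_mono ennreal_leI power_mono)
    also have "\<dots> < \<infinity>" using V_fin fm by (simp add: nn_integral_multc f1 ennreal_mult_less_top)
    finally show ?thesis .
  qed
  have "0 < V"
  proof (rule ccontr)
    assume "\<not> 0 < V"
    then have "(\<integral>\<^sup>+u. g s x u \<partial>?L) = 0" for s x using G_le[of s x] by simp
    then have "emeasure (PiM {1..p} (\<lambda>_. ?D)) {z \<in> space (PiM {1..p} (\<lambda>_. ?D)). forms_copy (t 0) \<Gamma> z {1..p}} = 0"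
      using prob[OF t(1), of 0] by simp
    then show False using feas by (simp add: measure_def)
  qed
  have "0 < L"
  proof (rule ccontr)
    assume "\<not> 0 < L"
    then have "AE x in lborel. ennreal (f x ^ p) * V = 0"
      using fm unfolding L_def by (subst (asm) not_gr_zero, subst (asm) nn_integral_0_iff_AE) auto
    then have "AE x in lborel. ennreal (f x) = 0"
      using \<open>0 < V\<close> f(2) by (auto elim!: eventually_mono simp: ennreal_eq_0_iff)
        (metis less_irrefl not_less order_antisym zero_less_power)
    then have "(\<integral>\<^sup>+x. ennreal (f x) \<partial>lborel) = 0" by (subst nn_integral_0_iff_AE) (use fm in auto)
    then show False using f1 by simp
  qed
  show thesis
  proof (rule that)
    show "0 < enn2real L" using \<open>0 < L\<close> L_fin by (simp add: enn2real_positive_iff)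
    have "measure (PiM {1..p} (\<lambda>_. ?D)) {z \<in> space (PiM {1..p} (\<lambda>_. ?D)). forms_copy (t n) \<Gamma> z {1..p}}
        / t n ^ (DIM('a) * (p - 1)) = enn2real (R n)" for n
      unfolding measure_def prob[OF t(1)] R_def[symmetric] using t(1)[of n] by (simp add: enn2real_mult)
    then show "(\<lambda>n. measure (PiM {1..p} (\<lambda>_. ?D)) {z \<in> space (PiM {1..p} (\<lambda>_. ?D)). forms_copy (t n) \<Gamma> z {1..p}}
        / t n ^ (DIM('a) * (p - 1))) \<longlonglongrightarrow> enn2real L"
      using tendsto_enn2real[of R "enn2real L" sequentially] R_lim L_fin by (simp add: ennreal_enn2real)
  qed
qed

section \<open>Limit laws and classes of test functions\<close>

lemma indep_rv_distr:
  assumes M: "prob_space M" and i: "indep_rv M MA A MB B"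
  shows "distr M (MA \<Otimes>\<^sub>M MB) (\<lambda>\<omega>. (A \<omega>, B \<omega>)) = distr M MA A \<Otimes>\<^sub>M distr M MB B"
proof -
  interpret prob_space M by (rule M)
  have mA: "A \<in> measurable M MA" and mB: "B \<in> measurable M MB"
    and ind: "indep_set {A -` S \<inter> space M | S. S \<in> sets MA} {B -` S \<inter> space M | S. S \<in> sets MB}"
    using i unfolding indep_rv_def by auto
  interpret DA: prob_space "distr M MA A" by (rule prob_space_distr[OF mA])
  interpret DB: prob_space "distr M MB B" by (rule prob_space_distr[OF mB])
  show ?thesis
  proof (rule pair_measure_eqI[symmetric])
    show "sigma_finite_measure (distr M MA A)" "sigma_finite_measure (distr M MB B)" by unfold_locales
    show "sets (distr M MA A \<Otimes>\<^sub>M distr M MB B) = sets (distr M (MA \<Otimes>\<^sub>M MB) (\<lambda>\<omega>. (A \<omega>, B \<omega>)))"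
      by (simp cong: sets_pair_measure_cong)
    fix S T assume "S \<in> sets (distr M MA A)" "T \<in> sets (distr M MB B)"
    then have S: "S \<in> sets MA" and T: "T \<in> sets MB" by auto
    have "(\<lambda>\<omega>. (A \<omega>, B \<omega>)) -` (S \<times> T) \<inter> space M = (A -` S \<inter> space M) \<inter> (B -` T \<inter> space M)" by auto
    moreover have "prob ((A -` S \<inter> space M) \<inter> (B -` T \<inter> space M)) = prob (A -` S \<inter> space M) * prob (B -` T \<inter> space M)"
      using ind S T unfolding indep_sets2_eq by blast
    ultimately show "emeasure (distr M MA A) S * emeasure (distr M MB B) T
        = emeasure (distr M (MA \<Otimes>\<^sub>M MB) (\<lambda>\<omega>. (A \<omega>, B \<omega>))) (S \<times> T)"
      using S T mA mB
      by (simp add: emeasure_distr measurable_Pair emeasure_eq_measure ennreal_mult[symmetric])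
  qed
qed

lemma sections_measurable:
  fixes h :: "'c::countable \<times> 'b \<Rightarrow> real"
  assumes "\<And>v. (\<lambda>x. h (v, x)) \<in> borel_measurable N"
  shows "h \<in> borel_measurable (count_space UNIV \<Otimes>\<^sub>M N)"
  using measurable_pair_measure_countable1[of UNIV h N borel] assms by simp

lemma indep_discrete_normal_integral:
  fixes X :: "'p \<Rightarrow> 'c::countable" and \<psi> :: "'c \<times> real \<Rightarrow> real"
  assumes P: "prob_space P" and X: "distr P (count_space UNIV) X = measure_pmf q"
    and i: "indep_rv P (count_space UNIV) X borel Z"
    and Z: "distributed P lborel Z (\<lambda>x. ennreal (\<rho> x))"
    and b: "\<And>z. \<bar>\<psi> z\<bar> \<le> B" and m: "\<And>v. (\<lambda>x. \<psi> (v, x)) \<in> borel_measurable borel"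
  shows "(\<integral>\<omega>. \<psi> (X \<omega>, Z \<omega>) \<partial>P) = (\<integral>x. measure_pmf.expectation q (\<lambda>v. \<psi> (v, x)) * \<rho> x \<partial>lborel)"
proof -
  interpret PP: prob_space P by (rule P)
  have mX: "X \<in> measurable P (count_space UNIV)" and mZ: "Z \<in> measurable P borel"
    using i unfolding indep_rv_def by auto
  have dZ: "distr P borel Z = density lborel (\<lambda>x. ennreal (\<rho> x))"
    using Z unfolding distributed_def by (metis (no_types) distr_cong sets_lborel)
  let ?N = "density lborel (\<lambda>x. ennreal (\<rho> x))"
  interpret N: prob_space ?N unfolding dZ[symmetric] by (rule PP.prob_space_distr[OF mZ])
  interpret pair_prob_space "measure_pmf q" ?N ..
  have mpsi: "\<psi> \<in> borel_measurable (count_space UNIV \<Otimes>\<^sub>M borel)" by (rule sections_measurable[OF m])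
  have sets_eq: "sets (measure_pmf q \<Otimes>\<^sub>M ?N) = sets (count_space UNIV \<Otimes>\<^sub>M borel)"
    by (intro sets_pair_measure_cong) auto
  have mpsi': "\<psi> \<in> borel_measurable (measure_pmf q \<Otimes>\<^sub>M ?N)"
    using mpsi by (simp only: measurable_cong_sets[OF sets_eq refl])
  have int: "integrable (measure_pmf q \<Otimes>\<^sub>M ?N) \<psi>"
    using b mpsi' by (intro P.integrable_const_bound[where B = B]) auto
  have "(\<integral>\<omega>. \<psi> (X \<omega>, Z \<omega>) \<partial>P) = (\<integral>z. \<psi> z \<partial>distr P (count_space UNIV \<Otimes>\<^sub>M borel) (\<lambda>\<omega>. (X \<omega>, Z \<omega>)))"
    using mX mZ mpsi by (subst integral_distr) auto
  also have "\<dots> = (\<integral>z. \<psi> z \<partial>(measure_pmf q \<Otimes>\<^sub>M ?N))"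
    unfolding indep_rv_distr[OF P i] X dZ ..
  also have "\<dots> = (\<integral>x. measure_pmf.expectation q (\<lambda>v. \<psi> (v, x)) \<partial>?N)"
    using integral_snd[of "\<lambda>v x. \<psi> (v, x)"] int by simp
  also have "\<dots> = (\<integral>x. \<rho> x * measure_pmf.expectation q (\<lambda>v. \<psi> (v, x)) \<partial>lborel)"
  proof (rule integral_real_density)
    have "(\<lambda>x. measure_pmf.expectation q (\<lambda>v. \<psi> (v, x))) \<in> borel_measurable ?N"
      using borel_measurable_integrable[OF integrable_snd[of "\<lambda>v x. \<psi> (v, x)"]] int by simp
    then show "(\<lambda>x. measure_pmf.expectation q (\<lambda>v. \<psi> (v, x))) \<in> borel_measurable lborel" by simp
  qed auto
  finally show ?thesis by (simp add: mult.commute)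
qed

text \<open>
  By the lemma of Scheffe, pointwise convergence of probability mass functions is convergence in total
  variation; the null sequence \<open>e\<close> is the \<open>L1\<close>-distance.
\<close>

lemma pmf_convergence_uniform:
  fixes p :: "nat \<Rightarrow> 'c::countable pmf"
  assumes lim: "\<And>v. (\<lambda>n. pmf (p n) v) \<longlonglongrightarrow> pmf q v"
  obtains e :: "nat \<Rightarrow> real" where "e \<longlonglongrightarrow> 0"
    and "\<And>n F. (\<And>v. \<bar>F v\<bar> \<le> 1) \<Longrightarrow> \<bar>measure_pmf.expectation (p n) F - measure_pmf.expectation q F\<bar> \<le> e n"
proof -
  let ?C = "count_space (UNIV :: 'c set)"
  have int: "integrable ?C (pmf r)" for r :: "'c pmf" by (rule integrable_pmf)
  define e where "e n = (\<integral>v. \<bar>pmf (p n) v - pmf q v\<bar> \<partial>?C)" for n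
  have ie: "integrable ?C (\<lambda>v. \<bar>pmf (p n) v - pmf q v\<bar>)" for n
    by (intro integrable_abs Bochner_Integration.integrable_diff int)
  have "(\<lambda>n. \<integral>\<^sup>+ v. norm (pmf (p n) v - pmf q v) \<partial>?C) \<longlonglongrightarrow> 0"
    by (rule Scheffe_lemma2) (use lim int in \<open>auto simp: nn_integral_pmf measure_pmf.emeasure_space_1[simplified]\<close>)
  then have "(\<lambda>n. ennreal (e n)) \<longlonglongrightarrow> 0"
    using nn_integral_eq_integral[OF ie] by (simp add: e_def)
  then have e0: "e \<longlonglongrightarrow> 0"
    by (subst (asm) ennreal_0[symmetric], subst (asm) tendsto_ennreal_iff) (auto simp: e_def)
  have ex: "measure_pmf.expectation r F = (\<integral>v. pmf r v * F v \<partial>?C)" for r :: "'c pmf" and F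
    by (subst measure_pmf_eq_density) (simp add: integral_real_density)
  have iF: "integrable ?C (\<lambda>v. pmf r v * F v)" if "\<And>v. \<bar>F v\<bar> \<le> 1" for r :: "'c pmf" and F
    by (rule Bochner_Integration.integrable_bound[OF int[of r]])
      (use that in \<open>auto simp: abs_mult intro!: mult_left_le\<close>)
  have bnd: "\<bar>measure_pmf.expectation (p n) F - measure_pmf.expectation q F\<bar> \<le> e n" if F: "\<And>v. \<bar>F v\<bar> \<le> 1" for n F
  proof -
    have "measure_pmf.expectation (p n) F - measure_pmf.expectation q F = (\<integral>v. (pmf (p n) v - pmf q v) * F v \<partial>?C)"
      unfolding ex left_diff_distrib by (rule Bochner_Integration.integral_diff[symmetric]) (intro iF F)+
    also have "\<bar>\<dots>\<bar> \<le> (\<integral>v. \<bar>(pmf (p n) v - pmf q v) * F v\<bar> \<partial>?C)" by (rule integral_abs_bound)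
    also have "\<dots> \<le> e n" unfolding e_def
    proof (rule integral_mono[OF _ ie])
      show "\<bar>(pmf (p n) v - pmf q v) * F v\<bar> \<le> \<bar>pmf (p n) v - pmf q v\<bar>" for v
        using F[of v] by (simp add: abs_mult mult_left_le)
      show "integrable ?C (\<lambda>v. \<bar>(pmf (p n) v - pmf q v) * F v\<bar>)"
        unfolding left_diff_distrib by (intro integrable_abs Bochner_Integration.integrable_diff iF F)
    qed
    finally show ?thesis .
  qed
  show thesis by (rule that[OF e0 bnd])
qed

lemma poisson_vec_pmf_tendsto:
  fixes l :: "nat \<Rightarrow> real ^ 'd"
  assumes "\<And>n j. 0 < l n $ j" "\<And>j. 0 < a $ j" "\<And>j. (\<lambda>n. l n $ j) \<longlonglongrightarrow> a $ j"
  shows "(\<lambda>n. pmf (poisson_vec_pmf (l n)) v) \<longlonglongrightarrow> pmf (poisson_vec_pmf a) v"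
proof -
  have p: "pmf (poisson_vec_pmf b) v = (\<Prod>j\<in>UNIV. (b $ j) ^ (v $ j) / fact (v $ j) * exp (- (b $ j)))"
    if "\<And>j. 0 < b $ j" for b :: "real ^ 'd"
  proof -
    have "inj (vec_lambda :: ('d \<Rightarrow> nat) \<Rightarrow> nat ^ 'd)" by (auto simp: inj_on_def vec_lambda_inject)
    from pmf_map_inj'[OF this, of "Pi_pmf UNIV 0 (\<lambda>j. poisson_pmf (b $ j))" "vec_nth v"]
    show ?thesis using that unfolding poisson_vec_pmf_def by (simp add: pmf_Pi vec_nth_inverse)
  qed
  show ?thesis unfolding p[OF assms(1)] p[OF assms(2)] 
    by (intro tendsto_prod tendsto_mult tendsto_divide tendsto_power tendsto_const tendsto_exp tendsto_minus assms(3)) auto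
qed

text \<open>
  A bounded continuous \<open>h\<close> is the limit from below of its Lipschitz envelopes
  \<open>INF y. h (v, y) + L \<bar>x - y\<bar>\<close>, which are multiples of functions in \<open>H1\<close>. This gives the lower half of the
  convergence by dominated convergence, and the upper half for \<open>- h\<close>.
\<close>

lemma converges_in_distribution_if_H1:
  fixes V :: "nat \<Rightarrow> 'w \<Rightarrow> (nat ^ 'd) \<times> real" and H :: "'p \<Rightarrow> (nat ^ 'd) \<times> real"
  assumes M: "prob_space M" and P: "prob_space P"
    and V: "\<And>n. V n \<in> measurable M (count_space UNIV \<Otimes>\<^sub>M borel)"
    and H: "H \<in> measurable P (count_space UNIV \<Otimes>\<^sub>M borel)"
    and conv: "\<And>\<psi>. \<psi> \<in> H1 \<Longrightarrow> (\<lambda>n. \<integral>\<omega>. \<psi> (V n \<omega>) \<partial>M) \<longlonglongrightarrow> (\<integral>\<omega>. \<psi> (H \<omega>) \<partial>P)"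
  shows "converges_in_distribution M V P H"
  unfolding converges_in_distribution_def
proof (intro allI impI)
  interpret M: prob_space M by (rule M)
  interpret P: prob_space P by (rule P)
  have lower: "\<forall>\<^sub>F n in sequentially. (\<integral>\<omega>. h (H \<omega>) \<partial>P) - e < (\<integral>\<omega>. h (V n \<omega>) \<partial>M)"
    if c: "continuous_on UNIV h" and B: "\<And>z. \<bar>h z\<bar> \<le> B" "1 \<le> B" and e: "0 < e"
    for h :: "(nat ^ 'd) \<times> real \<Rightarrow> real" and B e
  proof -
    define g where "g L z = (INF y. h (fst z, y) + real L * \<bar>snd z - y\<bar>)" for L :: nat and z
    have lb: "- B \<le> h (v, y) + real L * \<bar>x - y\<bar>" for v x y and L :: nat
      using B(1)[of "(v, y)"] by (simp add: abs_le_iff add_increasing2)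
    have bdd: "bdd_below (range (\<lambda>y. h (v, y) + real L * \<bar>x - y\<bar>))" for v x and L :: nat
      using lb by (intro bdd_belowI2[where m = "- B"]) auto
    have g_le: "g L z \<le> h z" for L z
      unfolding g_def using cINF_lower[OF bdd, of "snd z" "fst z" L "snd z"] by simp
    have g_ge: "- B \<le> g L z" for L z unfolding g_def by (rule cINF_greatest) (use lb in auto)
    have g_bound: "\<bar>g L z\<bar> \<le> B" for L z
      using g_le[of L z] g_ge[of L z] B(1)[of z] by (simp add: abs_le_iff)
    have g_step: "g L (v, x) \<le> g L (v, x') + real L * \<bar>x - x'\<bar>" for L v x x'
    proof -
      have "g L (v, x) - real L * \<bar>x - x'\<bar> \<le> h (v, y) + real L * \<bar>x' - y\<bar>" for y
      proof -
        have "g L (v, x) \<le> h (v, y) + real L * \<bar>x - y\<bar>" unfolding g_def using cINF_lower[OF bdd, of y v L x] by simp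
        also have "real L * \<bar>x - y\<bar> \<le> real L * (\<bar>x - x'\<bar> + \<bar>x' - y\<bar>)" by (intro mult_left_mono) auto
        finally show ?thesis by (simp add: distrib_left)
      qed
      then have "g L (v, x) - real L * \<bar>x - x'\<bar> \<le> g L (v, x')" unfolding g_def[of L "(v, x')"]
        by (intro cINF_greatest) auto
      then show ?thesis by simp
    qed
    have g_lip: "\<bar>g L (v, x) - g L (v, x')\<bar> \<le> real L * \<bar>x - x'\<bar>" for L v x x'
      using g_step[of L v x x'] g_step[of L v x' x] by (simp add: abs_le_iff abs_minus_commute)
    have g_cont: "continuous_on UNIV (\<lambda>x. g L (v, x))" for L v
    proof (rule lipschitz_on_continuous_on)
      show "(real L)-lipschitz_on UNIV (\<lambda>x. g L (v, x))" using g_lip by (auto simp: lipschitz_on_def dist_real_def)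
    qed
    have g_meas: "g L \<in> borel_measurable (count_space UNIV \<Otimes>\<^sub>M borel)" for L
      by (intro sections_measurable borel_measurable_continuous_onI g_cont)
    have h_sec: "continuous_on UNIV (\<lambda>x. h (v, x))" for v
      by (rule continuous_on_compose2[OF c]) (auto intro!: continuous_intros)
    have h_meas: "h \<in> borel_measurable (count_space UNIV \<Otimes>\<^sub>M borel)"
      by (intro sections_measurable borel_measurable_continuous_onI h_sec)
    have g_lim: "(\<lambda>L. g L z) \<longlonglongrightarrow> h z" for z
    proof (rule LIMSEQ_I)
      fix r :: real assume r: "0 < r"
      obtain v x where z: "z = (v, x)" by (cases z)
      obtain d where d: "0 < d" "\<And>y. dist y x < d \<Longrightarrow> dist (h (v, y)) (h (v, x)) < r / 2"
        using h_sec[of v] r unfolding continuous_on_iff by (metis UNIV_I half_gt_zero)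
      obtain N where N: "2 * B / d < real N" using reals_Archimedean2 by blast
      have "norm (g L z - h z) < r" if L: "N \<le> L" for L
      proof -
        have "h z - r / 2 \<le> h (v, y) + real L * \<bar>x - y\<bar>" for y
        proof (cases "dist y x < d")
          case True
          have "\<bar>h (v, y) - h (v, x)\<bar> < r / 2" using d(2)[OF True] by (simp only: dist_real_def)
          then have "h z - r / 2 \<le> h (v, y)" unfolding z by linarith
          moreover have "0 \<le> real L * \<bar>x - y\<bar>" by simp
          ultimately show ?thesis by linarith
        next
          case False
          have "2 * B \<le> real N * d" using N d(1) by (simp add: divide_less_eq)
          also have "\<dots> \<le> real L * \<bar>x - y\<bar>"
            using L False d(1) by (intro mult_mono) (auto simp: dist_real_def abs_minus_commute)
          finally show ?thesis using B(1)[of z] B(1)[of "(v, y)"] r by (simp add: abs_le_iff)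
        qed
        then have "h z - r / 2 \<le> g L z" unfolding g_def z by (intro cINF_greatest) auto
        then show ?thesis using g_le[of L z] r by simp
      qed
      then show "\<exists>no. \<forall>n\<ge>no. norm (g n z - h z) < r" by blast
    qed
    have "(\<lambda>L. \<integral>\<omega>. g L (H \<omega>) \<partial>P) \<longlonglongrightarrow> (\<integral>\<omega>. h (H \<omega>) \<partial>P)"
      by (rule integral_dominated_convergence[where w = "\<lambda>_. B"])
        (use measurable_compose[OF H g_meas] measurable_compose[OF H h_meas] g_lim g_bound in auto)
    then have "\<forall>\<^sub>F L in sequentially. (\<integral>\<omega>. h (H \<omega>) \<partial>P) - e < (\<integral>\<omega>. g L (H \<omega>) \<partial>P)"
      using e by (intro order_tendstoD(1)) auto
    then obtain L where L: "(\<integral>\<omega>. h (H \<omega>) \<partial>P) - e < (\<integral>\<omega>. g L (H \<omega>) \<partial>P)"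
      unfolding eventually_sequentially by blast
    \<comment> \<open>Dividing by \<open>c\<close> makes both the bound and the Lipschitz constant at most \<open>1\<close>.\<close>
    define c where "c = B + real L"
    have c: "0 < c" "B \<le> c" "real L \<le> c" using B(2) by (auto simp: c_def)
    have "(\<lambda>z. g L z / c) \<in> H1" unfolding H1_def
    proof (intro CollectI conjI allI)
      show "\<bar>g L z / c\<bar> \<le> 1" for z using g_bound[of L z] c by (simp add: abs_divide)
      show "1-lipschitz_on UNIV (\<lambda>x. g L (v, x) / c)" for v
      proof (rule lipschitz_onI)
        fix x x' :: real
        have "\<bar>g L (v, x) - g L (v, x')\<bar> \<le> c * \<bar>x - x'\<bar>"
          using g_lip[of L v x x'] mult_right_mono[OF c(3), of "\<bar>x - x'\<bar>"] by simp
        then show "dist (g L (v, x) / c) (g L (v, x') / c) \<le> 1 * dist x x'"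
          using c(1) by (simp add: dist_real_def diff_divide_distrib[symmetric] abs_divide pos_divide_le_eq mult.commute)
      qed simp
    qed
    from tendsto_mult_left[OF conv[OF this], of c]
    have "(\<lambda>n. \<integral>\<omega>. g L (V n \<omega>) \<partial>M) \<longlonglongrightarrow> (\<integral>\<omega>. g L (H \<omega>) \<partial>P)" using c(1) by simp
    then have "\<forall>\<^sub>F n in sequentially. (\<integral>\<omega>. h (H \<omega>) \<partial>P) - e < (\<integral>\<omega>. g L (V n \<omega>) \<partial>M)"
      using L by (rule order_tendstoD(1))
    moreover have "(\<integral>\<omega>. g L (V n \<omega>) \<partial>M) \<le> (\<integral>\<omega>. h (V n \<omega>) \<partial>M)" for n
      using measurable_compose[OF V g_meas] measurable_compose[OF V h_meas] g_bound B(1) g_le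
      by (intro integral_mono M.integrable_const_bound[where B = B]) auto
    ultimately show ?thesis by (auto elim!: eventually_mono intro: less_le_trans)
  qed
  fix h :: "(nat ^ 'd) \<times> real \<Rightarrow> real" assume "continuous_on UNIV h \<and> bounded (range h)"
  then obtain B0 where c: "continuous_on UNIV h" and B0: "\<And>z. \<bar>h z\<bar> \<le> B0"
    unfolding bounded_iff by auto
  define B where "B = max 1 B0"
  have B: "\<bar>h z\<bar> \<le> B" "\<bar>- h z\<bar> \<le> B" "1 \<le> B" for z using B0[of z] by (auto simp: B_def)
  have c': "continuous_on UNIV (\<lambda>z. - h z)" by (intro continuous_intros c)
  show "(\<lambda>n. \<integral>\<omega>. h (V n \<omega>) \<partial>M) \<longlonglongrightarrow> (\<integral>\<omega>. h (H \<omega>) \<partial>P)"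
  proof (rule order_tendstoI)
    fix a assume "a < (\<integral>\<omega>. h (H \<omega>) \<partial>P)"
    then show "\<forall>\<^sub>F n in sequentially. a < (\<integral>\<omega>. h (V n \<omega>) \<partial>M)"
      using lower[OF c B(1,3), of "(\<integral>\<omega>. h (H \<omega>) \<partial>P) - a"] by simp
  next
    fix a assume "(\<integral>\<omega>. h (H \<omega>) \<partial>P) < a"
    then show "\<forall>\<^sub>F n in sequentially. (\<integral>\<omega>. h (V n \<omega>) \<partial>M) < a"
      using lower[OF c' B(2,3), of "a - (\<integral>\<omega>. h (H \<omega>) \<partial>P)"] by simp
  qed
qed

lemma measure_density_cball_le:
  fixes f :: "'a::euclidean_space \<Rightarrow> real"
  assumes f: "f \<in> borel_measurable borel" "\<And>z. f z \<le> B" "0 \<le> B" and s: "0 \<le> s"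
  shows "measure (density lborel f) (cball x s) \<le> B * (unit_ball_vol (real DIM('a)) * s ^ DIM('a))"
proof -
  have "emeasure (density lborel f) (cball x s) = (\<integral>\<^sup>+z. ennreal (f z) * indicator (cball x s) z \<partial>lborel)"
    using f by (subst emeasure_density) auto
  also have "\<dots> \<le> (\<integral>\<^sup>+z. ennreal B * indicator (cball x s) z \<partial>lborel)"
    using f by (intro nn_integral_mono mult_right_mono ennreal_leI) auto
  also have "\<dots> = ennreal B * ennreal (unit_ball_vol (real DIM('a)) * s ^ DIM('a))"
    by (subst nn_integral_cmult_indicator) (auto simp: emeasure_cball[OF s])
  also have "\<dots> = ennreal (B * (unit_ball_vol (real DIM('a)) * s ^ DIM('a)))"
    using f(3) by (simp add: ennreal_mult')
  finally show ?thesis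
    unfolding measure_def using f(3) s by (intro enn2real_leI) (auto intro!: mult_nonneg_nonneg)
qed

section \<open>Joint approximation at a fixed intensity\<close>

context disk_sample
begin

lemma mean_eq:
  "mean j = n ^ k / fact k * measure (PiM {1..k} (\<lambda>_. D))
     {x \<in> space (PiM {1..k} (\<lambda>_. D)). forms_copy r (\<Gamma> j) x {1..k}}"
proof -
  have k1: "1 \<le> k" using orders by simp
  interpret A: poisson_neighbours D n "forms_copy r (\<Gamma> j)" counts k "2 * real k * r" q
    by (rule functionals[OF G(1) G(3) k1])
  have "mean j = A.\<mu>"
    unfolding A.\<mu>_def mean_def A.occurrences_def[abs_def] by (simp add: copies_def)
  also have "\<dots> = A.\<kappa> * expect (\<lambda>i y. A.U y)" using A.palm_one by (simp add: A.palm_def)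
  finally show ?thesis unfolding A.expect_U A.\<kappa>_def .
qed

lemma mean0_eq:
  "mean0 = n ^ k0 / fact k0 * measure (PiM {1..k0} (\<lambda>_. D))
     {x \<in> space (PiM {1..k0} (\<lambda>_. D)). forms_copy r \<Gamma>\<^sub>0 x {1..k0}}"
proof -
  interpret A: poisson_neighbours D n "forms_copy r \<Gamma>\<^sub>0" counts k0 "2 * real k * r" q
    by (rule functionals[OF G0(1) G0(3) orders(1)])
  have "mean0 = A.\<mu>"
    unfolding A.\<mu>_def mean0_def A.occurrences_def[abs_def] by (simp add: copies_def)
  also have "\<dots> = A.\<kappa> * expect (\<lambda>i y. A.U y)" using A.palm_one by (simp add: A.palm_def)
  finally show ?thesis unfolding A.expect_U A.\<kappa>_def .
qed

text \<open>
  A test function that does not depend on the count of \<open>\<Gamma>\<^sub>0\<close> has Lipschitz constant \<open>L = 0\<close> there, and no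
  term with \<open>1 / \<sigma>\<close> appears.
\<close>

theorem total_variation_bound:
  assumes pos: "\<And>j. 0 < mean j" and l: "\<And>j. l $ j = mean j"
  shows "\<bar>expect (\<lambda>i y. indicator E (fst (counts y {1..i}))) - measure (measure_pmf (poisson_vec_pmf l)) E\<bar>
    \<le> (\<Sum>j\<in>UNIV. mean j * exp (mean j) * (4 * excess))"
  using vector_step[of "\<lambda>v x. indicator E v" 0 0 l 0, OF _ _ _ _ pos l] by (simp add: expect_const)

text \<open>
  First the counts of order \<open>k\<close> become independent Poisson variables. Their average \<open>\<phi>\<close> of the test function is
  again bounded and Lipschitz, and then the normalized count becomes normal. Since the variance is at least the
  mean, \<open>1 / sqrt mean0\<close> bounds \<open>1 / \<sigma>\<close>.
\<close>

theorem mixed_bound: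
  assumes \<psi>: "\<psi> \<in> H1" and pos: "\<And>j. 0 < mean j" "0 < mean0" and l: "\<And>j. l $ j = mean j"
  shows "\<bar>expect (\<lambda>i y. \<psi> (fst (counts y {1..i}), (real (snd (counts y {1..i})) - mean0) / sqrt var0))
      - (\<integral>x. measure_pmf.expectation (poisson_vec_pmf l) (\<lambda>v. \<psi> (v, x)) * \<rho> x \<partial>lborel)\<bar>
    \<le> (\<Sum>j\<in>UNIV. mean j * exp (mean j) * (4 * excess + 2 / sqrt mean0 * 2 ^ k))
      + (8 * 2 ^ k0 * excess + 8 * 4 ^ k0 * (1 + excess) / sqrt mean0)"
proof -
  have b: "\<bar>\<psi> (v, x)\<bar> \<le> 1" for v x using \<psi> by (auto simp: H1_def)
  have lip: "\<bar>\<psi> (v, x) - \<psi> (v, x')\<bar> \<le> 1 * \<bar>x - x'\<bar>" for v x x'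
  proof -
    have "1-lipschitz_on UNIV (\<lambda>x. \<psi> (v, x))" using \<psi> by (auto simp: H1_def)
    from lipschitz_onD[OF this, of x x'] show ?thesis by (simp add: dist_real_def)
  qed
  define \<phi> where "\<phi> x = measure_pmf.expectation (poisson_vec_pmf l) (\<lambda>v. \<psi> (v, x))" for x
  have \<phi>: "\<phi> x = poisson_resample l UNIV (\<lambda>v. \<psi> (v, x)) 0" for x
    unfolding \<phi>_def poisson_resample_UNIV ..
  have \<phi>_b: "\<bar>\<phi> x\<bar> \<le> 1" for x unfolding \<phi> by (rule poisson_resample_bound) (rule b)
  have \<phi>_lip: "\<bar>\<phi> x - \<phi> x'\<bar> \<le> \<bar>x - x'\<bar>" for x x'
    unfolding \<phi> by (rule poisson_resample_lipschitz[where B = 1]) (use b lip in auto)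
  note ns = normal_step[of \<phi>, OF \<phi>_b \<phi>_lip pos(2)]
  have v: "0 < var0" using ns(1) pos(2) by simp
  have s: "1 / sqrt var0 \<le> 1 / sqrt mean0" using ns(1) pos(2) by (intro divide_left_mono) auto
  have k1: "1 \<le> k" using orders by simp
  have ex0: "0 \<le> excess"
  proof -
    have "0 \<le> q" using order_trans[OF measure_nonneg ball_prob] .
    then show ?thesis using n_pos by (simp add: excess_def)
  qed
  have s0: "0 \<le> 1 / sqrt var0" by (simp add: v less_imp_le)
  let ?X = "\<lambda>i y. (real (snd (counts y {1..i})) - mean0) / sqrt var0"
  have "\<bar>expect (\<lambda>i y. \<psi> (fst (counts y {1..i}), ?X i y)) - expect (\<lambda>i y. \<phi> (?X i y))\<bar>
     \<le> (\<Sum>j\<in>UNIV. mean j * exp (mean j) * (4 * excess + 2 * 1 * (1 / sqrt var0) * 2 ^ k))"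
    using vector_step[of "\<lambda>v x. \<psi> (v, x)" 1 "1 / sqrt var0" l mean0, OF b lip _ s0 pos(1) l]
    unfolding \<phi>_def by simp
  also have "\<dots> \<le> (\<Sum>j\<in>UNIV. mean j * exp (mean j) * (4 * excess + 2 / sqrt mean0 * 2 ^ k))"
  proof (intro sum_mono mult_left_mono add_left_mono)
    fix j
    show "2 * 1 * (1 / sqrt var0) * 2 ^ k \<le> 2 / sqrt mean0 * 2 ^ k"
      using mult_right_mono[OF s, of "2 * 2 ^ k"] by simp
    show "0 \<le> mean j * exp (mean j)" using pos(1)[of j] by simp
  qed
  finally have 1: "\<bar>expect (\<lambda>i y. \<psi> (fst (counts y {1..i}), ?X i y)) - expect (\<lambda>i y. \<phi> (?X i y))\<bar> \<le> \<dots>" .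
  have "\<bar>expect (\<lambda>i y. \<phi> (?X i y)) - (\<integral>x. \<phi> x * \<rho> x \<partial>lborel)\<bar> \<le> 8 * 2 ^ k0 * excess + 8 * 4 ^ k0 * (1 + excess) / sqrt var0"
    by (rule ns(2))
  also have "\<dots> \<le> 8 * 2 ^ k0 * excess + 8 * 4 ^ k0 * (1 + excess) / sqrt mean0"
    using mult_left_mono[OF s, of "8 * 4 ^ k0 * (1 + excess)"] ex0 by simp
  finally have 2: "\<bar>expect (\<lambda>i y. \<phi> (?X i y)) - (\<integral>x. \<phi> x * \<rho> x \<partial>lborel)\<bar> \<le> \<dots>" .
  show ?thesis
    using add_mono[OF 1 2] abs_triangle_ineq[of "expect (\<lambda>i y. \<psi> (fst (counts y {1..i}), ?X i y)) - expect (\<lambda>i y. \<phi> (?X i y))"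
        "expect (\<lambda>i y. \<phi> (?X i y)) - (\<integral>x. \<phi> x * \<rho> x \<partial>lborel)"]
    unfolding \<phi>_def by simp
qed

text \<open>
  A random number \<open>K\<close> of random points \<open>Y\<close> on an arbitrary probability space whose joint law is that of the
  Poisson sample has the same expectations.
\<close>

context
  fixes M :: "'w measure" and K :: "'w \<Rightarrow> nat" and Y :: "nat \<Rightarrow> 'w \<Rightarrow> 'a"
  assumes meas: "(\<lambda>\<omega>. (K \<omega>, \<lambda>i\<in>{1..}. Y i \<omega>)) \<in> measurable M \<Omega>"
    and law: "distr M \<Omega> (\<lambda>\<omega>. (K \<omega>, \<lambda>i\<in>{1..}. Y i \<omega>)) = \<Omega>"
begin

lemma counts_restrict: "counts (\<lambda>i. Y i \<omega>) {1..m} = counts (\<lambda>i\<in>{1..}. Y i \<omega>) {1..m}"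
  by (rule equivariant_cong[OF equivariant_counts]) simp

lemma counts_meas_Q: "(\<lambda>y. counts y {1..i}) \<in> measurable Q (count_space UNIV)"
  unfolding Q_def by (rule local_measurable_PiM[OF equivariant_counts local_measurable_counts]) auto

lemma counts_measurable: "(\<lambda>\<omega>. counts (\<lambda>i. Y i \<omega>) {1..K \<omega>}) \<in> measurable M (count_space UNIV)"
  using measurable_compose[OF meas measurable_\<Omega>[of "\<lambda>i y. counts y {1..i}", OF counts_meas_Q]]
  by (simp only: counts_restrict case_prod_conv)

lemma counts_integral:
  fixes \<Phi> :: "(nat ^ 'd) \<times> nat \<Rightarrow> real"
  shows "(\<integral>\<omega>. \<Phi> (counts (\<lambda>i. Y i \<omega>) {1..K \<omega>}) \<partial>M) = expect (\<lambda>i y. \<Phi> (counts y {1..i}))"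
proof -
  have m: "(\<lambda>(i, y). \<Phi> (counts y {1..i})) \<in> borel_measurable \<Omega>"
    by (rule measurable_\<Omega>) (rule measurable_compose[OF counts_meas_Q], simp)
  have "expect (\<lambda>i y. \<Phi> (counts y {1..i}))
      = (\<integral>\<omega>. (case \<omega> of (i, y) \<Rightarrow> \<Phi> (counts y {1..i})) \<partial>distr M \<Omega> (\<lambda>\<omega>. (K \<omega>, \<lambda>i\<in>{1..}. Y i \<omega>)))"
    unfolding law expect_def ..
  also have "\<dots> = (\<integral>\<omega>. \<Phi> (counts (\<lambda>i. Y i \<omega>) {1..K \<omega>}) \<partial>M)"
    by (subst integral_distr[OF meas m]) (simp only: counts_restrict case_prod_conv)
  finally show ?thesis ..
qed

end

end

section \<open>The sparse regime\<close>

text \<open>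
  With \<open>T = t ^ m\<close> the factor in brackets tends to \<open>1\<close>, so the mean count of a graph of order \<open>p\<close>, of
  order \<open>n ^ p T ^ (p - 1)\<close>, grows like the power of \<open>n\<close> on the right. For \<open>p = k\<close> this power is \<open>1\<close>.
\<close>

lemma regime_power:
  fixes T :: real and k p :: nat
  assumes n: "1 \<le> n" and k: "2 \<le> k" and p: "1 \<le> p"
  shows "real n ^ p * T ^ (p - 1)
    = (T * real n powr (real k / (real k - 1))) ^ (p - 1) * real n powr ((real k - real p) / (real k - 1))"
proof -
  have n0: "0 < real n" using n by simp
  \<comment> \<open>The exponents balance as \<open>k (p - 1) + (k - p) = p (k - 1)\<close>.\<close>
  have e: "real k / (real k - 1) * real (p - 1) + (real k - real p) / (real k - 1) = real p"
    using k p by (simp add: of_nat_diff divide_simps) (simp add: algebra_simps)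
  have "(real n powr (real k / (real k - 1))) ^ (p - 1) = real n powr (real k / (real k - 1) * real (p - 1))"
    using n0 by (simp add: powr_realpow[symmetric] powr_powr)
  then have "(T * real n powr (real k / (real k - 1))) ^ (p - 1) * real n powr ((real k - real p) / (real k - 1))
      = T ^ (p - 1) * (real n powr (real k / (real k - 1) * real (p - 1)) * real n powr ((real k - real p) / (real k - 1)))"
    by (simp add: power_mult_distrib mult.assoc)
  also have "\<dots> = T ^ (p - 1) * real n powr real p" unfolding powr_add[symmetric] e ..
  also have "\<dots> = real n ^ p * T ^ (p - 1)" using n0 by (simp add: powr_realpow)
  finally show ?thesis ..
qed

lemma regime_density:
  fixes T :: real and k :: nat
  assumes n: "1 \<le> n" and k: "2 \<le> k"
  shows "real n * T = (T * real n powr (real k / (real k - 1))) * real n powr (- (1 / (real k - 1)))"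
proof -
  have e: "real k / (real k - 1) + - (1 / (real k - 1)) = 1" using k by (simp add: divide_simps)
  have "real n * T = T * real n powr (real k / (real k - 1) + - (1 / (real k - 1)))"
    unfolding e using n by simp
  also have "\<dots> = (T * real n powr (real k / (real k - 1))) * real n powr (- (1 / (real k - 1)))"
    by (simp only: powr_add mult.assoc)
  finally show ?thesis .
qed

locale random_disk_graphs =
  fixes M :: "'w measure" and f :: "'a::euclidean_space \<Rightarrow> real" and Y :: "nat \<Rightarrow> 'w \<Rightarrow> 'a"
    and N :: "nat \<Rightarrow> 'w \<Rightarrow> nat" and t :: "nat \<Rightarrow> real" and k0 k :: nat
    and \<Gamma>\<^sub>0 :: "'v pair_pre_digraph" and \<Gamma> :: "'d::finite \<Rightarrow> 'v pair_pre_digraph"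
  assumes M: "prob_space M"
    and f: "\<And>x. 0 \<le> f x" "bounded (range f)" "continuous_on UNIV f"
    and Y_density: "\<And>i. 1 \<le> i \<Longrightarrow> distributed M lborel (Y i) (\<lambda>x. ennreal (f x))"
    and Y_indep: "prob_space.indep_vars M (\<lambda>_. borel) Y {1..}"
    and N_poisson: "\<And>n. 1 \<le> n \<Longrightarrow> distr M (count_space UNIV) (N n) = measure_pmf (poisson_pmf (real n))"
    and N_indep: "\<And>n. 1 \<le> n \<Longrightarrow> indep_rv M (count_space UNIV) (N n)
          (PiM {1..} (\<lambda>_. borel)) (\<lambda>\<omega>. \<lambda>i\<in>{1..}. Y i \<omega>)"
    and t: "\<And>n. 1 \<le> n \<Longrightarrow> 0 < t n" "t \<longlonglongrightarrow> 0"
    and k: "2 \<le> k0" "k0 < k"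
    and regime: "(\<lambda>n. t n ^ DIM('a)) \<sim>[sequentially] (\<lambda>n. real n powr - (real k / (real k - 1)))"
    and G0: "pair_graph \<Gamma>\<^sub>0" "Digraph_Component.connected (with_proj \<Gamma>\<^sub>0)"
          "card (pverts \<Gamma>\<^sub>0) = k0" "feasible M Y t \<Gamma>\<^sub>0"
    and G: "\<And>j. pair_graph (\<Gamma> j)" "\<And>j. Digraph_Component.connected (with_proj (\<Gamma> j))"
          "\<And>j. card (pverts (\<Gamma> j)) = k" "\<And>j. feasible M Y t (\<Gamma> j)"
    and non_iso: "\<And>i j. i \<noteq> j \<Longrightarrow> \<not> digraph_iso (with_proj (\<Gamma> i)) (with_proj (\<Gamma> j))"
begin

sublocale M: prob_space M by (rule M)

abbreviation "D \<equiv> density lborel (\<lambda>x. ennreal (f x))"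

lemma f_meas: "f \<in> borel_measurable borel"
  by (rule borel_measurable_continuous_onI[OF f(3)])

definition f_max :: real where "f_max = (SUP x. f x)"

lemma f_le: "f x \<le> f_max"
  unfolding f_max_def by (rule cSUP_upper) (auto intro: bounded_imp_bdd_above f(2))

lemma f_max_nonneg: "0 \<le> f_max" using f(1) f_le order_trans by blast

lemma Y_borel: "1 \<le> i \<Longrightarrow> Y i \<in> borel_measurable M"
  using distributed_measurable[OF Y_density, of i] by simp

lemma Y_distr:
  assumes "1 \<le> i" shows "distr M borel (Y i) = D"
proof -
  have "distr M borel (Y i) = distr M lborel (Y i)" by (rule distr_cong) auto
  then show ?thesis using distributed_distr_eq_density[OF Y_density[OF assms]] by simp
qed

lemma D_prob: "prob_space D"
  using M.prob_space_distr[OF Y_borel[of 1]] Y_distr[of 1] by simp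

lemma Y_law:
  assumes "I \<subseteq> {1..}" "I \<noteq> {}"
  shows "distr M (PiM I (\<lambda>_. borel)) (\<lambda>\<omega>. \<lambda>i\<in>I. Y i \<omega>) = PiM I (\<lambda>_. D)"
proof -
  have ind: "M.indep_vars (\<lambda>_. borel) Y I" by (rule M.indep_vars_subset[OF Y_indep assms(1)])
  have rv: "Y i \<in> borel_measurable M" if "i \<in> I" for i using that assms(1) Y_borel by auto
  have "distr M (PiM I (\<lambda>_. borel)) (\<lambda>\<omega>. \<lambda>i\<in>I. Y i \<omega>) = PiM I (\<lambda>i. distr M borel (Y i))"
    using M.indep_vars_iff_distr_eq_PiM'[where X = Y and M' = "\<lambda>_. borel", OF assms(2) rv] ind by simp
  also have "\<dots> = PiM I (\<lambda>_. D)" using assms(1) Y_distr by (intro PiM_cong) auto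
  finally show ?thesis .
qed

lemma copy_probability_pos:
  assumes G: "pair_graph \<Gamma>'" "card (pverts \<Gamma>') = p" "1 \<le> p" and feas: "feasible M Y t \<Gamma>'" and n: "1 \<le> n"
  shows "0 < measure (PiM {1..p} (\<lambda>_. D)) {x \<in> space (PiM {1..p} (\<lambda>_. D)). forms_copy (t n) \<Gamma>' x {1..p}}"
proof -
  let ?S = "{x \<in> space (PiM {1..p} (\<lambda>_. D)). forms_copy (t n) \<Gamma>' x {1..p}}"
  have fin: "finite (pverts \<Gamma>')"
    using G(1) by (simp add: pair_graph_def pair_digraph_def pair_fin_digraph_def pair_fin_digraph_axioms_def)
  have S: "?S \<in> sets (PiM {1..p} (\<lambda>_. D))" by (rule forms_copy_measurable) (use fin in auto)
  have se: "sets (PiM {1..p} (\<lambda>_. D)) = sets (PiM {1..p} (\<lambda>_. borel))" by (intro sets_PiM_cong) auto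
  have sp: "space (PiM {1..p} (\<lambda>_. D)) = space (PiM {1..p} (\<lambda>_. borel))" by (rule sets_eq_imp_space_eq[OF se])
  have meas: "(\<lambda>\<omega>. \<lambda>i\<in>{1..p}. Y i \<omega>) \<in> measurable M (PiM {1..p} (\<lambda>_. borel))"
    by (rule measurable_restrict) (auto intro: Y_borel)
  have law: "PiM {1..p} (\<lambda>_. D) = distr M (PiM {1..p} (\<lambda>_. borel)) (\<lambda>\<omega>. \<lambda>i\<in>{1..p}. Y i \<omega>)"
    using G(3) by (intro Y_law[symmetric]) auto
  have "measure (PiM {1..p} (\<lambda>_. D)) ?S = measure M ((\<lambda>\<omega>. \<lambda>i\<in>{1..p}. Y i \<omega>) -` ?S \<inter> space M)"
    by (subst law, rule measure_distr[OF meas]) (use S se in simp)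
  also have "(\<lambda>\<omega>. \<lambda>i\<in>{1..p}. Y i \<omega>) -` ?S \<inter> space M
    = {\<omega> \<in> space M. digraph_iso (with_proj (disk_graph (t n) ((\<lambda>i. Y i \<omega>) ` {1..card (pverts \<Gamma>')}))) (with_proj \<Gamma>')}"
  proof -
    have "forms_copy (t n) \<Gamma>' (\<lambda>i\<in>{1..p}. Y i \<omega>) {1..p} \<longleftrightarrow>
        digraph_iso (with_proj (disk_graph (t n) ((\<lambda>i. Y i \<omega>) ` {1..p}))) (with_proj \<Gamma>')" for \<omega>
    proof -
      have "forms_copy (t n) \<Gamma>' (\<lambda>i\<in>{1..p}. Y i \<omega>) {1..p} \<longleftrightarrow> forms_copy (t n) \<Gamma>' (\<lambda>i. Y i \<omega>) {1..p}"
        by (rule forms_copy_cong) simp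
      also have "\<dots> \<longleftrightarrow> digraph_iso (with_proj (disk_graph (t n) ((\<lambda>i. Y i \<omega>) ` {1..p}))) (with_proj \<Gamma>')"
        using forms_copy_iff_digraph_iso[OF G(1), of "{1..p}"] G(2) by simp
      finally show ?thesis .
    qed
    moreover have "(\<lambda>i\<in>{1..p}. Y i \<omega>) \<in> space (PiM {1..p} (\<lambda>_. D))" if "\<omega> \<in> space M" for \<omega>
      unfolding sp using measurable_space[OF meas that] .
    ultimately show ?thesis unfolding G(2) by blast
  qed
  finally show ?thesis using feas n unfolding feasible_def by simp
qed

lemma copy_probability_limit:
  assumes G: "pair_graph \<Gamma>'" "Digraph_Component.connected (with_proj \<Gamma>')" "card (pverts \<Gamma>') = p" "1 \<le> p"
    and feas: "feasible M Y t \<Gamma>'"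
  obtains L where "0 < L" "(\<lambda>n. measure (PiM {1..p} (\<lambda>_. D))
      {x \<in> space (PiM {1..p} (\<lambda>_. D)). forms_copy (t n) \<Gamma>' x {1..p}} / (t n ^ DIM('a)) ^ (p - 1)) \<longlonglongrightarrow> L"
proof -
  have lim: "(\<lambda>n. t (Suc n)) \<longlonglongrightarrow> 0" using t(2) by (rule LIMSEQ_Suc)
  have tp: "0 < t (Suc n)" for n by (rule t(1)) simp
  have fe: "0 < measure (PiM {1..p} (\<lambda>_. D)) {x \<in> space (PiM {1..p} (\<lambda>_. D)). forms_copy (t (Suc 0)) \<Gamma>' x {1..p}}"
    by (rule copy_probability_pos[OF G(1,3,4) feas]) simp
  obtain L where L: "0 < L" "(\<lambda>n. measure (PiM {1..p} (\<lambda>_. D))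
      {x \<in> space (PiM {1..p} (\<lambda>_. D)). forms_copy (t (Suc n)) \<Gamma>' x {1..p}} / t (Suc n) ^ (DIM('a) * (p - 1))) \<longlonglongrightarrow> L"
    by (rule copy_probability_scaling[OF f(3) f(1) f_le D_prob G tp lim fe])
  from LIMSEQ_imp_Suc[of "\<lambda>n. measure (PiM {1..p} (\<lambda>_. D))
      {x \<in> space (PiM {1..p} (\<lambda>_. D)). forms_copy (t n) \<Gamma>' x {1..p}} / t n ^ (DIM('a) * (p - 1))", OF L(2)] L(1)
  show thesis by (intro that[of L]) (simp_all add: power_mult)
qed

definition ratio :: "nat \<Rightarrow> real" where
  "ratio n = t n ^ DIM('a) * real n powr (real k / (real k - 1))"

lemma ratio_tendsto: "ratio \<longlonglongrightarrow> 1"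
proof -
  have "\<forall>\<^sub>F n in sequentially. (if t n ^ DIM('a) = 0 \<and> real n powr - (real k / (real k - 1)) = 0 then 1
      else t n ^ DIM('a) / real n powr - (real k / (real k - 1))) = ratio n"
    using eventually_ge_at_top[of 1]
    by eventually_elim (use t(1) in \<open>auto simp: ratio_def powr_minus field_simps\<close>)
  with regime show ?thesis unfolding asymp_equiv_def by (rule Lim_transform_eventually)
qed

text \<open>
  A bound on the probability of a ball of radius \<open>2 k t\<close>.
\<close>

definition q :: "nat \<Rightarrow> real" where
  "q n = f_max * (unit_ball_vol (real DIM('a)) * (2 * real k * t n) ^ DIM('a))"

definition excess :: "nat \<Rightarrow> real" where "excess n = exp (3 * real n * q n) - 1"

lemma sample: "1 \<le> n \<Longrightarrow> disk_sample D (real n) (t n) (q n) k0 k \<Gamma>\<^sub>0 \<Gamma>"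
proof -
  assume n: "1 \<le> n"
  have "poisson_sample D (real n)"
    using n by (intro poisson_sample.intro D_prob poisson_sample_axioms.intro) simp
  moreover have "measure D (cball x (2 * real k * t n)) \<le> q n" for x
    unfolding q_def using t(1)[OF n] by (intro measure_density_cball_le f_meas f_le f_max_nonneg) simp
  ultimately show ?thesis
    using t(1)[OF n] k G0(1-3) G(1-3) non_iso
    by (intro disk_sample.intro disk_sample_axioms.intro) auto
qed

text \<open>
  Independence of the number and the sequence of the points makes their joint law a product.
\<close>

lemma joint_law:
  assumes n: "1 \<le> n"
  shows "(\<lambda>\<omega>. (N n \<omega>, \<lambda>i\<in>{1..}. Y i \<omega>)) \<in> measurable M (poisson_sample.\<Omega> D (real n))" (is ?meas)
    and "distr M (poisson_sample.\<Omega> D (real n)) (\<lambda>\<omega>. (N n \<omega>, \<lambda>i\<in>{1..}. Y i \<omega>)) = poisson_sample.\<Omega> D (real n)" (is ?law)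
proof -
  interpret S: disk_sample D "real n" "t n" "q n" k0 k \<Gamma>\<^sub>0 \<Gamma> by (rule sample[OF n])
  have se: "sets S.\<Omega> = sets (count_space UNIV \<Otimes>\<^sub>M PiM {1..} (\<lambda>_. borel))"
    unfolding S.\<Omega>_def S.Q_def by (intro sets_pair_measure_cong sets_PiM_cong) auto
  have m: "N n \<in> measurable M (count_space UNIV)" "(\<lambda>\<omega>. \<lambda>i\<in>{1..}. Y i \<omega>) \<in> measurable M (PiM {1..} (\<lambda>_. borel))"
    using N_indep[OF n] unfolding indep_rv_def by auto
  show ?meas using measurable_Pair[OF m] by (simp only: measurable_cong_sets[OF refl se])
  have "distr M S.\<Omega> (\<lambda>\<omega>. (N n \<omega>, \<lambda>i\<in>{1..}. Y i \<omega>))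
    = distr M (count_space UNIV \<Otimes>\<^sub>M PiM {1..} (\<lambda>_. borel)) (\<lambda>\<omega>. (N n \<omega>, \<lambda>i\<in>{1..}. Y i \<omega>))"
    using se by (intro distr_cong) auto
  also have "\<dots> = S.\<Omega>"
    unfolding indep_rv_distr[OF M N_indep[OF n]] N_poisson[OF n] S.\<Omega>_def S.Q_def by (subst Y_law) auto
  finally show ?law .
qed

lemma disk_count_eq: "pair_graph \<Gamma>' \<Longrightarrow>
    disk_count Y N t \<Gamma>' n \<omega> = card (copies (t n) \<Gamma>' (\<lambda>i. Y i \<omega>) {1..N n \<omega>})"
  unfolding disk_count_def by (rule induced_count_eq_card_copies)

lemma mean_count_formula:
  assumes n: "1 \<le> n"
  shows "mean_count M Y N t (\<Gamma> j) n = real n ^ k / fact k *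
      measure (PiM {1..k} (\<lambda>_. D)) {x \<in> space (PiM {1..k} (\<lambda>_. D)). forms_copy (t n) (\<Gamma> j) x {1..k}}"
    and "mean_count M Y N t \<Gamma>\<^sub>0 n = real n ^ k0 / fact k0 *
      measure (PiM {1..k0} (\<lambda>_. D)) {x \<in> space (PiM {1..k0} (\<lambda>_. D)). forms_copy (t n) \<Gamma>\<^sub>0 x {1..k0}}"
proof -
  interpret S: disk_sample D "real n" "t n" "q n" k0 k \<Gamma>\<^sub>0 \<Gamma> by (rule sample[OF n])
  note ci = S.counts_integral[OF joint_law[OF n]]
  have "mean_count M Y N t (\<Gamma> j) n = S.mean j"
    unfolding mean_count_def S.mean_def disk_count_eq[OF G(1)]
    using ci[of "\<lambda>c. real (fst c $ j)"] by (simp only: S.counts_def fst_conv vec_lambda_beta)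
  then show "mean_count M Y N t (\<Gamma> j) n = real n ^ k / fact k *
      measure (PiM {1..k} (\<lambda>_. D)) {x \<in> space (PiM {1..k} (\<lambda>_. D)). forms_copy (t n) (\<Gamma> j) x {1..k}}"
    unfolding S.mean_eq .
  have "mean_count M Y N t \<Gamma>\<^sub>0 n = S.mean0"
    unfolding mean_count_def S.mean0_def disk_count_eq[OF G0(1)]
    using ci[of "\<lambda>c. real (snd c)"] by (simp only: S.counts_def snd_conv)
  then show "mean_count M Y N t \<Gamma>\<^sub>0 n = real n ^ k0 / fact k0 *
      measure (PiM {1..k0} (\<lambda>_. D)) {x \<in> space (PiM {1..k0} (\<lambda>_. D)). forms_copy (t n) \<Gamma>\<^sub>0 x {1..k0}}"
    unfolding S.mean0_eq .
qed

lemma mean_count_pos: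
  assumes n: "1 \<le> n"
  shows "0 < mean_count M Y N t (\<Gamma> j) n" "0 < mean_count M Y N t \<Gamma>\<^sub>0 n"
proof -
  have k1: "1 \<le> k" "1 \<le> k0" using k by auto
  show "0 < mean_count M Y N t (\<Gamma> j) n" unfolding mean_count_formula(1)[OF n]
    using copy_probability_pos[OF G(1) G(3) k1(1) G(4) n] n by simp
  show "0 < mean_count M Y N t \<Gamma>\<^sub>0 n" unfolding mean_count_formula(2)[OF n]
    using copy_probability_pos[OF G0(1) G0(3) k1(2) G0(4) n] n by simp
qed

lemma mean_count_limit:
  assumes G: "pair_graph \<Gamma>'" "Digraph_Component.connected (with_proj \<Gamma>')" "card (pverts \<Gamma>') = p" "1 \<le> p"
    "feasible M Y t \<Gamma>'"
    and formula: "\<And>n. 1 \<le> n \<Longrightarrow> m n = real n ^ p / fact p *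
      measure (PiM {1..p} (\<lambda>_. D)) {x \<in> space (PiM {1..p} (\<lambda>_. D)). forms_copy (t n) \<Gamma>' x {1..p}}"
  obtains L where "0 < L" "(\<lambda>n. m n / real n powr ((real k - real p) / (real k - 1))) \<longlonglongrightarrow> L"
proof -
  obtain L where L: "0 < L" "(\<lambda>n. measure (PiM {1..p} (\<lambda>_. D))
      {x \<in> space (PiM {1..p} (\<lambda>_. D)). forms_copy (t n) \<Gamma>' x {1..p}} / (t n ^ DIM('a)) ^ (p - 1)) \<longlonglongrightarrow> L"
    by (rule copy_probability_limit[OF G])
  define P where "P n = measure (PiM {1..p} (\<lambda>_. D))
      {x \<in> space (PiM {1..p} (\<lambda>_. D)). forms_copy (t n) \<Gamma>' x {1..p}}" for n
  have "(\<lambda>n. 1 / fact p * (P n / (t n ^ DIM('a)) ^ (p - 1)) * ratio n ^ (p - 1)) \<longlonglongrightarrow> 1 / fact p * L * 1 ^ (p - 1)"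
    unfolding P_def by (intro tendsto_mult tendsto_const L tendsto_power ratio_tendsto)
  moreover have "\<forall>\<^sub>F n in sequentially. 1 / fact p * (P n / (t n ^ DIM('a)) ^ (p - 1)) * ratio n ^ (p - 1)
      = m n / real n powr ((real k - real p) / (real k - 1))"
    using eventually_ge_at_top[of 1]
  proof eventually_elim
    case (elim n)
    have k2: "2 \<le> k" using k by simp
    let ?w = "real n powr ((real k - real p) / (real k - 1))" and ?T = "(t n ^ DIM('a)) ^ (p - 1)"
    have w: "0 < ?w" and T: "0 < ?T" using elim t(1)[OF elim] by auto
    have "real n ^ p * ?T = ratio n ^ (p - 1) * ?w"
      unfolding ratio_def by (rule regime_power[OF elim k2 G(4)])
    then have "real n ^ p = ratio n ^ (p - 1) * ?w / ?T" by (rule eq_divide_imp[OF less_imp_neq[OF T, symmetric]])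
    then have "m n = (ratio n ^ (p - 1) * ?w / ?T) / fact p * P n"
      unfolding formula[OF elim] P_def by simp
    then show ?case using w by (simp add: ac_simps)
  qed
  ultimately have "(\<lambda>n. m n / real n powr ((real k - real p) / (real k - 1))) \<longlonglongrightarrow> 1 / fact p * L * 1 ^ (p - 1)"
    by (rule Lim_transform_eventually)
  then show thesis using L(1) by (intro that[of "1 / fact p * L * 1 ^ (p - 1)"]) auto
qed

definition V :: "nat \<Rightarrow> 'w \<Rightarrow> (nat ^ 'd) \<times> real" where
  "V n \<omega> = ((\<chi> j. disk_count Y N t (\<Gamma> j) n \<omega>), normalized_count M Y N t \<Gamma>\<^sub>0 n \<omega>)"

definition lam :: "nat \<Rightarrow> real ^ 'd" where
  "lam n = (\<chi> j. mean_count M Y N t (\<Gamma> j) n)"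

lemma sample_bounds:
  assumes n: "1 \<le> n"
  shows V_measurable: "V n \<in> measurable M (count_space UNIV \<Otimes>\<^sub>M borel)"
    and V_mixed_bound: "\<And>\<psi>. \<psi> \<in> H1 \<Longrightarrow> \<bar>(\<integral>\<omega>. \<psi> (V n \<omega>) \<partial>M)
        - (\<integral>x. measure_pmf.expectation (poisson_vec_pmf (lam n)) (\<lambda>v. \<psi> (v, x)) * \<rho> x \<partial>lborel)\<bar>
      \<le> (\<Sum>j\<in>UNIV. lam n $ j * exp (lam n $ j) * (4 * excess n + 2 / sqrt (mean_count M Y N t \<Gamma>\<^sub>0 n) * 2 ^ k))
        + (8 * 2 ^ k0 * excess n + 8 * 4 ^ k0 * (1 + excess n) / sqrt (mean_count M Y N t \<Gamma>\<^sub>0 n))"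
    and V_total_variation_bound: "\<And>E. \<bar>measure M {\<omega> \<in> space M. fst (V n \<omega>) \<in> E} - measure (measure_pmf (poisson_vec_pmf (lam n))) E\<bar>
      \<le> (\<Sum>j\<in>UNIV. lam n $ j * exp (lam n $ j) * (4 * excess n))"
proof -
  interpret S: disk_sample D "real n" "t n" "q n" k0 k \<Gamma>\<^sub>0 \<Gamma> by (rule sample[OF n])
  let ?c = "\<lambda>\<omega>. S.counts (\<lambda>i. Y i \<omega>) {1..N n \<omega>}"
  note ci = S.counts_integral[OF joint_law[OF n]]
  have mc: "?c \<in> measurable M (count_space UNIV)" by (rule S.counts_measurable[OF joint_law[OF n]])
  have c1: "fst (?c \<omega>) = (\<chi> j. disk_count Y N t (\<Gamma> j) n \<omega>)" for \<omega>
    by (simp only: S.counts_def fst_conv disk_count_eq[OF G(1)])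
  have c2: "snd (?c \<omega>) = disk_count Y N t \<Gamma>\<^sub>0 n \<omega>" for \<omega>
    by (simp only: S.counts_def snd_conv disk_count_eq[OF G0(1)])
  have m0: "mean_count M Y N t \<Gamma>\<^sub>0 n = S.mean0"
    unfolding mean_count_formula(2)[OF n] S.mean0_eq ..
  have mj: "lam n $ j = S.mean j" for j
    unfolding lam_def vec_lambda_beta mean_count_formula(1)[OF n] S.mean_eq ..
  have v0: "var_count M Y N t \<Gamma>\<^sub>0 n = S.var0"
    unfolding var_count_def S.var0_def m0 c2[symmetric]
    using ci[of "\<lambda>c. (real (snd c) - S.mean0)\<^sup>2"] by (simp only: S.counts_def snd_conv)
  define W where "W c = (fst c, (real (snd c) - S.mean0) / sqrt S.var0)" for c :: "(nat ^ 'd) \<times> nat"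
  have VW: "V n \<omega> = W (?c \<omega>)" for \<omega>
    unfolding V_def W_def normalized_count_def m0 v0 c1 c2 ..
  have ex: "excess n = S.excess" by (simp only: excess_def S.excess_def)
  have pos: "0 < S.mean j" "0 < S.mean0" for j
    using mean_count_pos[OF n] mj m0 by (simp_all add: lam_def)
  have "(\<lambda>\<omega>. W (?c \<omega>)) \<in> measurable M (count_space UNIV \<Otimes>\<^sub>M borel)"
    by (rule measurable_compose[OF mc]) (simp add: space_pair_measure)
  then show "V n \<in> measurable M (count_space UNIV \<Otimes>\<^sub>M borel)" unfolding VW[symmetric] .
  fix \<psi> :: "(nat ^ 'd) \<times> real \<Rightarrow> real" assume \<psi>: "\<psi> \<in> H1"
  have "(\<integral>\<omega>. \<psi> (V n \<omega>) \<partial>M) = S.expect (\<lambda>i y. \<psi> (W (S.counts y {1..i})))"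
    unfolding VW by (rule ci)
  then show "\<bar>(\<integral>\<omega>. \<psi> (V n \<omega>) \<partial>M)
        - (\<integral>x. measure_pmf.expectation (poisson_vec_pmf (lam n)) (\<lambda>v. \<psi> (v, x)) * \<rho> x \<partial>lborel)\<bar>
      \<le> (\<Sum>j\<in>UNIV. lam n $ j * exp (lam n $ j) * (4 * excess n + 2 / sqrt (mean_count M Y N t \<Gamma>\<^sub>0 n) * 2 ^ k))
        + (8 * 2 ^ k0 * excess n + 8 * 4 ^ k0 * (1 + excess n) / sqrt (mean_count M Y N t \<Gamma>\<^sub>0 n))"
    unfolding W_def m0 ex mj using S.mixed_bound[OF \<psi> pos mj] by (simp only:)
next
  interpret S: disk_sample D "real n" "t n" "q n" k0 k \<Gamma>\<^sub>0 \<Gamma> by (rule sample[OF n])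
  fix E :: "(nat ^ 'd) set"
  let ?c = "\<lambda>\<omega>. S.counts (\<lambda>i. Y i \<omega>) {1..N n \<omega>}"
  have c1: "fst (V n \<omega>) = fst (?c \<omega>)" for \<omega>
    by (simp only: V_def S.counts_def fst_conv disk_count_eq[OF G(1)])
  have mj: "lam n $ j = S.mean j" for j
    unfolding lam_def vec_lambda_beta mean_count_formula(1)[OF n] S.mean_eq ..
  have pos: "0 < S.mean j" for j using mean_count_pos(1)[OF n] mj by (simp add: lam_def)
  have ex: "excess n = S.excess" by (simp only: excess_def S.excess_def)
  have "(\<lambda>\<omega>. fst (V n \<omega>)) \<in> measurable M (count_space UNIV)"
    unfolding c1 by (rule measurable_compose[OF S.counts_measurable[OF joint_law[OF n]]]) simp
  from measurable_sets[OF this, of E] have "{\<omega> \<in> space M. fst (V n \<omega>) \<in> E} \<in> sets M"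
    by (simp add: vimage_def Int_def conj_commute)
  then have "measure M {\<omega> \<in> space M. fst (V n \<omega>) \<in> E} = (\<integral>\<omega>. indicator {\<omega> \<in> space M. fst (V n \<omega>) \<in> E} \<omega> \<partial>M)"
    by simp
  also have "\<dots> = (\<integral>\<omega>. indicator E (fst (?c \<omega>)) \<partial>M)"
    by (intro Bochner_Integration.integral_cong) (auto simp: indicator_def c1)
  also have "\<dots> = S.expect (\<lambda>i y. indicator E (fst (S.counts y {1..i})))"
    by (rule S.counts_integral[OF joint_law[OF n]])
  finally show "\<bar>measure M {\<omega> \<in> space M. fst (V n \<omega>) \<in> E} - measure (measure_pmf (poisson_vec_pmf (lam n))) E\<bar>
      \<le> (\<Sum>j\<in>UNIV. lam n $ j * exp (lam n $ j) * (4 * excess n))"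
    unfolding ex mj using S.total_variation_bound[OF pos mj, of E] by (simp only:)
qed

end

section \<open>Rates of convergence\<close>

lemma convergent_imp_bounded_above:
  fixes x :: "nat \<Rightarrow> real"
  assumes "x \<longlonglongrightarrow> l"
  obtains K where "0 < K" "\<And>n. x n \<le> K"
proof -
  have "Bseq x" using assms by (intro convergent_imp_Bseq) (auto simp: convergent_def)
  then obtain K where "0 < K" "\<And>n. norm (x n) \<le> K" unfolding Bseq_def by blast
  then show thesis by (intro that[of K]) (auto intro: order_trans[OF abs_ge_self])
qed

lemma exp_minus_one_le: "exp x - 1 \<le> x * exp (x::real)"
proof -
  have "(1 - x) * exp x \<le> exp (- x) * exp x"
    using exp_ge_add_one_self[of "- x"] by (intro mult_right_mono) auto
  then show ?thesis by (simp add: mult_exp_exp algebra_simps)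
qed

context random_disk_graphs
begin

text \<open>
  Up to a constant factor, this bounds the mean number of neighbours of a vertex.
\<close>

definition degree_scale :: "nat \<Rightarrow> real" where "degree_scale n = real n * t n ^ DIM('a)"

lemma degree_scale_pos: "1 \<le> n \<Longrightarrow> 0 < degree_scale n"
  using t(1)[of n] by (simp add: degree_scale_def)

lemma degree_scale_eq: "1 \<le> n \<Longrightarrow> degree_scale n = ratio n * real n powr (- (1 / (real k - 1)))"
  unfolding degree_scale_def ratio_def using k by (intro regime_density) auto

lemma degree_scale_tendsto: "degree_scale \<longlonglongrightarrow> 0"
proof -
  have "(\<lambda>n. ratio n * real n powr (- (1 / (real k - 1)))) \<longlonglongrightarrow> 1 * 0"
    using k by (intro tendsto_mult ratio_tendsto tendsto_neg_powr filterlim_real_sequentially) auto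
  moreover have "\<forall>\<^sub>F n in sequentially. ratio n * real n powr (- (1 / (real k - 1))) = degree_scale n"
    using eventually_ge_at_top[of 1] by eventually_elim (simp add: degree_scale_eq)
  ultimately show ?thesis using Lim_transform_eventually by fastforce
qed

text \<open>
  The product \<open>n q n\<close> is a multiple of \<open>n t ^ m\<close>, which tends to \<open>0\<close>, so \<open>excess n\<close> is \<open>O (n t ^ m)\<close>
  and, being bounded, also \<open>O (sqrt (n t ^ m))\<close>.
\<close>

lemma excess_bounds:
  obtains C C' where "0 \<le> C" "0 \<le> C'" "\<And>n. 1 \<le> n \<Longrightarrow> 0 \<le> excess n"
    "\<And>n. 1 \<le> n \<Longrightarrow> excess n \<le> C * sqrt (degree_scale n)" "\<And>n. 1 \<le> n \<Longrightarrow> excess n \<le> C'"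
proof -
  obtain E where E: "0 < E" "\<And>n. degree_scale n \<le> E"
    using convergent_imp_bounded_above[OF degree_scale_tendsto] by blast
  define c where "c = 3 * f_max * unit_ball_vol (real DIM('a)) * (2 * real k) ^ DIM('a)"
  have c0: "0 \<le> c" unfolding c_def using f_max_nonneg by simp
  have ex: "excess n = exp (c * degree_scale n) - 1" for n
    unfolding excess_def q_def c_def degree_scale_def by (simp add: power_mult_distrib ac_simps)
  have "0 \<le> excess n \<and> excess n \<le> c * exp (c * E) * sqrt E * sqrt (degree_scale n)
      \<and> excess n \<le> c * exp (c * E) * E" if n: "1 \<le> n" for n
  proof -
    have d: "0 \<le> degree_scale n" using degree_scale_pos[OF n] by simp
    have "excess n \<le> (c * degree_scale n) * exp (c * degree_scale n)" unfolding ex by (rule exp_minus_one_le)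
    also have "\<dots> \<le> (c * degree_scale n) * exp (c * E)" using c0 d E(2)[of n] by (intro mult_left_mono) (auto intro: mult_left_mono)
    finally have 1: "excess n \<le> c * exp (c * E) * degree_scale n" by (simp add: ac_simps)
    have "degree_scale n = sqrt (degree_scale n) * sqrt (degree_scale n)" using d by simp
    also have "\<dots> \<le> sqrt E * sqrt (degree_scale n)" using E(2)[of n] d by (intro mult_right_mono) auto
    finally have 2: "degree_scale n \<le> sqrt E * sqrt (degree_scale n)" .
    have cE: "0 \<le> c * exp (c * E)" using c0 by simp
    show ?thesis
      using order_trans[OF 1 mult_left_mono[OF 2 cE]] order_trans[OF 1 mult_left_mono[OF E(2) cE]] c0 d
      by (simp add: ex mult.assoc)
  qed
  then show thesis using c0 E(1)
    by (intro that[of "c * exp (c * E) * sqrt E" "c * exp (c * E) * E"]) auto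
qed

lemma mean_limits:
  obtains a :: "real ^ 'd" and \<Lambda> :: real where "\<And>j. 0 < a $ j" "\<And>j. (\<lambda>n. mean_count M Y N t (\<Gamma> j) n) \<longlonglongrightarrow> a $ j"
    "0 < \<Lambda>" "\<And>n j. mean_count M Y N t (\<Gamma> j) n \<le> \<Lambda>"
proof -
  have "\<exists>L. 0 < L \<and> (\<lambda>n. mean_count M Y N t (\<Gamma> j) n) \<longlonglongrightarrow> L" for j
  proof -
    have k1: "1 \<le> k" using k by simp
    obtain L where L: "0 < L" "(\<lambda>n. mean_count M Y N t (\<Gamma> j) n / real n powr ((real k - real k) / (real k - 1))) \<longlonglongrightarrow> L"
      by (rule mean_count_limit[OF G(1,2,3) k1 G(4) mean_count_formula(1)])
    have "\<forall>\<^sub>F n in sequentially. mean_count M Y N t (\<Gamma> j) n / real n powr ((real k - real k) / (real k - 1))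
        = mean_count M Y N t (\<Gamma> j) n"
      using eventually_ge_at_top[of 1] by eventually_elim simp
    from Lim_transform_eventually[OF L(2) this] L(1) show ?thesis by blast
  qed
  then obtain L where L: "\<And>j. 0 < L j" "\<And>j. (\<lambda>n. mean_count M Y N t (\<Gamma> j) n) \<longlonglongrightarrow> L j" by metis
  have "\<exists>K>0. \<forall>n. mean_count M Y N t (\<Gamma> j) n \<le> K" for j
    using convergent_imp_bounded_above[OF L(2)[of j]] by metis
  then obtain K where K: "\<And>j. 0 < K j" "\<And>j n. mean_count M Y N t (\<Gamma> j) n \<le> K j" by metis
  have "K j \<le> (\<Sum>j\<in>UNIV. K j)" for j using K(1) by (intro member_le_sum) (auto intro: less_imp_le)
  then have "mean_count M Y N t (\<Gamma> j) n \<le> (\<Sum>j\<in>UNIV. K j)" for j n using K(2) order_trans by blast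
  moreover have "0 < (\<Sum>j\<in>UNIV. K j)" using K(1) by (intro sum_pos) auto
  ultimately show thesis using L by (intro that[of "\<chi> j. L j"]) auto
qed

text \<open>
  The mean of the count of \<open>\<Gamma>\<^sub>0\<close> divided by \<open>n powr ((k - k0) / (k - 1))\<close> has a positive limit.
\<close>

lemma inverse_sd_bound:
  obtains c where "0 \<le> c" "\<And>n. 1 \<le> n \<Longrightarrow> 1 / sqrt (mean_count M Y N t \<Gamma>\<^sub>0 n)
      \<le> c * real n powr (- ((real k - real k0) / (2 * (real k - 1))))"
proof -
  let ?m = "mean_count M Y N t \<Gamma>\<^sub>0"
  define v where "v = (real k - real k0) / (real k - 1)"
  have k1: "1 \<le> k0" using k by simp
  obtain L where L: "0 < L" "(\<lambda>n. ?m n / real n powr v) \<longlonglongrightarrow> L"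
    unfolding v_def by (rule mean_count_limit[OF G0(1,2,3) k1 G0(4) mean_count_formula(2)])
  have "(\<lambda>n. inverse (?m n / real n powr v)) \<longlonglongrightarrow> inverse L" using L by (intro tendsto_inverse) auto
  then obtain K where K: "0 < K" "\<And>n. inverse (?m n / real n powr v) \<le> K"
    using convergent_imp_bounded_above by blast
  have "1 / sqrt (?m n) \<le> sqrt K * real n powr (- ((real k - real k0) / (2 * (real k - 1))))" if n: "1 \<le> n" for n
  proof -
    have m: "0 < ?m n" by (rule mean_count_pos(2)[OF n])
    have "1 / ?m n = inverse (?m n / real n powr v) * real n powr (- v)"
      using m n by (simp add: powr_minus field_simps)
    also have "\<dots> \<le> K * real n powr (- v)" using K(2) by (rule mult_right_mono) simp
    finally have "sqrt (1 / ?m n) \<le> sqrt (K * real n powr (- v))" by (rule real_sqrt_le_mono)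
    also have "\<dots> = sqrt K * real n powr (- ((real k - real k0) / (2 * (real k - 1))))"
      using n by (simp add: real_sqrt_mult powr_half_sqrt[symmetric] powr_powr v_def divide_simps mult.commute)
    finally show ?thesis by (simp add: real_sqrt_divide)
  qed
  then show thesis using K(1) by (intro that[of "sqrt K"]) auto
qed

lemma sqrt_degree_scale_le: 
  obtains R where "0 \<le> R" "\<And>n. 1 \<le> n \<Longrightarrow> sqrt (degree_scale n) \<le> R * real n powr (- (1 / (2 * (real k - 1))))"
proof -
  obtain K where K: "0 < K" "\<And>n. ratio n \<le> K" using convergent_imp_bounded_above[OF ratio_tendsto] by blast
  have "sqrt (degree_scale n) \<le> sqrt K * real n powr (- (1 / (2 * (real k - 1))))" if n: "1 \<le> n" for n
  proof -
    have "degree_scale n \<le> K * real n powr (- (1 / (real k - 1)))"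
      unfolding degree_scale_eq[OF n] using K(2) by (rule mult_right_mono) simp
    then have "sqrt (degree_scale n) \<le> sqrt (K * real n powr (- (1 / (real k - 1))))" by (rule real_sqrt_le_mono)
    also have "\<dots> = sqrt K * real n powr (- (1 / (2 * (real k - 1))))"
      using n by (simp add: real_sqrt_mult powr_half_sqrt[symmetric] powr_powr divide_simps mult.commute)
    finally show ?thesis .
  qed
  then show thesis using K(1) by (intro that[of "sqrt K"]) auto
qed

text \<open>
  The error is of order \<open>excess n + 1 / \<sigma>\<close>; the exponent \<open>(k - k0) / (2 (k - 1))\<close> of the bound on
  \<open>1 / \<sigma>\<close> is twice the one stated.
\<close>

lemma mixed_rate:
  obtains A B where "\<And>n \<psi>. 1 \<le> n \<Longrightarrow> \<psi> \<in> H1 \<Longrightarrow> \<bar>(\<integral>\<omega>. \<psi> (V n \<omega>) \<partial>M)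
        - (\<integral>x. measure_pmf.expectation (poisson_vec_pmf (lam n)) (\<lambda>v. \<psi> (v, x)) * \<rho> x \<partial>lborel)\<bar>
      \<le> A * sqrt (degree_scale n) + B * real n powr (- ((real k - real k0) / (4 * (real k - 1))))"
proof -
  obtain C C' where C: "0 \<le> C" "0 \<le> C'" "\<And>n. 1 \<le> n \<Longrightarrow> 0 \<le> excess n"
    "\<And>n. 1 \<le> n \<Longrightarrow> excess n \<le> C * sqrt (degree_scale n)" "\<And>n. 1 \<le> n \<Longrightarrow> excess n \<le> C'"
    using excess_bounds by blast
  obtain a \<Lambda> where \<Lambda>: "0 < \<Lambda>" "\<And>n j. mean_count M Y N t (\<Gamma> j) n \<le> \<Lambda>" using mean_limits by metis
  obtain c where c: "0 \<le> c" "\<And>n. 1 \<le> n \<Longrightarrow> 1 / sqrt (mean_count M Y N t \<Gamma>\<^sub>0 n)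
      \<le> c * real n powr (- ((real k - real k0) / (2 * (real k - 1))))" using inverse_sd_bound by blast
  define W where "W = real CARD('d) * (\<Lambda> * exp \<Lambda>)"
  define A where "A = W * 4 * C + 8 * 2 ^ k0 * C"
  define B where "B = W * 2 * 2 ^ k * c + 8 * 4 ^ k0 * (1 + C') * c"
  show thesis
  proof (rule that[of A B])
    fix n :: nat and \<psi> assume n: "1 \<le> n" and \<psi>: "(\<psi> :: (nat ^ 'd) \<times> real \<Rightarrow> real) \<in> H1"
    define s where "s = sqrt (degree_scale n)"
    define i where "i = 1 / sqrt (mean_count M Y N t \<Gamma>\<^sub>0 n)"
    define w where "w = real n powr (- ((real k - real k0) / (4 * (real k - 1))))"
    have ex: "0 \<le> excess n" "excess n \<le> C * s" "excess n \<le> C'" using C n by (auto simp: s_def)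
    have i0: "0 \<le> i" using mean_count_pos(2)[OF n] by (simp add: i_def less_imp_le)
    have i: "i \<le> c * w"
    proof -
      have "(real k - real k0) / (4 * (real k - 1)) \<le> (real k - real k0) / (2 * (real k - 1))"
        using k by (intro divide_left_mono) auto
      then have "real n powr (- ((real k - real k0) / (2 * (real k - 1)))) \<le> w"
        unfolding w_def using n by (intro powr_mono) auto
      then show ?thesis using c(2)[OF n] c(1) unfolding i_def
        by (meson mult_left_mono order_trans)
    qed
    have summand: "lam n $ j * exp (lam n $ j) * (4 * excess n + 2 * i * 2 ^ k) \<le> (\<Lambda> * exp \<Lambda>) * (4 * (C * s) + 2 * (c * w) * 2 ^ k)" for j
    proof (intro mult_mono add_mono)
      show "lam n $ j \<le> \<Lambda>" "exp (lam n $ j) \<le> exp \<Lambda>" using \<Lambda>(2) by (auto simp: lam_def)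
    qed (use \<Lambda> ex i i0 in \<open>auto intro: less_imp_le add_nonneg_nonneg\<close>)
    have "(\<Sum>j\<in>UNIV. lam n $ j * exp (lam n $ j) * (4 * excess n + 2 / sqrt (mean_count M Y N t \<Gamma>\<^sub>0 n) * 2 ^ k))
        \<le> (\<Sum>j\<in>(UNIV :: 'd set). (\<Lambda> * exp \<Lambda>) * (4 * (C * s) + 2 * (c * w) * 2 ^ k))"
      using summand unfolding i_def by (intro sum_mono) simp
    also have "\<dots> = W * (4 * (C * s) + 2 * (c * w) * 2 ^ k)" unfolding W_def by simp
    finally have 1: "(\<Sum>j\<in>UNIV. lam n $ j * exp (lam n $ j) * (4 * excess n + 2 / sqrt (mean_count M Y N t \<Gamma>\<^sub>0 n) * 2 ^ k)) \<le> \<dots>" .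
    have "8 * 2 ^ k0 * excess n + 8 * 4 ^ k0 * (1 + excess n) / sqrt (mean_count M Y N t \<Gamma>\<^sub>0 n)
      = 8 * 2 ^ k0 * excess n + 8 * 4 ^ k0 * (1 + excess n) * i" by (simp add: i_def)
    also have "\<dots> \<le> 8 * 2 ^ k0 * (C * s) + 8 * 4 ^ k0 * (1 + C') * (c * w)"
      using ex i i0 C(2) by (intro add_mono mult_mono mult_left_mono) auto
    finally have 2: "8 * 2 ^ k0 * excess n + 8 * 4 ^ k0 * (1 + excess n) / sqrt (mean_count M Y N t \<Gamma>\<^sub>0 n) \<le> \<dots>" .
    have "\<bar>(\<integral>\<omega>. \<psi> (V n \<omega>) \<partial>M)
        - (\<integral>x. measure_pmf.expectation (poisson_vec_pmf (lam n)) (\<lambda>v. \<psi> (v, x)) * \<rho> x \<partial>lborel)\<bar>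
      \<le> W * (4 * (C * s) + 2 * (c * w) * 2 ^ k) + (8 * 2 ^ k0 * (C * s) + 8 * 4 ^ k0 * (1 + C') * (c * w))"
      by (rule order_trans[OF V_mixed_bound[OF n \<psi>] add_mono[OF 1 2]])
    also have "\<dots> = A * s + B * w" unfolding A_def B_def by (simp add: algebra_simps)
    finally show "\<bar>(\<integral>\<omega>. \<psi> (V n \<omega>) \<partial>M)
        - (\<integral>x. measure_pmf.expectation (poisson_vec_pmf (lam n)) (\<lambda>v. \<psi> (v, x)) * \<rho> x \<partial>lborel)\<bar>
      \<le> A * sqrt (degree_scale n) + B * real n powr (- ((real k - real k0) / (4 * (real k - 1))))"
      unfolding s_def w_def .
  qed
qed

lemma total_variation_rate:
  obtains C where "\<And>n E. 1 \<le> n \<Longrightarrow>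
    \<bar>measure M {\<omega> \<in> space M. fst (V n \<omega>) \<in> E} - measure (measure_pmf (poisson_vec_pmf (lam n))) E\<bar> \<le> C * sqrt (degree_scale n)"
proof -
  obtain C C' where C: "0 \<le> C" "0 \<le> C'" "\<And>n. 1 \<le> n \<Longrightarrow> 0 \<le> excess n"
    "\<And>n. 1 \<le> n \<Longrightarrow> excess n \<le> C * sqrt (degree_scale n)" "\<And>n. 1 \<le> n \<Longrightarrow> excess n \<le> C'"
    using excess_bounds by blast
  obtain a \<Lambda> where \<Lambda>: "0 < \<Lambda>" "\<And>n j. mean_count M Y N t (\<Gamma> j) n \<le> \<Lambda>" using mean_limits by metis
  show thesis
  proof (rule that[of "real CARD('d) * (\<Lambda> * exp \<Lambda> * (4 * C))"])
    fix n :: nat and E :: "(nat ^ 'd) set" assume n: "1 \<le> n"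
    have "lam n $ j * exp (lam n $ j) * (4 * excess n) \<le> (\<Lambda> * exp \<Lambda>) * (4 * (C * sqrt (degree_scale n)))" for j
    proof (intro mult_mono)
      show "lam n $ j \<le> \<Lambda>" "exp (lam n $ j) \<le> exp \<Lambda>" using \<Lambda>(2) by (auto simp: lam_def)
    qed (use \<Lambda> C n in \<open>auto intro: less_imp_le\<close>)
    then have "(\<Sum>j\<in>UNIV. lam n $ j * exp (lam n $ j) * (4 * excess n))
      \<le> (\<Sum>j\<in>(UNIV :: 'd set). (\<Lambda> * exp \<Lambda>) * (4 * (C * sqrt (degree_scale n))))" by (intro sum_mono)
    then show "\<bar>measure M {\<omega> \<in> space M. fst (V n \<omega>) \<in> E} - measure (measure_pmf (poisson_vec_pmf (lam n))) E\<bar>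
      \<le> real CARD('d) * (\<Lambda> * exp \<Lambda> * (4 * C)) * sqrt (degree_scale n)"
      using V_total_variation_bound[OF n, of E] by (simp add: ac_simps)
  qed
qed

text \<open>
  The approximating Poisson vectors have the parameters \<open>lam n\<close>, and their laws converge in total variation to
  the one with parameter \<open>a\<close>. The index is shifted because the bounds hold from \<open>n = 1\<close> on.
\<close>

lemma limit_law:
  fixes a :: "real ^ 'd"
  assumes a: "\<And>j. 0 < a $ j" "\<And>j. (\<lambda>n. mean_count M Y N t (\<Gamma> j) n) \<longlonglongrightarrow> a $ j" and \<psi>: "\<psi> \<in> H1"
  shows "(\<lambda>n. \<integral>\<omega>. \<psi> (V (Suc n) \<omega>) \<partial>M)
    \<longlonglongrightarrow> (\<integral>x. measure_pmf.expectation (poisson_vec_pmf a) (\<lambda>v. \<psi> (v, x)) * \<rho> x \<partial>lborel)"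
proof -
  obtain A B where AB: "\<And>n \<psi>. 1 \<le> n \<Longrightarrow> \<psi> \<in> H1 \<Longrightarrow> \<bar>(\<integral>\<omega>. \<psi> (V n \<omega>) \<partial>M)
        - (\<integral>x. measure_pmf.expectation (poisson_vec_pmf (lam n)) (\<lambda>v. \<psi> (v, x)) * \<rho> x \<partial>lborel)\<bar>
      \<le> A * sqrt (degree_scale n) + B * real n powr (- ((real k - real k0) / (4 * (real k - 1))))"
    using mixed_rate by blast
  have b: "\<bar>\<psi> z\<bar> \<le> 1" for z using \<psi> unfolding H1_def by blast
  have sec: "continuous_on UNIV (\<lambda>x. \<psi> (v, x))" for v
    using \<psi> by (intro lipschitz_on_continuous_on[where L = 1]) (auto simp: H1_def)
  let ?I = "\<lambda>p. \<integral>x. measure_pmf.expectation p (\<lambda>v. \<psi> (v, x)) * \<rho> x \<partial>lborel"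
  have pl: "(\<lambda>n. pmf (poisson_vec_pmf (lam (Suc n))) v) \<longlonglongrightarrow> pmf (poisson_vec_pmf a) v" for v
    by (rule poisson_vec_pmf_tendsto)
      (use a(1) mean_count_pos(1) LIMSEQ_Suc[OF a(2)] in \<open>auto simp: lam_def\<close>)
  obtain e :: "nat \<Rightarrow> real" where e: "e \<longlonglongrightarrow> 0" "\<And>n F. (\<And>v. \<bar>F v\<bar> \<le> 1) \<Longrightarrow>
      \<bar>measure_pmf.expectation (poisson_vec_pmf (lam (Suc n))) F - measure_pmf.expectation (poisson_vec_pmf a) F\<bar> \<le> e n"
    using pmf_convergence_uniform[OF pl] by blast
  have int: "integrable lborel (\<lambda>x. measure_pmf.expectation p (\<lambda>v. \<psi> (v, x)) * \<rho> x)" for p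
  proof (rule integrable_times_rho)
    show "\<bar>measure_pmf.expectation p (\<lambda>v. \<psi> (v, x))\<bar> \<le> 1" for x by (rule pmf_expectation_bound) (rule b)
    have "1-lipschitz_on UNIV (\<lambda>x. measure_pmf.expectation p (\<lambda>v. \<psi> (v, x)))"
    proof (rule lipschitz_onI)
      fix x x' :: real
      have "\<bar>\<psi> (v, x) - \<psi> (v, x')\<bar> \<le> \<bar>x - x'\<bar>" for v
      proof -
        have "1-lipschitz_on UNIV (\<lambda>x. \<psi> (v, x))" using \<psi> by (auto simp: H1_def)
        from lipschitz_onD[OF this, of x x'] show ?thesis by (simp add: dist_real_def)
      qed
      from pmf_expectation_bound[OF this, of p "\<lambda>v. v"]
      have "\<bar>measure_pmf.expectation p (\<lambda>v. \<psi> (v, x) - \<psi> (v, x'))\<bar> \<le> \<bar>x - x'\<bar>" by simp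
      moreover have "measure_pmf.expectation p (\<lambda>v. \<psi> (v, x) - \<psi> (v, x'))
          = measure_pmf.expectation p (\<lambda>v. \<psi> (v, x)) - measure_pmf.expectation p (\<lambda>v. \<psi> (v, x'))"
        using b by (intro Bochner_Integration.integral_diff measure_pmf.integrable_const_bound[where B = 1]) auto
      ultimately show "dist (measure_pmf.expectation p (\<lambda>v. \<psi> (v, x))) (measure_pmf.expectation p (\<lambda>v. \<psi> (v, x'))) \<le> 1 * dist x x'"
        by (simp add: dist_real_def)
    qed simp
    then show "(\<lambda>x. measure_pmf.expectation p (\<lambda>v. \<psi> (v, x))) \<in> borel_measurable borel"
      by (intro borel_measurable_continuous_onI lipschitz_on_continuous_on)
  qed
  have dist: "\<bar>?I (poisson_vec_pmf (lam (Suc n))) - ?I (poisson_vec_pmf a)\<bar> \<le> e n" for n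
  proof -
    let ?d = "\<lambda>x. measure_pmf.expectation (poisson_vec_pmf (lam (Suc n))) (\<lambda>v. \<psi> (v, x)) * \<rho> x
            - measure_pmf.expectation (poisson_vec_pmf a) (\<lambda>v. \<psi> (v, x)) * \<rho> x"
    have "?I (poisson_vec_pmf (lam (Suc n))) - ?I (poisson_vec_pmf a) = (\<integral>x. ?d x \<partial>lborel)"
      by (rule Bochner_Integration.integral_diff[symmetric]) (rule int)+
    then have "\<bar>?I (poisson_vec_pmf (lam (Suc n))) - ?I (poisson_vec_pmf a)\<bar> \<le> (\<integral>x. \<bar>?d x\<bar> \<partial>lborel)"
      using integral_abs_bound[of lborel ?d] by presburger
    also have "\<dots> \<le> (\<integral>x. e n * \<rho> x \<partial>lborel)"
    proof (rule integral_mono)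
      show "integrable lborel (\<lambda>x. \<bar>measure_pmf.expectation (poisson_vec_pmf (lam (Suc n))) (\<lambda>v. \<psi> (v, x)) * \<rho> x
            - measure_pmf.expectation (poisson_vec_pmf a) (\<lambda>v. \<psi> (v, x)) * \<rho> x\<bar>)"
        by (intro integrable_abs Bochner_Integration.integrable_diff int)
      show "integrable lborel (\<lambda>x. e n * \<rho> x)" by (intro integrable_mult_right integrable_rho)
      show "\<bar>measure_pmf.expectation (poisson_vec_pmf (lam (Suc n))) (\<lambda>v. \<psi> (v, x)) * \<rho> x
            - measure_pmf.expectation (poisson_vec_pmf a) (\<lambda>v. \<psi> (v, x)) * \<rho> x\<bar> \<le> e n * \<rho> x" for x
        unfolding left_diff_distrib[symmetric] abs_mult using e(2)[of "\<lambda>v. \<psi> (v, x)" n] b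
        by (simp add: mult_right_mono)
    qed
    also have "\<dots> = e n" using std_normal_moment_even[of 0] by (simp add: has_bochner_integral_iff)
    finally show ?thesis .
  qed
  let ?r = "\<lambda>n. A * sqrt (degree_scale (Suc n)) + B * real (Suc n) powr (- ((real k - real k0) / (4 * (real k - 1)))) + e n"
  have "(\<lambda>n. A * sqrt (degree_scale (Suc n)) + B * real (Suc n) powr (- ((real k - real k0) / (4 * (real k - 1)))) + e n)
      \<longlonglongrightarrow> A * sqrt 0 + B * 0 + 0"
  proof (intro tendsto_add tendsto_mult tendsto_const tendsto_real_sqrt e(1))
    show "(\<lambda>n. degree_scale (Suc n)) \<longlonglongrightarrow> 0" by (rule LIMSEQ_Suc[OF degree_scale_tendsto])
    have "0 < (real k - real k0) / (4 * (real k - 1))" using k by simp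
    then have "- ((real k - real k0) / (4 * (real k - 1))) < 0" by (simp only: neg_less_0_iff_less)
    then have "(\<lambda>n. real n powr (- ((real k - real k0) / (4 * (real k - 1))))) \<longlonglongrightarrow> 0"
      by (rule tendsto_neg_powr[OF _ filterlim_real_sequentially])
    then show "(\<lambda>n. real (Suc n) powr (- ((real k - real k0) / (4 * (real k - 1))))) \<longlonglongrightarrow> 0"
      by (rule LIMSEQ_Suc)
  qed
  then have r0: "?r \<longlonglongrightarrow> 0" by simp
  have triangle: "\<bar>x - z\<bar> \<le> c + d" if "\<bar>x - y\<bar> \<le> c" "\<bar>y - z\<bar> \<le> d" for x y z c d :: real
    using that by linarith
  have "\<bar>(\<integral>\<omega>. \<psi> (V (Suc n) \<omega>) \<partial>M) - ?I (poisson_vec_pmf a)\<bar> \<le> ?r n" for n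
    by (rule triangle[OF AB[OF _ \<psi>] dist]) simp
  then have "(\<lambda>n. (\<integral>\<omega>. \<psi> (V (Suc n) \<omega>) \<partial>M) - ?I (poisson_vec_pmf a)) \<longlonglongrightarrow> 0"
    by (intro Lim_null_comparison[OF _ r0]) (simp only: real_norm_def eventually_True)
  then show ?thesis by (simp add: LIM_zero_iff)
qed

end

section \<open>Poisson and normal limits of the subgraph counts\<close>

theorem theorem2p6:
  fixes M :: "'w measure" and P :: "'p measure"
    and f :: "real ^ 'm \<Rightarrow> real"
    and Y :: "nat \<Rightarrow> 'w \<Rightarrow> real ^ 'm"
    and N :: "nat \<Rightarrow> 'w \<Rightarrow> nat"
    and t :: "nat \<Rightarrow> real"
    and k\<^sub>0 k :: nat
    and \<Gamma>\<^sub>0 :: "'v pair_pre_digraph"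
    and \<Gamma> :: "'d::finite \<Rightarrow> 'v pair_pre_digraph"
    and Z :: "'p \<Rightarrow> real"
    and X :: "nat \<Rightarrow> 'p \<Rightarrow> nat ^ 'd"
    and X_lim :: "'p \<Rightarrow> nat ^ 'd"
    and V' :: "nat \<Rightarrow> 'w \<Rightarrow> nat ^ 'd"
    and V :: "nat \<Rightarrow> 'w \<Rightarrow> (nat ^ 'd) \<times> real"
    and lam :: "nat \<Rightarrow> real ^ 'd"
    and a :: "real ^ 'd"
  assumes M: "prob_space M"
    and f: "\<forall>x. 0 \<le> f x" "bounded (range f)" "continuous_on UNIV f"
    and Y_density: "\<forall>i\<ge>1. distributed M lborel (Y i) (\<lambda>x. ennreal (f x))"
    and Y_indep: "prob_space.indep_vars M (\<lambda>_. borel) Y {1..}"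
    and N_poisson: "\<forall>n\<ge>1. N n \<in> measurable M (count_space UNIV) \<and>
          distr M (count_space UNIV) (N n) = measure_pmf (poisson_pmf (real n))"
    and N_indep: "\<forall>n\<ge>1. indep_rv M (count_space UNIV) (N n)
          (PiM {1..} (\<lambda>_. borel)) (\<lambda>\<omega>. \<lambda>i\<in>{1..}. Y i \<omega>)"
    and t: "\<forall>n\<ge>1. 0 < t n" "\<forall>n\<ge>1. t (Suc n) < t n" "t \<longlonglongrightarrow> 0"
    and k: "2 \<le> k\<^sub>0" "k\<^sub>0 < k"
    and regime: "(\<lambda>n. t n ^ CARD('m)) \<sim>[sequentially] (\<lambda>n. real n powr - (real k / (real k - 1)))"
    and \<Gamma>\<^sub>0: "pair_graph \<Gamma>\<^sub>0" "Digraph_Component.connected (with_proj \<Gamma>\<^sub>0)"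
          "card (pverts \<Gamma>\<^sub>0) = k\<^sub>0" "feasible M Y t \<Gamma>\<^sub>0"
    and \<Gamma>: "\<forall>j. pair_graph (\<Gamma> j)" "\<forall>j. Digraph_Component.connected (with_proj (\<Gamma> j))"
          "\<forall>j. card (pverts (\<Gamma> j)) = k" "\<forall>j. feasible M Y t (\<Gamma> j)"
    and non_iso: "\<forall>i j. i \<noteq> j \<longrightarrow> \<not> digraph_iso (with_proj (\<Gamma> i)) (with_proj (\<Gamma> j))"
    and V': "\<forall>n \<omega>. V' n \<omega> = (\<chi> j. disk_count Y N t (\<Gamma> j) n \<omega>)"
    and V: "\<forall>n \<omega>. V n \<omega> = (V' n \<omega>, normalized_count M Y N t \<Gamma>\<^sub>0 n \<omega>)"
    and lam: "\<forall>n j. lam n $ j = mean_count M Y N t (\<Gamma> j) n"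
    and a: "\<forall>j. a $ j = lim (\<lambda>n. mean_count M Y N t (\<Gamma> j) n)"
    and P: "prob_space P"
    and Z_normal: "distributed P lborel Z (\<lambda>x. ennreal (std_normal_density x))"
    and X_poisson: "\<forall>n\<ge>1. distr P (count_space UNIV) (X n) = measure_pmf (poisson_vec_pmf (lam n))"
    and X_indep: "\<forall>n\<ge>1. indep_rv P (count_space UNIV) (X n) borel Z"
    and X_lim_poisson: "distr P (count_space UNIV) X_lim = measure_pmf (poisson_vec_pmf a)"
    and X_lim_indep: "indep_rv P (count_space UNIV) X_lim borel Z"
  shows "(\<exists>A B :: real.
            (\<forall>n\<ge>1. d_H1 M (V n) P (\<lambda>\<omega>. (X n \<omega>, Z \<omega>))
               \<le> A * sqrt (real n * t n ^ CARD('m))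
                 + B * real n powr - ((real k - real k\<^sub>0) / (4 * (real k - 1)))) \<and>
            (\<lambda>n. A * sqrt (real n * t n ^ CARD('m))
                 + B * real n powr - ((real k - real k\<^sub>0) / (4 * (real k - 1))))
              \<in> O(\<lambda>n. real n powr - (1 / (2 * (real k - 1)))
                    + real n powr - ((real k - real k\<^sub>0) / (4 * (real k - 1)))))
       \<and> ((\<forall>j. (\<lambda>n. mean_count M Y N t (\<Gamma> j) n) \<longlonglongrightarrow> a $ j \<and> 0 < a $ j) \<and>
          converges_in_distribution M V P (\<lambda>\<omega>. (X_lim \<omega>, Z \<omega>)))
       \<and> (\<exists>C :: real.
            (\<forall>n\<ge>1. d_TV M (V' n) P (X n) \<le> C * sqrt (real n * t n ^ CARD('m))) \<and>
            (\<lambda>n. C * sqrt (real n * t n ^ CARD('m))) \<in> O(\<lambda>n. real n powr - (1 / (2 * (real k - 1)))))"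
proof -
  interpret R: random_disk_graphs M f Y N t k\<^sub>0 k \<Gamma>\<^sub>0 \<Gamma>
    by (rule random_disk_graphs.intro) (use assms in \<open>simp_all\<close>)
  interpret P: prob_space P by (rule P)
  have lamR: "lam n = R.lam n" for n using lam by (simp add: R.lam_def vec_eq_iff)
  have VR: "V n = R.V n" for n using V V' by (auto simp: R.V_def fun_eq_iff)
  have V'R: "V' n \<omega> = fst (R.V n \<omega>)" for n \<omega> using V' by (simp add: R.V_def)
  have ds: "real n * t n ^ CARD('m) = R.degree_scale n" for n by (simp add: R.degree_scale_def)
  have X_meas: "X n \<in> measurable P (count_space UNIV)" if "1 \<le> n" for n
    using X_indep that unfolding indep_rv_def by blast
  \<comment> \<open>Independence of the Poisson vector and the normal variable turns expectations into iterated integrals.\<close>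
  have H1_law: "(\<integral>\<omega>. \<psi> (W \<omega>, Z \<omega>) \<partial>P) = (\<integral>x. measure_pmf.expectation p (\<lambda>v. \<psi> (v, x)) * \<rho> x \<partial>lborel)"
    if \<psi>: "\<psi> \<in> H1" and W: "distr P (count_space UNIV) W = measure_pmf p" "indep_rv P (count_space UNIV) W borel Z"
    for \<psi> :: "(nat ^ 'd) \<times> real \<Rightarrow> real" and W p
  proof (rule indep_discrete_normal_integral[OF P W Z_normal])
    show "\<bar>\<psi> z\<bar> \<le> 1" for z using \<psi> unfolding H1_def by blast
    show "(\<lambda>x. \<psi> (v, x)) \<in> borel_measurable borel" for v
      using \<psi> by (intro borel_measurable_continuous_onI lipschitz_on_continuous_on[where L = 1]) (auto simp: H1_def)
  qed
  let ?u = "\<lambda>n. real n powr - (1 / (2 * (real k - 1)))"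
    and ?w = "\<lambda>n. real n powr - ((real k - real k\<^sub>0) / (4 * (real k - 1)))"
  obtain R where R: "0 \<le> R" "\<And>n. 1 \<le> n \<Longrightarrow> sqrt (R.degree_scale n) \<le> R * ?u n"
    using R.sqrt_degree_scale_le by blast
  have s0: "0 \<le> sqrt (R.degree_scale n)" if "1 \<le> n" for n using R.degree_scale_pos[OF that] by simp
  obtain A B where AB: "\<And>n \<psi>. 1 \<le> n \<Longrightarrow> \<psi> \<in> H1 \<Longrightarrow> \<bar>(\<integral>\<omega>. \<psi> (R.V n \<omega>) \<partial>M)
        - (\<integral>x. measure_pmf.expectation (poisson_vec_pmf (R.lam n)) (\<lambda>v. \<psi> (v, x)) * \<rho> x \<partial>lborel)\<bar>
      \<le> A * sqrt (R.degree_scale n) + B * ?w n"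
    using R.mixed_rate by blast
  have "(\<lambda>_. 0) \<in> (H1 :: ((nat ^ 'd) \<times> real \<Rightarrow> real) set)" by (auto simp: H1_def lipschitz_on_def)
  then have H1_ne: "(H1 :: ((nat ^ 'd) \<times> real \<Rightarrow> real) set) \<noteq> {}" by blast
  have a1: "d_H1 M (V n) P (\<lambda>\<omega>. (X n \<omega>, Z \<omega>)) \<le> A * sqrt (R.degree_scale n) + B * ?w n" if n: "1 \<le> n" for n
    unfolding d_H1_def
  proof (rule cSUP_least[OF H1_ne])
    fix \<psi> :: "(nat ^ 'd) \<times> real \<Rightarrow> real" assume \<psi>: "\<psi> \<in> H1"
    have "(\<integral>\<omega>. \<psi> (X n \<omega>, Z \<omega>) \<partial>P) = (\<integral>x. measure_pmf.expectation (poisson_vec_pmf (R.lam n)) (\<lambda>v. \<psi> (v, x)) * \<rho> x \<partial>lborel)"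
      unfolding lamR[symmetric] using X_poisson X_indep n by (intro H1_law[OF \<psi>]) auto
    then show "\<bar>(\<integral>\<omega>. \<psi> (V n \<omega>) \<partial>M) - (\<integral>\<omega>. \<psi> (X n \<omega>, Z \<omega>) \<partial>P)\<bar> \<le> A * sqrt (R.degree_scale n) + B * ?w n"
      using AB[OF n \<psi>] unfolding VR by simp
  qed
  have a2: "(\<lambda>n. A * sqrt (R.degree_scale n) + B * ?w n) \<in> O(\<lambda>n. ?u n + ?w n)"
  proof (rule bigoI[where c = "\<bar>A\<bar> * R + \<bar>B\<bar>"])
    show "\<forall>\<^sub>F n in sequentially. norm (A * sqrt (R.degree_scale n) + B * ?w n) \<le> (\<bar>A\<bar> * R + \<bar>B\<bar>) * norm (?u n + ?w n)"
      using eventually_ge_at_top[of 1]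
    proof eventually_elim
      case (elim n)
      have "norm (A * sqrt (R.degree_scale n) + B * ?w n) \<le> \<bar>A\<bar> * sqrt (R.degree_scale n) + \<bar>B\<bar> * ?w n"
        using abs_triangle_ineq[of "A * sqrt (R.degree_scale n)" "B * ?w n"] s0[OF elim] by (simp add: abs_mult)
      also have "\<dots> \<le> \<bar>A\<bar> * (R * ?u n) + \<bar>B\<bar> * ?w n"
        by (intro add_right_mono mult_left_mono R(2)[OF elim]) simp
      also have "\<dots> \<le> (\<bar>A\<bar> * R) * (?u n + ?w n) + \<bar>B\<bar> * (?u n + ?w n)"
        using R(1) by (intro add_mono) (auto simp: mult.assoc[symmetric] distrib_left intro!: mult_left_mono)
      finally show ?case by (simp add: distrib_right)
    qed
  qed
  obtain l :: "real ^ 'd" and \<Lambda> :: real where l: "\<And>j. 0 < l $ j"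
    "\<And>j. (\<lambda>n. mean_count M Y N t (\<Gamma> j) n) \<longlonglongrightarrow> l $ j"
    using R.mean_limits by metis
  \<comment> \<open>The limit exists and is positive, so \<open>lim\<close> has its intended meaning.\<close>
  have la: "l = a" using a limI[OF l(2)] by (simp add: vec_eq_iff)
  have b1: "\<forall>j. (\<lambda>n. mean_count M Y N t (\<Gamma> j) n) \<longlonglongrightarrow> a $ j \<and> 0 < a $ j" using l la by blast
  have b2: "converges_in_distribution M V P (\<lambda>\<omega>. (X_lim \<omega>, Z \<omega>))"
  proof -
    have H: "(\<lambda>\<omega>. (X_lim \<omega>, Z \<omega>)) \<in> measurable P (count_space UNIV \<Otimes>\<^sub>M borel)"
      using X_lim_indep unfolding indep_rv_def by (intro measurable_Pair) auto
    \<comment> \<open>The bounds start at \<open>n = 1\<close>; shifting the index does not affect the limit.\<close>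
    have "converges_in_distribution M (\<lambda>n. V (Suc n)) P (\<lambda>\<omega>. (X_lim \<omega>, Z \<omega>))"
    proof (rule converges_in_distribution_if_H1[OF M P _ H])
      show "V (Suc n) \<in> measurable M (count_space UNIV \<Otimes>\<^sub>M borel)" for n
        unfolding VR by (rule R.V_measurable) simp
      fix \<psi> :: "(nat ^ 'd) \<times> real \<Rightarrow> real" assume \<psi>: "\<psi> \<in> H1"
      show "(\<lambda>n. \<integral>\<omega>. \<psi> (V (Suc n) \<omega>) \<partial>M) \<longlonglongrightarrow> (\<integral>\<omega>. \<psi> (X_lim \<omega>, Z \<omega>) \<partial>P)"
        unfolding H1_law[OF \<psi> X_lim_poisson X_lim_indep] VR using l R.limit_law[OF _ _ \<psi>, of a] la by blast
    qed
    then show ?thesis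
      unfolding converges_in_distribution_def
        filterlim_sequentially_Suc[where f = "\<lambda>n. \<integral>\<omega>. h (V n \<omega>) \<partial>M" for h] .
  qed
  obtain C where C: "\<And>n E. 1 \<le> n \<Longrightarrow> \<bar>measure M {\<omega> \<in> space M. fst (R.V n \<omega>) \<in> E}
      - measure (measure_pmf (poisson_vec_pmf (R.lam n))) E\<bar> \<le> C * sqrt (R.degree_scale n)"
    using R.total_variation_rate by blast
  have c1: "d_TV M (V' n) P (X n) \<le> C * sqrt (R.degree_scale n)" if n: "1 \<le> n" for n
    unfolding d_TV_def
  proof (rule cSUP_least)
    fix E :: "(nat ^ 'd) set"
    have "measure (measure_pmf (poisson_vec_pmf (R.lam n))) E = measure (distr P (count_space UNIV) (X n)) E"
      using X_poisson n unfolding lamR[symmetric] by simp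
    also have "\<dots> = measure P (X n -` E \<inter> space P)" using X_meas[OF n] by (rule measure_distr) simp
    also have "X n -` E \<inter> space P = {\<omega> \<in> space P. X n \<omega> \<in> E}" by auto
    finally show "\<bar>measure M {\<omega> \<in> space M. V' n \<omega> \<in> E} - measure P {\<omega> \<in> space P. X n \<omega> \<in> E}\<bar> \<le> C * sqrt (R.degree_scale n)"
      using C[OF n, of E] unfolding V'R by simp
  qed simp
  have c2: "(\<lambda>n. C * sqrt (R.degree_scale n)) \<in> O(?u)"
  proof (rule bigoI[where c = "\<bar>C\<bar> * R"])
    show "\<forall>\<^sub>F n in sequentially. norm (C * sqrt (R.degree_scale n)) \<le> (\<bar>C\<bar> * R) * norm (?u n)"
      using eventually_ge_at_top[of 1]
    proof eventually_elim
      case (elim n)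
      then show ?case
        using mult_left_mono[OF R(2)[OF elim], of "\<bar>C\<bar>"] s0[OF elim] by (simp add: abs_mult mult.assoc)
    qed
  qed
  have part_a: "\<exists>A B. (\<forall>n\<ge>1. d_H1 M (V n) P (\<lambda>\<omega>. (X n \<omega>, Z \<omega>)) \<le> A * sqrt (R.degree_scale n) + B * ?w n)
      \<and> (\<lambda>n. A * sqrt (R.degree_scale n) + B * ?w n) \<in> O(\<lambda>n. ?u n + ?w n)"
    by (rule exI[of _ A], rule exI[of _ B]) (intro conjI allI impI a1 a2)
  have part_c: "\<exists>C. (\<forall>n\<ge>1. d_TV M (V' n) P (X n) \<le> C * sqrt (R.degree_scale n))
      \<and> (\<lambda>n. C * sqrt (R.degree_scale n)) \<in> O(?u)"
    by (rule exI[of _ C]) (intro conjI allI impI c1 c2)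
  show ?thesis unfolding ds by (intro conjI part_a b1 b2 part_c)
qed

end
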